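(* Let $R$ be a commutative ring, let $A$ be a DG $R$-algebra, and let $B=A\langle X\mid dX=t\rangle$ be the DG $R$-algebra obtained from $A$ by the adjunction of a variable $X$ of positive even degree $|X|$ killing a homogeneous cycle $t\in A$ of degree $|X|-1$. Let $N$ be a semi-free DG $B$-module. Then: (1) If $N$ is bounded below as a graded $R$-module and $\mathrm{Ext}_B^{|X|+1}(N,N)=0$, then $N$ is liftable to $A$. (2) If $N$ is liftable to $A$ and $\mathrm{Ext}_B^{|X|}(N,N)=0$, then a lifting of $N$ is unique up to DG $A$-isomorphism; that is, any two liftings of $N$ to $A$ are isomorphic as DG $A$-modules.
   Context: DG algebras: a DG $R$-algebra is a non-negatively graded $R$-algebra $A=\bigoplus_{n\ge 0}A_n$ with an $R$-linear map $d^A$ of degree $-1$ such that $ab=(-1)^{|a||b|}ba$ for homogeneous $a,b$, $a^2=0$ if $|a|$ is odd, $(d^A)^2=0$, and $d^A(ab)=d^A(a)b+(-1)^{|a|}a\,d^A(b)$. A (left) DG $A$-module is a $\mathbb{Z}$-graded left $A$-module $M$ with an $R$-linear map $\partial^M$ of degree $-1$ such that $(\partial^M)^2=0$ and $\partial^M(am)=d^A(a)m+(-1)^{|a|}a\,\partial^M(m)$. The superscript $\natural$ denotes the underlying graded object. The tensor product $M\otimes_A N$ has differential $\partial(m\otimes n)=\partial^M(m)\otimes n+(-1)^{|m|}m\otimes\partial^N(n)$. Homomorphisms: an $R$-linear map $f$ of degree $r$ between DG $A$-modules is $A$-linear if $f(am)=(-1)^{r|a|}af(m)$; $\mathrm{Hom}_A(M,N)=\bigoplus_r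 \mathrm{Hom}_A(M,N)_r$ has differential $f\mapsto \partial^N f-(-1)^{|f|}f\partial^M$. A DG $A$-homomorphism is an $A$-linear map of degree $0$ commuting with differentials; a DG $A$-isomorphism is an invertible one. Adjunction of an even variable: for $t\in A$ a homogeneous cycle of odd degree $|X|-1$, $B=A\langle X\mid dX=t\rangle=\bigoplus_{i\ge0}X^{(i)}A$ is the divided power algebra, with $X^{(0)}=1$, $X^{(1)}=X$, $|X^{(i)}|=i|X|$, $X^{(i)}X^{(j)}=\binom{i+j}{i}X^{(i+j)}$, and differential extending $d^A$ with $d^B(X^{(i)})=tX^{(i-1)}$ for $i>0$. There is a natural inclusion $A\to B$ of DG algebras. Semi-free: a DG $B$-module $F$ is semi-free if $F^\natural$ has a graded $B^\natural$-free basis $E=\bigsqcup_{i\ge0}E_i$ with $\partial^F(E_i)\subseteq\sum_{j<i}BE_j$ for all $i\ge 0$. $\mathrm{Ext}_B^i(M,N):=H_{-i}(\mathrm{Hom}_B(F_M,N))$ for a semi-free resolution $F_M\to M$; in particular for $N$ semi-free, $\mathrm{Ext}^i_B(N,N)=H_{-i}(\mathrm{Hom}_B(N,N))$. Liftability: a DG $B$-module $N$ is liftable to $A$ if there is a DG $A$-module $M$ with $N\cong B\otimes_A M$ as DG $B$-modules; such an $M$ is called a lifting of $N$. A graded module $L$ is bounded below if $L_{-i}=0$ for all sufficiently large $i$. *)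

theory Defs
  imports
    "HOL-Algebra.Module"
    "HOL-Algebra.Coset"
    "HOL-Algebra.Generated_Groups"
    "HOL-Algebra.Elementary_Groups"
    "HOL-Algebra.Free_Abelian_Groups"
begin

section \<open>Graded objects\<close>

text \<open>
  One record serves both for DG algebras and for DG modules.  In an algebra over a ring, the
  scalar multiplication is the action of the ground ring.  In a module over a DG algebra it is the
  action of that algebra, and the fields \<open>mult\<close> and \<open>one\<close> are not used
  (as in the library's treatment of modules).
\<close>

record ('a, 'm) dg = "('a, 'm) module" +
  homog :: "int \<Rightarrow> 'm set"
  diff :: "'m \<Rightarrow> 'm"

definition is_decomp :: "('a, 'm) dg \<Rightarrow> 'm \<Rightarrow> (int \<Rightarrow> 'm) \<Rightarrow> bool" where
  "is_decomp M x f \<longleftrightarrow>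
     (\<forall>n. f n \<in> homog M n) \<and> finite {n. f n \<noteq> \<zero>\<^bsub>M\<^esub>} \<and>
     x = (\<Oplus>\<^bsub>M\<^esub>n \<in> {n. f n \<noteq> \<zero>\<^bsub>M\<^esub>}. f n)"

text \<open>An abelian group that is the internal direct sum of its homogeneous parts.\<close>

locale graded_group = abelian_group M for M :: "('a, 'm) dg" (structure) +
  assumes homog_subgroup: "subgroup (homog M n) (add_monoid M)"
    and decomp_ex1: "x \<in> carrier M \<Longrightarrow> \<exists>!f. is_decomp M x f"

definition component :: "('a, 'm) dg \<Rightarrow> 'm \<Rightarrow> int \<Rightarrow> 'm" where
  "component M x = (THE f. is_decomp M x f)"

text \<open>\<open>signed M k x\<close> is $(-1)^k x$.\<close>

definition signed :: "('a, 'm) dg \<Rightarrow> int \<Rightarrow> 'm \<Rightarrow> 'm" where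
  "signed M k x = (if even k then x else \<ominus>\<^bsub>M\<^esub> x)"

text \<open>The additive map with $b \mapsto (-1)^{|b|} b$ on homogeneous elements.\<close>

definition sign_twist :: "('a, 'm) dg \<Rightarrow> 'm \<Rightarrow> 'm" where
  "sign_twist M x =
     (\<Oplus>\<^bsub>M\<^esub>n \<in> {n. component M x n \<noteq> \<zero>\<^bsub>M\<^esub>}. signed M n (component M x n))"


section \<open>DG algebras and DG modules\<close>

locale dg_algebra =
  fixes R :: "'r ring" and A :: "('r, 'a) dg"
  assumes cring: "cring R"
    and ring: "ring A"
    and R_module: "module R A"
    and graded: "graded_group A"
    and smult_mult_left: "\<lbrakk>r \<in> carrier R; a \<in> carrier A; b \<in> carrier A\<rbrakk>
          \<Longrightarrow> (r \<odot>\<^bsub>A\<^esub> a) \<otimes>\<^bsub>A\<^esub> b = r \<odot>\<^bsub>A\<^esub> (a \<otimes>\<^bsub>A\<^esub> b)"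
    and smult_mult_right: "\<lbrakk>r \<in> carrier R; a \<in> carrier A; b \<in> carrier A\<rbrakk>
          \<Longrightarrow> a \<otimes>\<^bsub>A\<^esub> (r \<odot>\<^bsub>A\<^esub> b) = r \<odot>\<^bsub>A\<^esub> (a \<otimes>\<^bsub>A\<^esub> b)"
    and homog_neg: "n < 0 \<Longrightarrow> homog A n = {\<zero>\<^bsub>A\<^esub>}"
    and homog_one: "\<one>\<^bsub>A\<^esub> \<in> homog A 0"
    and homog_mult: "\<lbrakk>a \<in> homog A i; b \<in> homog A j\<rbrakk> \<Longrightarrow> a \<otimes>\<^bsub>A\<^esub> b \<in> homog A (i + j)"
    and homog_smult: "\<lbrakk>r \<in> carrier R; a \<in> homog A i\<rbrakk> \<Longrightarrow> r \<odot>\<^bsub>A\<^esub> a \<in> homog A i"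
    and graded_comm: "\<lbrakk>a \<in> homog A i; b \<in> homog A j\<rbrakk>
          \<Longrightarrow> a \<otimes>\<^bsub>A\<^esub> b = signed A (i * j) (b \<otimes>\<^bsub>A\<^esub> a)"
    and odd_square: "\<lbrakk>a \<in> homog A i; odd i\<rbrakk> \<Longrightarrow> a \<otimes>\<^bsub>A\<^esub> a = \<zero>\<^bsub>A\<^esub>"
    and diff_closed: "a \<in> carrier A \<Longrightarrow> diff A a \<in> carrier A"
    and diff_add: "\<lbrakk>a \<in> carrier A; b \<in> carrier A\<rbrakk>
          \<Longrightarrow> diff A (a \<oplus>\<^bsub>A\<^esub> b) = diff A a \<oplus>\<^bsub>A\<^esub> diff A b"
    and diff_smult: "\<lbrakk>r \<in> carrier R; a \<in> carrier A\<rbrakk> \<Longrightarrow> diff A (r \<odot>\<^bsub>A\<^esub> a) = r \<odot>\<^bsub>A\<^esub> diff A a"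
    and diff_degree: "a \<in> homog A i \<Longrightarrow> diff A a \<in> homog A (i - 1)"
    and diff_diff: "a \<in> carrier A \<Longrightarrow> diff A (diff A a) = \<zero>\<^bsub>A\<^esub>"
    and leibniz: "\<lbrakk>a \<in> homog A i; b \<in> carrier A\<rbrakk>
          \<Longrightarrow> diff A (a \<otimes>\<^bsub>A\<^esub> b) = (diff A a \<otimes>\<^bsub>A\<^esub> b) \<oplus>\<^bsub>A\<^esub> signed A i (a \<otimes>\<^bsub>A\<^esub> diff A b)"

text \<open>The action of $R$ on an $A$-module is the one through the structure map $r \mapsto r 1_A$.\<close>

definition R_linear ::
    "'r ring \<Rightarrow> ('r, 'a) dg \<Rightarrow> ('a, 'm) dg \<Rightarrow> ('a, 'n) dg \<Rightarrow> ('m \<Rightarrow> 'n) \<Rightarrow> bool" where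
  "R_linear R A M N f \<longleftrightarrow>
     f \<in> carrier M \<rightarrow> carrier N \<and>
     (\<forall>x \<in> carrier M. \<forall>y \<in> carrier M. f (x \<oplus>\<^bsub>M\<^esub> y) = f x \<oplus>\<^bsub>N\<^esub> f y) \<and>
     (\<forall>r \<in> carrier R. \<forall>x \<in> carrier M.
        f ((r \<odot>\<^bsub>A\<^esub> \<one>\<^bsub>A\<^esub>) \<odot>\<^bsub>M\<^esub> x) = (r \<odot>\<^bsub>A\<^esub> \<one>\<^bsub>A\<^esub>) \<odot>\<^bsub>N\<^esub> f x)"

text \<open>The library's \<open>module\<close> locale requires a commutative ring of scalars, hence the axioms of a
  left module over the ring \<open>A\<close> are spelled out.\<close>

locale dg_module = dg_algebra R A
  for R :: "'r ring" and A :: "('r, 'a) dg" +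
  fixes M :: "('a, 'm) dg"
  assumes M_graded: "graded_group M"
    and smult_closed: "\<lbrakk>a \<in> carrier A; x \<in> carrier M\<rbrakk> \<Longrightarrow> a \<odot>\<^bsub>M\<^esub> x \<in> carrier M"
    and smult_l_distr: "\<lbrakk>a \<in> carrier A; b \<in> carrier A; x \<in> carrier M\<rbrakk>
          \<Longrightarrow> (a \<oplus>\<^bsub>A\<^esub> b) \<odot>\<^bsub>M\<^esub> x = (a \<odot>\<^bsub>M\<^esub> x) \<oplus>\<^bsub>M\<^esub> (b \<odot>\<^bsub>M\<^esub> x)"
    and smult_r_distr: "\<lbrakk>a \<in> carrier A; x \<in> carrier M; y \<in> carrier M\<rbrakk>
          \<Longrightarrow> a \<odot>\<^bsub>M\<^esub> (x \<oplus>\<^bsub>M\<^esub> y) = (a \<odot>\<^bsub>M\<^esub> x) \<oplus>\<^bsub>M\<^esub> (a \<odot>\<^bsub>M\<^esub> y)"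
    and smult_assoc: "\<lbrakk>a \<in> carrier A; b \<in> carrier A; x \<in> carrier M\<rbrakk>
          \<Longrightarrow> (a \<otimes>\<^bsub>A\<^esub> b) \<odot>\<^bsub>M\<^esub> x = a \<odot>\<^bsub>M\<^esub> (b \<odot>\<^bsub>M\<^esub> x)"
    and smult_one: "x \<in> carrier M \<Longrightarrow> \<one>\<^bsub>A\<^esub> \<odot>\<^bsub>M\<^esub> x = x"
    and M_homog_smult: "\<lbrakk>a \<in> homog A i; x \<in> homog M j\<rbrakk> \<Longrightarrow> a \<odot>\<^bsub>M\<^esub> x \<in> homog M (i + j)"
    and M_diff_linear: "R_linear R A M M (diff M)"
    and M_diff_degree: "x \<in> homog M i \<Longrightarrow> diff M x \<in> homog M (i - 1)"
    and M_diff_diff: "x \<in> carrier M \<Longrightarrow> diff M (diff M x) = \<zero>\<^bsub>M\<^esub>"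
    and M_leibniz: "\<lbrakk>a \<in> homog A i; x \<in> carrier M\<rbrakk>
          \<Longrightarrow> diff M (a \<odot>\<^bsub>M\<^esub> x) = (diff A a \<odot>\<^bsub>M\<^esub> x) \<oplus>\<^bsub>M\<^esub> signed M i (a \<odot>\<^bsub>M\<^esub> diff M x)"

definition bounded_below :: "('a, 'm) dg \<Rightarrow> bool" where
  "bounded_below M \<longleftrightarrow> (\<exists>k. \<forall>i \<ge> k. homog M (- i) = {\<zero>\<^bsub>M\<^esub>})"


section \<open>Homomorphisms and Ext\<close>

text \<open>Maps are taken extensional, so that equality of homomorphisms is equality of functions.\<close>

definition Hom ::
    "'r ring \<Rightarrow> ('r, 'a) dg \<Rightarrow> ('a, 'm) dg \<Rightarrow> ('a, 'n) dg \<Rightarrow> int \<Rightarrow> ('m \<Rightarrow> 'n) set" where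
  "Hom R A M N r =
     {f \<in> extensional (carrier M).
        R_linear R A M N f \<and>
        (\<forall>n. f ` homog M n \<subseteq> homog N (n + r)) \<and>
        (\<forall>i. \<forall>a \<in> homog A i. \<forall>x \<in> carrier M.
           f (a \<odot>\<^bsub>M\<^esub> x) = signed N (r * i) (a \<odot>\<^bsub>N\<^esub> f x))}"

definition Hom_group ::
    "'r ring \<Rightarrow> ('r, 'a) dg \<Rightarrow> ('a, 'm) dg \<Rightarrow> ('a, 'n) dg \<Rightarrow> int \<Rightarrow> ('m \<Rightarrow> 'n) monoid" where
  "Hom_group R A M N r =
     \<lparr>carrier = Hom R A M N r,
      monoid.mult = (\<lambda>f g. \<lambda>x \<in> carrier M. f x \<oplus>\<^bsub>N\<^esub> g x),
      one = (\<lambda>x \<in> carrier M. \<zero>\<^bsub>N\<^esub>)\<rparr>"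

definition Hom_diff ::
    "('a, 'm) dg \<Rightarrow> ('a, 'n) dg \<Rightarrow> int \<Rightarrow> ('m \<Rightarrow> 'n) \<Rightarrow> ('m \<Rightarrow> 'n)" where
  "Hom_diff M N r f = (\<lambda>x \<in> carrier M. diff N (f x) \<ominus>\<^bsub>N\<^esub> signed N r (f (diff M x)))"

definition Hom_cycles ::
    "'r ring \<Rightarrow> ('r, 'a) dg \<Rightarrow> ('a, 'm) dg \<Rightarrow> ('a, 'n) dg \<Rightarrow> int \<Rightarrow> ('m \<Rightarrow> 'n) set" where
  "Hom_cycles R A M N r =
     {f \<in> Hom R A M N r. Hom_diff M N r f = (\<lambda>x \<in> carrier M. \<zero>\<^bsub>N\<^esub>)}"

definition Hom_boundaries ::
    "'r ring \<Rightarrow> ('r, 'a) dg \<Rightarrow> ('a, 'm) dg \<Rightarrow> ('a, 'n) dg \<Rightarrow> int \<Rightarrow> ('m \<Rightarrow> 'n) set" where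
  "Hom_boundaries R A M N r = Hom_diff M N (r + 1) ` Hom R A M N (r + 1)"

definition Hom_homology ::
    "'r ring \<Rightarrow> ('r, 'a) dg \<Rightarrow> ('a, 'm) dg \<Rightarrow> ('a, 'n) dg \<Rightarrow> int \<Rightarrow> ('m \<Rightarrow> 'n) set monoid" where
  "Hom_homology R A M N r =
     (Hom_group R A M N r)\<lparr>carrier := Hom_cycles R A M N r\<rparr> Mod Hom_boundaries R A M N r"

text \<open>$\mathrm{Ext}^i_A(M,N)$ for a semi-free DG module \<open>M\<close>, which is a semi-free resolution of
  itself.  For other \<open>M\<close> a resolution would have to be inserted.\<close>

definition Ext ::
    "'r ring \<Rightarrow> ('r, 'a) dg \<Rightarrow> ('a, 'm) dg \<Rightarrow> ('a, 'n) dg \<Rightarrow> int \<Rightarrow> ('m \<Rightarrow> 'n) set monoid" where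
  "Ext R A M N i = Hom_homology R A M N (- i)"

definition dg_hom ::
    "'r ring \<Rightarrow> ('r, 'a) dg \<Rightarrow> ('a, 'm) dg \<Rightarrow> ('a, 'n) dg \<Rightarrow> ('m \<Rightarrow> 'n) set" where
  "dg_hom R A M N = {f \<in> Hom R A M N 0. \<forall>x \<in> carrier M. f (diff M x) = diff N (f x)}"

definition dg_isomorphic ::
    "'r ring \<Rightarrow> ('r, 'a) dg \<Rightarrow> ('a, 'm) dg \<Rightarrow> ('a, 'n) dg \<Rightarrow> bool" where
  "dg_isomorphic R A M N \<longleftrightarrow>
     (\<exists>f \<in> dg_hom R A M N. \<exists>g \<in> dg_hom R A N M.
        (\<forall>x \<in> carrier M. g (f x) = x) \<and> (\<forall>y \<in> carrier N. f (g y) = y))"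


section \<open>Semi-free modules\<close>

definition lin_comb :: "('a, 'm) dg \<Rightarrow> ('m \<Rightarrow> 'a) \<Rightarrow> 'm set \<Rightarrow> 'm" where
  "lin_comb M c S = (\<Oplus>\<^bsub>M\<^esub>e \<in> S. c e \<odot>\<^bsub>M\<^esub> e)"

definition lin_span :: "('r, 'a) dg \<Rightarrow> ('a, 'm) dg \<Rightarrow> 'm set \<Rightarrow> 'm set" where
  "lin_span A M E = {lin_comb M c S | c S. finite S \<and> S \<subseteq> E \<and> c \<in> S \<rightarrow> carrier A}"

definition graded_free_basis :: "('r, 'a) dg \<Rightarrow> ('a, 'm) dg \<Rightarrow> 'm set \<Rightarrow> bool" where
  "graded_free_basis A M E \<longleftrightarrow>
     E \<subseteq> (\<Union>n. homog M n) \<and>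
     (\<forall>x \<in> carrier M. \<exists>!c.
        c \<in> E \<rightarrow> carrier A \<and> (\<forall>e. e \<notin> E \<longrightarrow> c e = \<zero>\<^bsub>A\<^esub>) \<and> finite {e. c e \<noteq> \<zero>\<^bsub>A\<^esub>} \<and>
        x = lin_comb M c {e. c e \<noteq> \<zero>\<^bsub>A\<^esub>})"

definition semi_free :: "('r, 'a) dg \<Rightarrow> ('a, 'm) dg \<Rightarrow> bool" where
  "semi_free A M \<longleftrightarrow>
     (\<exists>E :: nat \<Rightarrow> 'm set.
        (\<forall>i j. i \<noteq> j \<longrightarrow> E i \<inter> E j = {}) \<and>
        graded_free_basis A M (\<Union>i. E i) \<and>
        (\<forall>i. diff M ` E i \<subseteq> lin_span A M (\<Union>j \<in> {..<i}. E j)))"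


section \<open>Adjunction of an even variable\<close>

text \<open>
  For even \<open>w = |X|\<close>, the algebra $A\langle X \mid dX = t\rangle$.  A finitely supported
  function \<open>f\<close> stands for $\sum_i X^{(i)} f(i)$.  As \<open>w\<close> is even, the divided powers
  commute with $A$ without signs, and $d(X^{(i)} a) = X^{(i-1)} t a + X^{(i)} d a$.
\<close>

definition adjoin_even :: "('r, 'a) dg \<Rightarrow> int \<Rightarrow> 'a \<Rightarrow> ('r, nat \<Rightarrow> 'a) dg" where
  "adjoin_even A w t =
     (let C = {f. (\<forall>i. f i \<in> carrier A) \<and> finite {i. f i \<noteq> \<zero>\<^bsub>A\<^esub>}} in
     \<lparr>carrier = C,
      monoid.mult = (\<lambda>f g n. \<Oplus>\<^bsub>A\<^esub>i \<in> {..n}. add_pow A (n choose i) (f i \<otimes>\<^bsub>A\<^esub> g (n - i))),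
      one = (\<lambda>i. if i = 0 then \<one>\<^bsub>A\<^esub> else \<zero>\<^bsub>A\<^esub>),
      ring.zero = (\<lambda>i. \<zero>\<^bsub>A\<^esub>),
      add = (\<lambda>f g i. f i \<oplus>\<^bsub>A\<^esub> g i),
      smult = (\<lambda>r f i. r \<odot>\<^bsub>A\<^esub> f i),
      homog = (\<lambda>n. {f \<in> C. \<forall>i. f i \<in> homog A (n - int i * w)}),
      diff = (\<lambda>f i. diff A (f i) \<oplus>\<^bsub>A\<^esub> (t \<otimes>\<^bsub>A\<^esub> f (Suc i)))\<rparr>)"

definition adjoin_incl :: "('r, 'a) dg \<Rightarrow> 'a \<Rightarrow> (nat \<Rightarrow> 'a)" where
  "adjoin_incl A a = (\<lambda>i. if i = 0 then a else \<zero>\<^bsub>A\<^esub>)"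


section \<open>Tensor product along a DG algebra homomorphism\<close>

text \<open>
  For a homomorphism \<open>\<phi>\<close> from \<open>A\<close> to \<open>B\<close>, the DG \<open>B\<close>-module $B \otimes_A M$ is the
  free abelian group on pairs \<open>(b, m)\<close> modulo the bilinearity and balancing relations.  The
  operations on the quotient are induced from additive maps of the free abelian group that
  preserve the relations.
\<close>

definition tensor_free ::
    "('r, 'b) dg \<Rightarrow> ('a, 'm) dg \<Rightarrow> (('b \<times> 'm) \<Rightarrow>\<^sub>0 int) monoid" where
  "tensor_free B M = free_Abelian_group (carrier B \<times> carrier M)"

definition tensor_rels ::
    "('r, 'a) dg \<Rightarrow> ('r, 'b) dg \<Rightarrow> ('a \<Rightarrow> 'b) \<Rightarrow> ('a, 'm) dg \<Rightarrow> (('b \<times> 'm) \<Rightarrow>\<^sub>0 int) set" where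
  "tensor_rels A B \<phi> M = generate (tensor_free B M)
     ({frag_of (b \<oplus>\<^bsub>B\<^esub> b', m) - frag_of (b, m) - frag_of (b', m) | b b' m.
         b \<in> carrier B \<and> b' \<in> carrier B \<and> m \<in> carrier M} \<union>
      {frag_of (b, m \<oplus>\<^bsub>M\<^esub> m') - frag_of (b, m) - frag_of (b, m') | b m m'.
         b \<in> carrier B \<and> m \<in> carrier M \<and> m' \<in> carrier M} \<union>
      {frag_of (b \<otimes>\<^bsub>B\<^esub> \<phi> a, m) - frag_of (b, a \<odot>\<^bsub>M\<^esub> m) | b a m.
         b \<in> carrier B \<and> a \<in> carrier A \<and> m \<in> carrier M})"

definition tensor_class ::
    "('r, 'a) dg \<Rightarrow> ('r, 'b) dg \<Rightarrow> ('a \<Rightarrow> 'b) \<Rightarrow> ('a, 'm) dg \<Rightarrow>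
     (('b \<times> 'm) \<Rightarrow>\<^sub>0 int) \<Rightarrow> (('b \<times> 'm) \<Rightarrow>\<^sub>0 int) set" where
  "tensor_class A B \<phi> M u = tensor_rels A B \<phi> M #>\<^bsub>tensor_free B M\<^esub> u"

definition tensor ::
    "('r, 'a) dg \<Rightarrow> ('r, 'b) dg \<Rightarrow> ('a \<Rightarrow> 'b) \<Rightarrow> ('a, 'm) dg \<Rightarrow>
     ('b, (('b \<times> 'm) \<Rightarrow>\<^sub>0 int) set) dg" where
  "tensor A B \<phi> M =
     (let Q = tensor_free B M Mod tensor_rels A B \<phi> M;
          cls = tensor_class A B \<phi> M
      in
     \<lparr>carrier = carrier Q,
      monoid.mult = undefined,
      one = undefined,
      ring.zero = one Q,
      add = monoid.mult Q,
      smult = (\<lambda>b C. \<Union>u \<in> C. cls (frag_extend (\<lambda>(b', m). frag_of (b \<otimes>\<^bsub>B\<^esub> b', m)) u)),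
      homog = (\<lambda>n. cls ` generate (tensor_free B M)
                 {frag_of (b, m) | b m i j. b \<in> homog B i \<and> m \<in> homog M j \<and> i + j = n}),
      diff = (\<lambda>C. \<Union>u \<in> C. cls (frag_extend
                 (\<lambda>(b, m). frag_of (diff B b, m) + frag_of (sign_twist B b, diff M m)) u))\<rparr>)"


section \<open>Liftings\<close>

definition is_lifting ::
    "'r ring \<Rightarrow> ('r, 'a) dg \<Rightarrow> ('r, 'b) dg \<Rightarrow> ('a \<Rightarrow> 'b) \<Rightarrow> ('b, 'n) dg \<Rightarrow> ('a, 'm) dg \<Rightarrow> bool" where
  "is_lifting R A B \<phi> N M \<longleftrightarrow>
     dg_module R A M \<and> dg_isomorphic R B N (tensor A B \<phi> M)"

text \<open>
  A quantifier cannot range over types, so the lifting is sought with elements in the type of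
  \<open>N\<close>.  For $B = A\langle X \mid dX = t\rangle$ this is no restriction: \<open>M\<close> is isomorphic
  to its image $1 \otimes M$, a DG $A$-submodule of $B \otimes_A M \cong N$.
\<close>

definition liftable ::
    "'r ring \<Rightarrow> ('r, 'a) dg \<Rightarrow> ('r, 'b) dg \<Rightarrow> ('a \<Rightarrow> 'b) \<Rightarrow> ('b, 'n) dg \<Rightarrow> bool" where
  "liftable R A B \<phi> N \<longleftrightarrow> (\<exists>M :: ('a, 'n) dg. is_lifting R A B \<phi> N M)"

end

theory Submission
  imports Defs
begin

text \<open>
  The derivation $d/dX$ of $B$, which sends $X^{(i)}$ to $X^{(i-1)}$, commutes with $d^B$ and kills $A$.
  A basis of \<open>N\<close> extends it to a derivation $D_0$ of \<open>N\<close>, of degree $-|X|$.  The commutator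
  $\partial D_0 - D_0 \partial$ is $B$-linear and a cycle of degree $-|X|-1$, so it is the boundary
  of some $h$, and $D = D_0 - h$ commutes with $\partial$.  If \<open>N\<close> is bounded below, then $D$ is
  locally nilpotent, and subtracting $X^{(k)} D^k x$ repeatedly writes every $x$ uniquely as
  $\sum X^{(i)} m_i$ with $m_i \in \ker D$.  Hence $\ker D$ is a lifting.

  Conversely a lifting $M_k$ gives an embedding $j_k : M_k \to N$, the map $c_k : N \to M_k$ with
  $X \mapsto 0$, and a derivation $D_k$ commuting with $\partial$.  For two liftings,
  $D_1 - D_2$ is a cycle of degree $-|X|$, hence equal to $\partial h + h \partial$.  The map
  $c_2 j_1$ is an isomorphism of graded modules but not a chain map.  Since $t^2 = 0$, the map
  $c_2 j_1 + t c_2 h j_1$ is a chain map with inverse $c_1 j_2 - t c_1 h j_2$.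
\<close>

section \<open>Additive maps and graded groups\<close>

text \<open>Two properties of $d/dX$ carry both halves. It commutes with $d^B$, so in the commutator
  of $D_0$ with the differential all terms that differentiate a scalar cancel. And on divided powers
  it introduces no integer factor, so for \<open>m\<close> in the kernel of \<open>D\<close> the map
  $D^k$ recovers \<open>m\<close> from $X^{(k)} m$ in any characteristic.

  The obstacle to uniqueness is that X \<mapsto> 0 is a ring map from \<open>B\<close> to
  \<open>A\<close> but not a chain map, since $dX = t$. Hence \<open>c2\<close> commutes with the
  differentials only up to \<open>t c2 D2\<close>. As \<open>D1\<close> vanishes on the image of
  \<open>j1\<close>, the defect of \<open>c2 j1\<close> is \<open>t c2 (D1 - D2) j1\<close>, and the
  homotopy \<open>h\<close> turns it into the defect of a correction term with coefficient
  \<open>t\<close>. Every second-order term then contains $t^2$, which is zero because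
  \<open>t\<close> has odd degree.

  A technical obstacle is the tensor product, a quotient of a free Abelian group whose homogeneous
  parts are given by generators. Its maps come from the universal property and are compared on pure
  tensors, and degrees are followed through generators, without first establishing that it is the
  direct sum of its homogeneous parts.\<close>

definition additive :: "('a, 'm) ring_scheme \<Rightarrow> ('b, 'n) ring_scheme \<Rightarrow> ('a \<Rightarrow> 'b) \<Rightarrow> bool" where
  "additive M N f \<longleftrightarrow> abelian_group M \<and> abelian_group N \<and> f \<in> carrier M \<rightarrow> carrier N \<and>
     (\<forall>x \<in> carrier M. \<forall>y \<in> carrier M. f (x \<oplus>\<^bsub>M\<^esub> y) = f x \<oplus>\<^bsub>N\<^esub> f y)"

lemma additiveI:
  assumes "abelian_group M" "abelian_group N" "\<And>x. x \<in> carrier M \<Longrightarrow> f x \<in> carrier N"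
    "\<And>x y. \<lbrakk>x \<in> carrier M; y \<in> carrier M\<rbrakk> \<Longrightarrow> f (x \<oplus>\<^bsub>M\<^esub> y) = f x \<oplus>\<^bsub>N\<^esub> f y"
  shows "additive M N f"
  using assms by (auto simp: additive_def)

lemma additive_closed: "additive M N f \<Longrightarrow> x \<in> carrier M \<Longrightarrow> f x \<in> carrier N"
  by (auto simp: additive_def)

lemma additive_add:
  "additive M N f \<Longrightarrow> x \<in> carrier M \<Longrightarrow> y \<in> carrier M \<Longrightarrow> f (x \<oplus>\<^bsub>M\<^esub> y) = f x \<oplus>\<^bsub>N\<^esub> f y"
  by (auto simp: additive_def)

lemma additive_dom: "additive M N f \<Longrightarrow> abelian_group M"
  and additive_cod: "additive M N f \<Longrightarrow> abelian_group N"
  by (auto simp: additive_def)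

lemma additive_zero:
  assumes f: "additive M N f" shows "f \<zero>\<^bsub>M\<^esub> = \<zero>\<^bsub>N\<^esub>"
proof -
  interpret M: abelian_group M using additive_dom[OF f] .
  interpret N: abelian_group N using additive_cod[OF f] .
  have "f \<zero>\<^bsub>M\<^esub> \<oplus>\<^bsub>N\<^esub> f \<zero>\<^bsub>M\<^esub> = f \<zero>\<^bsub>M\<^esub>"
    using additive_add[OF f, of "\<zero>\<^bsub>M\<^esub>" "\<zero>\<^bsub>M\<^esub>"] by simp
  then show ?thesis using additive_closed[OF f, of "\<zero>\<^bsub>M\<^esub>"] by simp
qed

lemma additive_uminus:
  assumes f: "additive M N f" and x: "x \<in> carrier M" shows "f (\<ominus>\<^bsub>M\<^esub> x) = \<ominus>\<^bsub>N\<^esub> f x"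
proof -
  interpret M: abelian_group M using additive_dom[OF f] .
  interpret N: abelian_group N using additive_cod[OF f] .
  have "f (\<ominus>\<^bsub>M\<^esub> x) \<oplus>\<^bsub>N\<^esub> f x = \<zero>\<^bsub>N\<^esub>"
    using additive_add[OF f, of "\<ominus>\<^bsub>M\<^esub> x" x] additive_zero[OF f] x by (simp add: M.l_neg)
  then show ?thesis using additive_closed[OF f] x by (simp add: N.minus_equality)
qed

lemma additive_minus:
  assumes f: "additive M N f" and x: "x \<in> carrier M" and y: "y \<in> carrier M"
  shows "f (x \<ominus>\<^bsub>M\<^esub> y) = f x \<ominus>\<^bsub>N\<^esub> f y"
proof -
  interpret M: abelian_group M using additive_dom[OF f] .
  show ?thesis
    using x y additive_uminus[OF f y] additive_add[OF f, of x "\<ominus>\<^bsub>M\<^esub> y"] by (simp add: a_minus_def)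
qed

lemma additive_finsum:
  assumes f: "additive M N f" and "g \<in> S \<rightarrow> carrier M"
  shows "f (finsum M g S) = finsum N (\<lambda>i. f (g i)) S"
proof -
  interpret M: abelian_group M using additive_dom[OF f] .
  interpret N: abelian_group N using additive_cod[OF f] .
  show ?thesis using assms(2)
  proof (induction S rule: infinite_finite_induct)
    case (insert i S)
    have "(\<lambda>i. f (g i)) \<in> S \<rightarrow> carrier N" "f (g i) \<in> carrier N"
      using insert.prems additive_closed[OF f] by (auto simp: Pi_def)
    then show ?case using insert additive_add[OF f, of "g i" "finsum M g S"] by simp
  qed (use additive_zero[OF f] in simp_all)
qed

lemma additive_comp:
  "additive M N f \<Longrightarrow> additive N L g \<Longrightarrow> additive M L (\<lambda>x. g (f x))"
  by (auto simp: additive_def Pi_def)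

lemma additive_plus:
  assumes f: "additive M N f" and g: "additive M N g"
  shows "additive M N (\<lambda>x. f x \<oplus>\<^bsub>N\<^esub> g x)"
proof -
  interpret N: abelian_group N using additive_cod[OF f] .
  show ?thesis
    using additive_closed[OF f] additive_closed[OF g] additive_add[OF f] additive_add[OF g]
      additive_dom[OF f]
    by (intro additiveI) (auto simp: N.a_ac intro: N.abelian_group_axioms)
qed

lemma additive_neg:
  assumes f: "additive M N f"
  shows "additive M N (\<lambda>x. \<ominus>\<^bsub>N\<^esub> f x)"
proof -
  interpret N: abelian_group N using additive_cod[OF f] .
  show ?thesis
    using additive_closed[OF f] additive_add[OF f] additive_dom[OF f]
    by (intro additiveI) (auto simp: N.minus_add intro: N.abelian_group_axioms)
qed

lemma additive_diff:
  assumes "additive M N f" "additive M N g"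
  shows "additive M N (\<lambda>x. f x \<ominus>\<^bsub>N\<^esub> g x)"
  unfolding a_minus_def by (rule additive_plus[OF assms(1) additive_neg[OF assms(2)]])

lemma additive_id: "abelian_group M \<Longrightarrow> additive M M (\<lambda>x. x)"
  by (auto simp: additive_def)

lemma additive_funpow: "additive M M f \<Longrightarrow> additive M M (f ^^ k)"
proof (induction k)
  case 0
  then show ?case by (auto simp: additive_def)
next
  case (Suc k)
  then show ?case using additive_comp[of M M "f ^^ k" M f] by (simp add: comp_def)
qed

lemma additive_cong:
  assumes "additive M N f" "\<And>x. x \<in> carrier M \<Longrightarrow> g x = f x"
  shows "additive M N g"
proof -
  interpret M: abelian_group M using additive_dom[OF assms(1)] .
  show ?thesis
    using assms by (intro additiveI) (auto simp: additive_def)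
qed

lemma signed_even: "even k \<Longrightarrow> signed M k x = x"
  by (simp add: signed_def)

lemma signed_closed: "abelian_group M \<Longrightarrow> x \<in> carrier M \<Longrightarrow> signed M k x \<in> carrier M"
  by (simp add: signed_def abelian_group.a_inv_closed)

lemma additive_signed: "additive M N f \<Longrightarrow> additive M N (\<lambda>x. signed N k (f x))"
  by (cases "even k") (simp_all add: signed_def additive_neg)

lemma additive_apply_signed:
  assumes "additive M N f" "x \<in> carrier M"
  shows "f (signed M k x) = signed N k (f x)"
  using additive_uminus[OF assms] by (simp add: signed_def)

lemma signed_add:
  "abelian_group M \<Longrightarrow> x \<in> carrier M \<Longrightarrow> y \<in> carrier M
    \<Longrightarrow> signed M k (x \<oplus>\<^bsub>M\<^esub> y) = signed M k x \<oplus>\<^bsub>M\<^esub> signed M k y"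
  by (simp add: signed_def abelian_group.minus_add)

lemma signed_signed:
  "abelian_group M \<Longrightarrow> x \<in> carrier M \<Longrightarrow> signed M k (signed M l x) = signed M (k + l) x"
  by (auto simp: signed_def abelian_group.minus_minus)

section \<open>Homogeneous components\<close>

context graded_group
begin

lemma homog_closed: "x \<in> homog M n \<Longrightarrow> x \<in> carrier M"
  using subgroup.mem_carrier[OF homog_subgroup] by fastforce

lemma homog_zero: "\<zero> \<in> homog M n"
  using subgroup.one_closed[OF homog_subgroup] by simp

lemma homog_add: "x \<in> homog M n \<Longrightarrow> y \<in> homog M n \<Longrightarrow> x \<oplus> y \<in> homog M n"
  using subgroup.m_closed[OF homog_subgroup] by fastforce

lemma homog_uminus: "x \<in> homog M n \<Longrightarrow> \<ominus> x \<in> homog M n"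
  using subgroup.m_inv_closed[OF homog_subgroup] by (fastforce simp: a_inv_def)

lemma homog_minus: "x \<in> homog M n \<Longrightarrow> y \<in> homog M n \<Longrightarrow> x \<ominus> y \<in> homog M n"
  by (simp add: a_minus_def homog_add homog_uminus)

lemma homog_finsum: "(\<And>i. i \<in> S \<Longrightarrow> f i \<in> homog M n) \<Longrightarrow> finsum M f S \<in> homog M n"
proof (induction S rule: infinite_finite_induct)
  case (insert i S)
  then have "f \<in> S \<rightarrow> carrier M" "f i \<in> carrier M" by (auto intro: homog_closed)
  with insert show ?case by (auto intro: homog_add)
qed (simp_all add: homog_zero)

text \<open>Any finite index set that covers the support will do, so two decompositions can be added
  over the union of their supports.\<close>

lemma is_decompI:
  assumes "\<And>n. f n \<in> homog M n" "finite S" "\<And>n. n \<notin> S \<Longrightarrow> f n = \<zero>" "x = finsum M f S"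
  shows "is_decomp M x f"
proof -
  have "finsum M f {n. f n \<noteq> \<zero>} = finsum M f S"
    using assms homog_closed by (intro add.finprod_mono_neutral_cong_left) auto
  moreover have "finite {n. f n \<noteq> \<zero>}"
    by (rule finite_subset[OF _ assms(2)]) (use assms(3) in auto)
  ultimately show ?thesis using assms by (simp add: is_decomp_def)
qed

lemma component_decomp: "x \<in> carrier M \<Longrightarrow> is_decomp M x (component M x)"
  unfolding component_def by (rule theI'[OF decomp_ex1])

lemma component_eqI: "is_decomp M x f \<Longrightarrow> component M x = f"
proof -
  assume f: "is_decomp M x f"
  then have "x \<in> carrier M"
    using homog_closed by (auto simp: is_decomp_def Pi_def intro!: finsum_closed)
  with f show ?thesis
    using component_decomp decomp_ex1 by blast
qed

lemma component_homog: "x \<in> carrier M \<Longrightarrow> component M x n \<in> homog M n"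
  using component_decomp by (auto simp: is_decomp_def)

lemma component_closed: "x \<in> carrier M \<Longrightarrow> component M x n \<in> carrier M"
  by (rule homog_closed[OF component_homog])

lemma component_finite: "x \<in> carrier M \<Longrightarrow> finite {n. component M x n \<noteq> \<zero>}"
  using component_decomp by (auto simp: is_decomp_def)

lemma component_sum:
  "x \<in> carrier M \<Longrightarrow> finsum M (component M x) {n. component M x n \<noteq> \<zero>} = x"
  using component_decomp by (auto simp: is_decomp_def)

lemma component_of_homog:
  assumes "x \<in> homog M n" shows "component M x k = (if k = n then x else \<zero>)"
proof -
  have "finsum M (\<lambda>k. if k = n then x else \<zero>) {n} = x"
    using homog_closed[OF assms] by simp
  then have "is_decomp M x (\<lambda>k. if k = n then x else \<zero>)"
    using assms by (intro is_decompI[of _ "{n}"]) (auto simp: homog_zero)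
  then show ?thesis by (simp add: component_eqI)
qed

lemma component_zero: "component M \<zero> k = \<zero>"
  using component_of_homog[OF homog_zero[of k], of k] by simp

lemma component_sum_superset:
  assumes "x \<in> carrier M" "finite S" "{n. component M x n \<noteq> \<zero>} \<subseteq> S"
  shows "finsum M (component M x) S = x"
proof -
  have "finsum M (component M x) {n. component M x n \<noteq> \<zero>} = finsum M (component M x) S"
    using assms component_closed by (intro add.finprod_mono_neutral_cong_left) auto
  then show ?thesis using component_sum[OF assms(1)] by simp
qed

lemma component_add:
  assumes x: "x \<in> carrier M" and y: "y \<in> carrier M"
  shows "component M (x \<oplus> y) n = component M x n \<oplus> component M y n"
proof -
  let ?S = "{n. component M x n \<noteq> \<zero>} \<union> {n. component M y n \<noteq> \<zero>}"
  have S: "finite ?S" using component_finite x y by simp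
  have "is_decomp M (x \<oplus> y) (\<lambda>n. component M x n \<oplus> component M y n)"
  proof (rule is_decompI[OF _ S])
    have "finsum M (component M x) ?S = x" "finsum M (component M y) ?S = y"
      using x y S by (auto intro!: component_sum_superset)
    then show "x \<oplus> y = (\<Oplus>n\<in>?S. component M x n \<oplus> component M y n)"
      using component_closed x y by (subst finsum_addf) auto
  qed (use component_homog x y homog_add in auto)
  then show ?thesis by (simp add: component_eqI)
qed

lemma additive_component: "additive M M (\<lambda>x. component M x n)"
  by (auto intro!: additiveI component_closed component_add abelian_group_axioms)

lemma homog_induct [consumes 1, case_names zero homog add]:
  assumes x: "x \<in> carrier M" and "P \<zero>" "\<And>n y. y \<in> homog M n \<Longrightarrow> P y"
    and add: "\<And>y z. \<lbrakk>y \<in> carrier M; z \<in> carrier M; P y; P z\<rbrakk> \<Longrightarrow> P (y \<oplus> z)"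
  shows "P x"
proof -
  have "P (finsum M (component M x) S)" if "finite S" for S
    using that
  proof (induction S)
    case (insert n S)
    then show ?case
      using component_homog[OF x] component_closed[OF x] assms(3) by (auto intro!: add)
  qed (simp add: \<open>P \<zero>\<close>)
  then show ?thesis using component_sum[OF x] component_finite[OF x] by metis
qed

end

text \<open>Both sides are additive in \<open>x\<close>, and for homogeneous \<open>x\<close> each
  is \<open>f x\<close> or zero. The rule makes the kernel of a homogeneous map graded and extracts
  one degree from an expansion in a basis.\<close>

lemma component_additive_homog:
  assumes M: "graded_group M" and N: "graded_group N" and f: "additive M N f"
    and deg: "\<And>n x. x \<in> homog M n \<Longrightarrow> f x \<in> homog N (n + r)" and x: "x \<in> carrier M"
  shows "component N (f x) (n + r) = f (component M x n)"
proof -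
  interpret M: graded_group M by fact
  interpret N: graded_group N by fact
  show ?thesis using x
  proof (induction x rule: M.homog_induct)
    case zero
    then show ?case
      using additive_zero[OF f] by (simp add: N.component_zero M.component_zero)
  next
    case (homog k y)
    then show ?case
      using additive_zero[OF f] by (simp add: M.component_of_homog N.component_of_homog[OF deg])
  next
    case (add y z)
    then show ?case
      using additive_add[OF f] additive_closed[OF f]
      by (simp add: M.component_add N.component_add M.component_closed)
  qed
qed

text \<open>Signs are attached to homogeneous elements only. This rule is the passage from an
  identity with signs on homogeneous elements to all elements.\<close>

lemma additive_eqI:
  assumes "graded_group M" "additive M N f" "additive M N g"
    and "\<And>n x. x \<in> homog M n \<Longrightarrow> f x = g x" and x: "x \<in> carrier M"
  shows "f x = g x"
proof -
  interpret M: graded_group M by fact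
  show ?thesis using x
  proof (induction x rule: M.homog_induct)
    case zero
    then show ?case using additive_zero assms(2,3) by metis
  qed (use assms additive_add in \<open>metis+\<close>)
qed

section \<open>The sign twist by degree\<close>

context graded_group
begin

lemma sign_twist_superset:
  assumes "x \<in> carrier M" "finite S" "{n. component M x n \<noteq> \<zero>} \<subseteq> S"
  shows "sign_twist M x = (\<Oplus>n\<in>S. signed M n (component M x n))"
  unfolding sign_twist_def
  using assms component_closed
  by (intro add.finprod_mono_neutral_cong_left)
    (auto simp: signed_closed abelian_group_axioms signed_def)

lemma sign_twist_homog: "x \<in> homog M n \<Longrightarrow> sign_twist M x = signed M n x"
  using homog_closed signed_closed[OF abelian_group_axioms]
  by (subst sign_twist_superset[of _ "{n}"]) (auto simp: component_of_homog)

lemma additive_sign_twist: "additive M M (sign_twist M)"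
proof (rule additiveI)
  fix x assume "x \<in> carrier M"
  then show "sign_twist M x \<in> carrier M"
    unfolding sign_twist_def
    by (intro finsum_closed) (auto simp: component_closed signed_closed abelian_group_axioms)
next
  fix x y assume x: "x \<in> carrier M" and y: "y \<in> carrier M"
  let ?S = "{n. component M x n \<noteq> \<zero>} \<union> {n. component M y n \<noteq> \<zero>}"
  have S: "finite ?S" using component_finite x y by simp
  have xy: "{n. component M (x \<oplus> y) n \<noteq> \<zero>} \<subseteq> ?S"
    using x y by (auto simp: component_add)
  have "sign_twist M (x \<oplus> y)
      = (\<Oplus>n\<in>?S. signed M n (component M x n) \<oplus> signed M n (component M y n))"
    using x y S xy
    by (subst sign_twist_superset[of _ ?S])
      (auto intro!: finsum_cong' simp: component_add component_closed signed_add signed_closed abelian_group_axioms)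
  also have "\<dots> = sign_twist M x \<oplus> sign_twist M y"
    using x y S
    by (subst finsum_addf)
      (auto simp: component_closed signed_closed abelian_group_axioms sign_twist_superset[of _ ?S])
  finally show "sign_twist M (x \<oplus> y) = sign_twist M x \<oplus> sign_twist M y" .
qed (rule abelian_group_axioms)+

end

section \<open>DG algebras and modules\<close>

sublocale dg_algebra \<subseteq> ring: ring A
  by (rule ring)

sublocale dg_algebra \<subseteq> gr: graded_group A
  by (rule graded)

sublocale dg_module \<subseteq> M: graded_group M
  by (rule M_graded)

context dg_algebra
begin

lemma is_abelian_group: "abelian_group A"
  by (rule ring.abelian_group_axioms)

lemma additive_mult_left: "a \<in> carrier A \<Longrightarrow> additive A A (\<lambda>b. a \<otimes>\<^bsub>A\<^esub> b)"
  by (intro additiveI) (auto simp: ring.r_distr is_abelian_group)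

lemma additive_mult_right: "a \<in> carrier A \<Longrightarrow> additive A A (\<lambda>b. b \<otimes>\<^bsub>A\<^esub> a)"
  by (intro additiveI) (auto simp: ring.l_distr is_abelian_group)

lemma additive_diff: "additive A A (diff A)"
  by (intro additiveI) (auto simp: diff_closed diff_add is_abelian_group)

lemma diff_one: "diff A \<one>\<^bsub>A\<^esub> = \<zero>\<^bsub>A\<^esub>"
proof -
  have "diff A \<one>\<^bsub>A\<^esub> = diff A \<one>\<^bsub>A\<^esub> \<oplus>\<^bsub>A\<^esub> diff A \<one>\<^bsub>A\<^esub>"
    using leibniz[OF homog_one ring.one_closed] diff_closed[OF ring.one_closed]
    by (simp add: signed_even)
  then show ?thesis using diff_closed[OF ring.one_closed] by simp
qed

lemma smult_closed: "r \<in> carrier R \<Longrightarrow> a \<in> carrier A \<Longrightarrow> r \<odot>\<^bsub>A\<^esub> a \<in> carrier A"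
  using module.smult_closed[OF R_module] by metis

lemma smult_zero: "r \<in> carrier R \<Longrightarrow> r \<odot>\<^bsub>A\<^esub> \<zero>\<^bsub>A\<^esub> = \<zero>\<^bsub>A\<^esub>"
  using module.smult_r_null[OF R_module] by metis

lemma scalar_homog: "r \<in> carrier R \<Longrightarrow> r \<odot>\<^bsub>A\<^esub> \<one>\<^bsub>A\<^esub> \<in> homog A 0"
  using homog_smult homog_one by simp

end

context dg_module
begin

lemma M_abelian_group: "abelian_group M"
  by (rule M.abelian_group_axioms)

lemma additive_smult: "a \<in> carrier A \<Longrightarrow> additive M M (\<lambda>x. a \<odot>\<^bsub>M\<^esub> x)"
  by (intro additiveI) (auto simp: smult_r_distr M_abelian_group smult_closed)

lemma additive_scalar: "x \<in> carrier M \<Longrightarrow> additive A M (\<lambda>a. a \<odot>\<^bsub>M\<^esub> x)"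
  by (intro additiveI) (auto simp: smult_l_distr M_abelian_group is_abelian_group smult_closed)

lemma additive_M_diff: "additive M M (diff M)"
  using M_diff_linear by (intro additiveI) (auto simp: R_linear_def M_abelian_group)

lemmas M_diff_closed = additive_closed[OF additive_M_diff]
lemmas M_diff_add = additive_add[OF additive_M_diff]

lemma smult_signed_left:
  "a \<in> carrier A \<Longrightarrow> x \<in> carrier M \<Longrightarrow> signed A k a \<odot>\<^bsub>M\<^esub> x = signed M k (a \<odot>\<^bsub>M\<^esub> x)"
  using additive_apply_signed[OF additive_scalar] .

lemma smult_signed_right:
  "a \<in> carrier A \<Longrightarrow> x \<in> carrier M \<Longrightarrow> a \<odot>\<^bsub>M\<^esub> signed M k x = signed M k (a \<odot>\<^bsub>M\<^esub> x)"
  using additive_apply_signed[OF additive_smult] .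

text \<open>For a scalar of mixed degree the sign differs from component to component, and
  \<open>sign_twist\<close> absorbs it. The differential of \<open>tensor\<close> is written in the
  same form.\<close>

lemma M_leibniz_twist:
  assumes "a \<in> carrier A" "x \<in> carrier M"
  shows "diff M (a \<odot>\<^bsub>M\<^esub> x)
       = (diff A a \<odot>\<^bsub>M\<^esub> x) \<oplus>\<^bsub>M\<^esub> (sign_twist A a \<odot>\<^bsub>M\<^esub> diff M x)"
proof (rule additive_eqI[OF graded _ _ _ assms(1)])
  show "additive A M (\<lambda>a. diff M (a \<odot>\<^bsub>M\<^esub> x))"
    using additive_comp[OF additive_scalar additive_M_diff] assms by simp
  show "additive A M (\<lambda>a. (diff A a \<odot>\<^bsub>M\<^esub> x) \<oplus>\<^bsub>M\<^esub> (sign_twist A a \<odot>\<^bsub>M\<^esub> diff M x))"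
    using assms M_diff_closed
    by (intro additive_plus additive_comp[OF additive_diff additive_scalar]
        additive_comp[OF gr.additive_sign_twist additive_scalar])
next
  fix n a assume "a \<in> homog A n"
  then show "diff M (a \<odot>\<^bsub>M\<^esub> x)
       = (diff A a \<odot>\<^bsub>M\<^esub> x) \<oplus>\<^bsub>M\<^esub> (sign_twist A a \<odot>\<^bsub>M\<^esub> diff M x)"
    using M_leibniz assms gr.homog_closed M_diff_closed
    by (simp add: gr.sign_twist_homog smult_signed_left)
qed

end

text \<open>Compatibility with the action of \<open>R\<close> is linearity over the elements $r 1_A$ of degree
  $0$.\<close>

lemma R_linearI:
  assumes "dg_algebra R A" "additive M N f"
    and "\<And>a x. \<lbrakk>a \<in> homog A 0; x \<in> carrier M\<rbrakk> \<Longrightarrow> f (a \<odot>\<^bsub>M\<^esub> x) = a \<odot>\<^bsub>N\<^esub> f x"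
  shows "R_linear R A M N f"
proof -
  interpret dg_algebra R A by fact
  show ?thesis
    using assms(2,3) scalar_homog by (auto simp: R_linear_def additive_def)
qed

text \<open>The source enters only through closure properties, so the rule also applies to
  \<open>tensor\<close>, for which the module axioms and the direct sum decomposition are not
  established.\<close>

lemma HomI:
  assumes A: "dg_algebra R A" and f: "additive M N f"
    and M: "\<And>n. homog M n \<subseteq> carrier M"
      "\<And>a x. \<lbrakk>a \<in> carrier A; x \<in> carrier M\<rbrakk> \<Longrightarrow> a \<odot>\<^bsub>M\<^esub> x \<in> carrier M"
    and deg: "\<And>n x. x \<in> homog M n \<Longrightarrow> f x \<in> homog N (n + r)"
    and lin: "\<And>i a x. \<lbrakk>a \<in> homog A i; x \<in> carrier M\<rbrakk>
          \<Longrightarrow> f (a \<odot>\<^bsub>M\<^esub> x) = signed N (r * i) (a \<odot>\<^bsub>N\<^esub> f x)"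
  shows "restrict f (carrier M) \<in> Hom R A M N r"
proof -
  interpret dg_algebra R A by fact
  have "additive M N (restrict f (carrier M))"
    by (rule additive_cong[OF f]) simp
  then have "R_linear R A M N (restrict f (carrier M))"
    using lin[of _ 0] gr.homog_closed M(2)
    by (intro R_linearI[OF A]) (auto simp: signed_even)
  then show ?thesis
    using deg lin gr.homog_closed M subsetD[OF M(1)] by (auto simp: Hom_def)
qed

lemma (in dg_module) Hom_from_moduleI:
  assumes "additive M N f" "\<And>n x. x \<in> homog M n \<Longrightarrow> f x \<in> homog N (n + r)"
    and "\<And>i a x. \<lbrakk>a \<in> homog A i; x \<in> carrier M\<rbrakk>
          \<Longrightarrow> f (a \<odot>\<^bsub>M\<^esub> x) = signed N (r * i) (a \<odot>\<^bsub>N\<^esub> f x)"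
  shows "restrict f (carrier M) \<in> Hom R A M N r"
  using assms M.homog_closed smult_closed by (intro HomI[OF dg_algebra_axioms]) auto

lemma Hom_additive:
  assumes "abelian_group M" "abelian_group N" "f \<in> Hom R A M N r"
  shows "additive M N f"
  using assms by (auto simp: additive_def Hom_def R_linear_def)

lemma Hom_homog: "f \<in> Hom R A M N r \<Longrightarrow> x \<in> homog M n \<Longrightarrow> f x \<in> homog N (n + r)"
  by (auto simp: Hom_def)

lemma Hom_smult:
  "\<lbrakk>f \<in> Hom R A M N r; a \<in> homog A i; x \<in> carrier M\<rbrakk>
    \<Longrightarrow> f (a \<odot>\<^bsub>M\<^esub> x) = signed N (r * i) (a \<odot>\<^bsub>N\<^esub> f x)"
  by (auto simp: Hom_def)

text \<open>For even \<open>r\<close> the sign is trivial in every degree, so both sides are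
  additive in \<open>a\<close> and homogeneous scalars suffice.\<close>

lemma Hom_smult_even:
  assumes "dg_module R A M" "dg_module R A N" "f \<in> Hom R A M N r" "even r"
    and "a \<in> carrier A" "x \<in> carrier M"
  shows "f (a \<odot>\<^bsub>M\<^esub> x) = a \<odot>\<^bsub>N\<^esub> f x"
proof -
  interpret M: dg_module R A M by fact
  interpret N: dg_module R A N by fact
  have f: "additive M N f"
    using Hom_additive[OF M.M_abelian_group N.M_abelian_group assms(3)] .
  show ?thesis
  proof (rule additive_eqI[OF M.graded _ _ _ assms(5)])
    show "additive A N (\<lambda>a. f (a \<odot>\<^bsub>M\<^esub> x))"
      by (rule additive_comp[OF M.additive_scalar f]) fact
    show "additive A N (\<lambda>a. a \<odot>\<^bsub>N\<^esub> f x)"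
      by (rule N.additive_scalar[OF additive_closed[OF f]]) fact
  qed (use Hom_smult[OF assms(3)] assms in \<open>simp add: signed_even\<close>)
qed

locale dg_algebra_hom = A: dg_algebra R A + B: dg_algebra R B
  for R :: "'r ring" and A :: "('r, 'a) dg" and B :: "('r, 'b) dg" +
  fixes \<phi> :: "'a \<Rightarrow> 'b"
  assumes \<phi>_closed: "a \<in> carrier A \<Longrightarrow> \<phi> a \<in> carrier B"
    and \<phi>_add: "\<lbrakk>a \<in> carrier A; b \<in> carrier A\<rbrakk> \<Longrightarrow> \<phi> (a \<oplus>\<^bsub>A\<^esub> b) = \<phi> a \<oplus>\<^bsub>B\<^esub> \<phi> b"
    and \<phi>_mult: "\<lbrakk>a \<in> carrier A; b \<in> carrier A\<rbrakk> \<Longrightarrow> \<phi> (a \<otimes>\<^bsub>A\<^esub> b) = \<phi> a \<otimes>\<^bsub>B\<^esub> \<phi> b"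
    and \<phi>_one: "\<phi> \<one>\<^bsub>A\<^esub> = \<one>\<^bsub>B\<^esub>"
    and \<phi>_scalar: "r \<in> carrier R \<Longrightarrow> \<phi> (r \<odot>\<^bsub>A\<^esub> \<one>\<^bsub>A\<^esub>) = r \<odot>\<^bsub>B\<^esub> \<one>\<^bsub>B\<^esub>"
    and \<phi>_homog: "a \<in> homog A i \<Longrightarrow> \<phi> a \<in> homog B i"
    and \<phi>_diff: "a \<in> carrier A \<Longrightarrow> \<phi> (diff A a) = diff B (\<phi> a)"
begin

lemma additive_\<phi>: "additive A B \<phi>"
  by (intro additiveI) (auto simp: \<phi>_closed \<phi>_add A.is_abelian_group B.is_abelian_group)

end

section \<open>The divided power algebra and its derivation\<close>

lemma carrier_adjoin_even:
  "f \<in> carrier (adjoin_even A w t) \<longleftrightarrow> (\<forall>i. f i \<in> carrier A) \<and> finite {i. f i \<noteq> \<zero>\<^bsub>A\<^esub>}"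
  and zero_adjoin_even: "\<zero>\<^bsub>adjoin_even A w t\<^esub> = (\<lambda>i. \<zero>\<^bsub>A\<^esub>)"
  and add_adjoin_even: "f \<oplus>\<^bsub>adjoin_even A w t\<^esub> g = (\<lambda>i. f i \<oplus>\<^bsub>A\<^esub> g i)"
  and one_adjoin_even: "\<one>\<^bsub>adjoin_even A w t\<^esub> = adjoin_incl A \<one>\<^bsub>A\<^esub>"
  and mult_adjoin_even: "f \<otimes>\<^bsub>adjoin_even A w t\<^esub> g
      = (\<lambda>n. \<Oplus>\<^bsub>A\<^esub>i \<in> {..n}. add_pow A (n choose i) (f i \<otimes>\<^bsub>A\<^esub> g (n - i)))"
  and smult_adjoin_even: "r \<odot>\<^bsub>adjoin_even A w t\<^esub> f = (\<lambda>i. r \<odot>\<^bsub>A\<^esub> f i)"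
  and homog_adjoin_even: "f \<in> homog (adjoin_even A w t) n \<longleftrightarrow>
      f \<in> carrier (adjoin_even A w t) \<and> (\<forall>i. f i \<in> homog A (n - int i * w))"
  and diff_adjoin_even:
    "diff (adjoin_even A w t) f = (\<lambda>i. diff A (f i) \<oplus>\<^bsub>A\<^esub> (t \<otimes>\<^bsub>A\<^esub> f (Suc i)))"
  by (simp_all add: adjoin_even_def Let_def adjoin_incl_def)

text \<open>The element $X^{(k)}$.\<close>

definition divpow :: "('r, 'a) dg \<Rightarrow> nat \<Rightarrow> nat \<Rightarrow> 'a" where
  "divpow A k = (\<lambda>n. if n = k then \<one>\<^bsub>A\<^esub> else \<zero>\<^bsub>A\<^esub>)"

lemma divpow_apply: "divpow A k n = (if n = k then \<one>\<^bsub>A\<^esub> else \<zero>\<^bsub>A\<^esub>)"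
  by (simp add: divpow_def)

text \<open>The value \<open>f i\<close> is the coefficient of $X^{(i)}$, so the shift sends
  $X^{(i)}$ to $X^{(i-1)}$. On divided powers this is $d/dX$.\<close>

definition ddX :: "(nat \<Rightarrow> 'a) \<Rightarrow> nat \<Rightarrow> 'a" where
  "ddX f = (\<lambda>n. f (Suc n))"

text \<open>That \<open>B\<close> is a DG algebra is assumed here; in the theorem it is part of the
  hypothesis that \<open>N\<close> is a DG \<open>B\<close>-module.\<close>

locale even_adjunction = A: dg_algebra R A + B: dg_algebra R "adjoin_even A w t"
  for R :: "'r ring" and A :: "('r, 'a) dg" and w :: int and t :: 'a +
  assumes w_pos: "w > 0" and w_even: "even w"
    and t_homog: "t \<in> homog A (w - 1)" and t_cycle: "diff A t = \<zero>\<^bsub>A\<^esub>"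
begin

abbreviation B where "B \<equiv> adjoin_even A w t"

abbreviation \<iota> where "\<iota> \<equiv> adjoin_incl A"

lemma B_closed: "f \<in> carrier B \<Longrightarrow> f i \<in> carrier A"
  by (simp add: carrier_adjoin_even)

lemma t_closed: "t \<in> carrier A"
  by (rule A.gr.homog_closed[OF t_homog])

lemma t_square: "t \<otimes>\<^bsub>A\<^esub> t = \<zero>\<^bsub>A\<^esub>"
  by (rule A.odd_square[OF t_homog]) (simp add: w_even)

lemma additive_coeff: "additive B A (\<lambda>f. f i)"
  by (intro additiveI) (auto simp: B_closed add_adjoin_even A.is_abelian_group B.is_abelian_group)

lemma finite_support_single: "finite {i. (if i = k then x else \<zero>\<^bsub>A\<^esub>) \<noteq> \<zero>\<^bsub>A\<^esub>}"
  by (rule finite_subset[of _ "{k}"]) auto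

lemma incl_closed: "a \<in> carrier A \<Longrightarrow> \<iota> a \<in> carrier B"
  by (auto simp: carrier_adjoin_even adjoin_incl_def finite_support_single)

lemma divpow_closed: "divpow A k \<in> carrier B"
  by (auto simp: carrier_adjoin_even divpow_def finite_support_single)

lemma divpow_homog: "divpow A k \<in> homog B (int k * w)"
  using divpow_closed
  by (auto simp: homog_adjoin_even divpow_def A.gr.homog_zero A.homog_one)

lemma incl_homog: "a \<in> homog A n \<Longrightarrow> \<iota> a \<in> homog B n"
  using incl_closed
  by (auto simp: homog_adjoin_even adjoin_incl_def A.gr.homog_zero A.gr.homog_closed)

lemma coeff_homog: "f \<in> homog B n \<Longrightarrow> f i \<in> homog A (n - int i * w)"
  by (simp add: homog_adjoin_even)

lemma add_pow_1: "x \<in> carrier A \<Longrightarrow> add_pow A (1::nat) x = x"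
  by (simp add: add_pow_def)

lemma add_pow_closed: "x \<in> carrier A \<Longrightarrow> add_pow A (n::nat) x \<in> carrier A"
  using A.ring.add.nat_pow_closed .

text \<open>In the convolution only the term \<open>i = n\<close> survives, with binomial
  coefficient 1; for multiplication on the left it is the term \<open>i = 0\<close>.\<close>

lemma mult_incl_right:
  assumes "f \<in> carrier B" "a \<in> carrier A"
  shows "(f \<otimes>\<^bsub>B\<^esub> \<iota> a) n = f n \<otimes>\<^bsub>A\<^esub> a"
proof -
  have "(f \<otimes>\<^bsub>B\<^esub> \<iota> a) n = (\<Oplus>\<^bsub>A\<^esub>i\<in>{..n}. if n = i then f i \<otimes>\<^bsub>A\<^esub> a else \<zero>\<^bsub>A\<^esub>)"
    unfolding mult_adjoin_even using assms B_closed
    by (intro A.ring.finsum_cong') (auto simp: adjoin_incl_def add_pow_1[unfolded One_nat_def])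
  also have "\<dots> = f n \<otimes>\<^bsub>A\<^esub> a"
    using assms B_closed by (intro A.ring.finsum_singleton) auto
  finally show ?thesis .
qed

lemma mult_incl_left:
  assumes "f \<in> carrier B" "a \<in> carrier A"
  shows "(\<iota> a \<otimes>\<^bsub>B\<^esub> f) n = a \<otimes>\<^bsub>A\<^esub> f n"
proof -
  have "(\<iota> a \<otimes>\<^bsub>B\<^esub> f) n = (\<Oplus>\<^bsub>A\<^esub>i\<in>{..n}. if 0 = i then a \<otimes>\<^bsub>A\<^esub> f (n - i) else \<zero>\<^bsub>A\<^esub>)"
    unfolding mult_adjoin_even using assms B_closed
    by (intro A.ring.finsum_cong') (auto simp: adjoin_incl_def add_pow_1[unfolded One_nat_def])
  also have "\<dots> = a \<otimes>\<^bsub>A\<^esub> f n"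
    using assms B_closed
    by (subst A.ring.finsum_singleton[where f = "\<lambda>i. a \<otimes>\<^bsub>A\<^esub> f (n - i)"]) auto
  finally show ?thesis .
qed

lemma mult_coeff_0: "\<lbrakk>f \<in> carrier B; g \<in> carrier B\<rbrakk> \<Longrightarrow> (f \<otimes>\<^bsub>B\<^esub> g) 0 = f 0 \<otimes>\<^bsub>A\<^esub> g 0"
  by (simp add: mult_adjoin_even add_pow_1[unfolded One_nat_def] B_closed)

lemma dg_algebra_hom_incl: "dg_algebra_hom R A B \<iota>"
proof (intro dg_algebra_hom.intro dg_algebra_hom_axioms.intro)
  show "dg_algebra R A" "dg_algebra R B" by unfold_locales
next
  fix a b assume ab: "a \<in> carrier A" "b \<in> carrier A"
  show "\<iota> (a \<oplus>\<^bsub>A\<^esub> b) = \<iota> a \<oplus>\<^bsub>B\<^esub> \<iota> b"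
    unfolding adjoin_incl_def add_adjoin_even using ab by auto
  have "\<iota> (a \<otimes>\<^bsub>A\<^esub> b) n = (\<iota> a \<otimes>\<^bsub>B\<^esub> \<iota> b) n" for n
    unfolding mult_incl_left[OF incl_closed[OF ab(2)] ab(1)]
    using ab by (simp add: adjoin_incl_def)
  then show "\<iota> (a \<otimes>\<^bsub>A\<^esub> b) = \<iota> a \<otimes>\<^bsub>B\<^esub> \<iota> b" ..
next
  fix a assume a: "a \<in> carrier A"
  show "\<iota> a \<in> carrier B" by (rule incl_closed[OF a])
  show "\<iota> (diff A a) = diff B (\<iota> a)"
    unfolding adjoin_incl_def diff_adjoin_even
    using a t_closed A.diff_closed additive_zero[OF A.additive_diff] by (simp add: fun_eq_iff)
next
  fix r assume "r \<in> carrier R"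
  then show "\<iota> (r \<odot>\<^bsub>A\<^esub> \<one>\<^bsub>A\<^esub>) = r \<odot>\<^bsub>B\<^esub> \<one>\<^bsub>B\<^esub>"
    unfolding one_adjoin_even smult_adjoin_even adjoin_incl_def
    using A.smult_zero by (simp add: fun_eq_iff)
next
  show "\<iota> \<one>\<^bsub>A\<^esub> = \<one>\<^bsub>B\<^esub>" by (rule one_adjoin_even[symmetric])
next
  fix a i assume "a \<in> homog A i" then show "\<iota> a \<in> homog B i" by (rule incl_homog)
qed

sublocale dg_algebra_hom R A B \<iota>
  by (rule dg_algebra_hom_incl)

lemma one_divpow: "\<one>\<^bsub>B\<^esub> = divpow A 0"
  by (simp add: one_adjoin_even divpow_def adjoin_incl_def)

text \<open>Compare coefficients: at index \<open>i\<close> only the summand \<open>k = i\<close> is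
  nonzero. The set \<open>S\<close> is left free so that it can be an initial segment of the natural
  numbers.\<close>

lemma divpow_expansion:
  assumes f: "f \<in> carrier B" and S: "finite S" "{i. f i \<noteq> \<zero>\<^bsub>A\<^esub>} \<subseteq> S"
  shows "f = (\<Oplus>\<^bsub>B\<^esub>k\<in>S. divpow A k \<otimes>\<^bsub>B\<^esub> \<iota> (f k))"
proof
  fix i
  have "(\<Oplus>\<^bsub>B\<^esub>k\<in>S. divpow A k \<otimes>\<^bsub>B\<^esub> \<iota> (f k)) i
      = (\<Oplus>\<^bsub>A\<^esub>k\<in>S. (divpow A k \<otimes>\<^bsub>B\<^esub> \<iota> (f k)) i)"
    using f B_closed incl_closed divpow_closed by (intro additive_finsum[OF additive_coeff]) auto
  also have "\<dots> = (\<Oplus>\<^bsub>A\<^esub>k\<in>S. if i = k then f k else \<zero>\<^bsub>A\<^esub>)"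
    using f B_closed
    by (intro A.ring.finsum_cong') (auto simp: mult_incl_right divpow_closed divpow_apply)
  also have "\<dots> = f i"
  proof (cases "i \<in> S")
    case True
    then show ?thesis using f S B_closed by (intro A.ring.finsum_singleton) auto
  next
    case False
    then have "(\<Oplus>\<^bsub>A\<^esub>k\<in>S. if i = k then f k else \<zero>\<^bsub>A\<^esub>) = (\<Oplus>\<^bsub>A\<^esub>k\<in>S. \<zero>\<^bsub>A\<^esub>)"
      by (intro A.ring.finsum_cong') auto
    moreover have "f i = \<zero>\<^bsub>A\<^esub>" using False S by auto
    ultimately show ?thesis by simp
  qed
  finally show "f i = (\<Oplus>\<^bsub>B\<^esub>k\<in>S. divpow A k \<otimes>\<^bsub>B\<^esub> \<iota> (f k)) i" ..
qed

section \<open>The derivation d/dX\<close>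

lemma ddX_closed: "f \<in> carrier B \<Longrightarrow> ddX f \<in> carrier B"
proof -
  assume f: "f \<in> carrier B"
  then have "finite (Suc -` {i. f i \<noteq> \<zero>\<^bsub>A\<^esub>})"
    by (intro finite_vimageI) (auto simp: carrier_adjoin_even)
  then show ?thesis using f by (simp add: carrier_adjoin_even ddX_def vimage_def)
qed

lemma additive_ddX: "additive B B ddX"
  by (intro additiveI ddX_closed B.is_abelian_group) (simp_all add: add_adjoin_even ddX_def)

lemma ddX_homog: "f \<in> homog B n \<Longrightarrow> ddX f \<in> homog B (n - w)"
  using ddX_closed coeff_homog[of f n "Suc _"]
  by (auto simp: homog_adjoin_even ddX_def algebra_simps)

text \<open>The coefficient formula for the differential has the same shape at every index, so it
  commutes with the shift.\<close>

lemma ddX_diff: "ddX (diff B f) = diff B (ddX f)"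
  by (simp add: ddX_def diff_adjoin_even)

lemma ddX_incl: "ddX (\<iota> a) = \<zero>\<^bsub>B\<^esub>"
  by (simp add: ddX_def adjoin_incl_def zero_adjoin_even)

lemma ddX_divpow_Suc: "ddX (divpow A (Suc k)) = divpow A k"
  by (simp add: ddX_def divpow_def)

lemma ddX_divpow_0: "ddX (divpow A 0) = \<zero>\<^bsub>B\<^esub>"
  by (simp add: ddX_def divpow_def zero_adjoin_even)

text \<open>The product rule at index \<open>n\<close> is Pascal's identity for
  \<open>Suc n choose Suc i\<close>. It carries no sign because $d/dX$ has even degree.\<close>

lemma ddX_mult:
  assumes f: "f \<in> carrier B" and g: "g \<in> carrier B"
  shows "ddX (f \<otimes>\<^bsub>B\<^esub> g) = (ddX f \<otimes>\<^bsub>B\<^esub> g) \<oplus>\<^bsub>B\<^esub> (f \<otimes>\<^bsub>B\<^esub> ddX g)"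
proof
  fix n
  define u where "u i = f i \<otimes>\<^bsub>A\<^esub> g (Suc n - i)" for i
  have u: "u i \<in> carrier A" for i using f g B_closed by (simp add: u_def)
  let ?p = "\<lambda>k x. add_pow A (k::nat) x"
  have p: "?p k x \<in> carrier A" if "x \<in> carrier A" for k x
    using that by (rule add_pow_closed)
  have "ddX (f \<otimes>\<^bsub>B\<^esub> g) n = (\<Oplus>\<^bsub>A\<^esub>i\<in>{..Suc n}. ?p (Suc n choose i) (u i))"
    by (simp add: ddX_def mult_adjoin_even u_def)
  \<comment> \<open>The summand with index 0 is split off because Pascal's identity applies to the
    others only; it rejoins the second family below.\<close>
  also have "\<dots> = (\<Oplus>\<^bsub>A\<^esub>i\<in>{..n}. ?p (Suc n choose Suc i) (u (Suc i))) \<oplus>\<^bsub>A\<^esub> ?p (Suc n choose 0) (u 0)"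
    using u p by (subst A.ring.finsum_Suc2) auto
  also have "(\<Oplus>\<^bsub>A\<^esub>i\<in>{..n}. ?p (Suc n choose Suc i) (u (Suc i)))
      = (\<Oplus>\<^bsub>A\<^esub>i\<in>{..n}. ?p (n choose i) (u (Suc i)) \<oplus>\<^bsub>A\<^esub> ?p (n choose Suc i) (u (Suc i)))"
    using u p A.ring.add.nat_pow_mult by (intro A.ring.finsum_cong') auto
  also have "\<dots> = (\<Oplus>\<^bsub>A\<^esub>i\<in>{..n}. ?p (n choose i) (u (Suc i)))
      \<oplus>\<^bsub>A\<^esub> (\<Oplus>\<^bsub>A\<^esub>i\<in>{..n}. ?p (n choose Suc i) (u (Suc i)))"
    using u p by (subst A.ring.finsum_addf) auto
  also have "\<dots> \<oplus>\<^bsub>A\<^esub> ?p (Suc n choose 0) (u 0)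
    = (\<Oplus>\<^bsub>A\<^esub>i\<in>{..n}. ?p (n choose i) (u (Suc i))) \<oplus>\<^bsub>A\<^esub>
     ((\<Oplus>\<^bsub>A\<^esub>i\<in>{..n}. ?p (n choose Suc i) (u (Suc i))) \<oplus>\<^bsub>A\<^esub> ?p (n choose 0) (u 0))"
    using u p by (subst A.ring.a_assoc) auto
  also have "(\<Oplus>\<^bsub>A\<^esub>i\<in>{..n}. ?p (n choose Suc i) (u (Suc i))) \<oplus>\<^bsub>A\<^esub> ?p (n choose 0) (u 0)
    = (\<Oplus>\<^bsub>A\<^esub>i\<in>{..Suc n}. ?p (n choose i) (u i))"
    using u p by (subst A.ring.finsum_Suc2) auto
  \<comment> \<open>The top summand vanishes because \<open>n choose Suc n\<close> is 0.\<close>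
  also have "\<dots> = (\<Oplus>\<^bsub>A\<^esub>i\<in>{..n}. ?p (n choose i) (u i))"
    using u p by (subst A.ring.finsum_Suc) (auto simp: add_pow_def binomial_eq_0)
  also have "\<dots> = (f \<otimes>\<^bsub>B\<^esub> ddX g) n"
    unfolding mult_adjoin_even using u p
    by (intro A.ring.finsum_cong') (auto simp: u_def ddX_def Suc_diff_le[symmetric])
  also have "(\<Oplus>\<^bsub>A\<^esub>i\<in>{..n}. ?p (n choose i) (u (Suc i))) = (ddX f \<otimes>\<^bsub>B\<^esub> g) n"
    by (simp add: u_def ddX_def mult_adjoin_even)
  finally show "ddX (f \<otimes>\<^bsub>B\<^esub> g) n = ((ddX f \<otimes>\<^bsub>B\<^esub> g) \<oplus>\<^bsub>B\<^esub> (f \<otimes>\<^bsub>B\<^esub> ddX g)) n"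
    by (simp add: add_adjoin_even)
qed

lemma ddX_mult_incl:
  assumes "f \<in> carrier B" "a \<in> carrier A"
  shows "ddX (f \<otimes>\<^bsub>B\<^esub> \<iota> a) = ddX f \<otimes>\<^bsub>B\<^esub> \<iota> a"
  using assms ddX_closed incl_closed by (simp add: ddX_mult ddX_incl)

end

section \<open>Base change\<close>

locale base_change = dg_algebra_hom R A B \<phi> + L: dg_module R A M
  for R :: "'r ring" and A :: "('r, 'a) dg" and B :: "('r, 'b) dg" and \<phi> :: "'a \<Rightarrow> 'b"
    and M :: "('a, 'm) dg"
begin

abbreviation F where "F \<equiv> tensor_free B M"
abbreviation K where "K \<equiv> tensor_rels A B \<phi> M"
abbreviation T where "T \<equiv> tensor A B \<phi> M"
abbreviation cls where "cls \<equiv> tensor_class A B \<phi> M"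

definition tens :: "'b \<Rightarrow> 'm \<Rightarrow> (('b \<times> 'm) \<Rightarrow>\<^sub>0 int) set" where
  "tens b m = cls (frag_of (b, m))"

definition biadditive :: "('c, 'n) ring_scheme \<Rightarrow> ('b \<Rightarrow> 'm \<Rightarrow> 'c) \<Rightarrow> bool" where
  "biadditive G f \<longleftrightarrow>
     (\<forall>m \<in> carrier M. additive B G (\<lambda>b. f b m)) \<and> (\<forall>b \<in> carrier B. additive M G (f b))"

definition balanced :: "('b \<Rightarrow> 'm \<Rightarrow> 'c) \<Rightarrow> bool" where
  "balanced f \<longleftrightarrow> (\<forall>b \<in> carrier B. \<forall>a \<in> carrier A. \<forall>m \<in> carrier M.
     f (b \<otimes>\<^bsub>B\<^esub> \<phi> a) m = f b (a \<odot>\<^bsub>M\<^esub> m))"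

lemma F_comm_group: "comm_group F"
  unfolding tensor_free_def by (rule abelian_free_Abelian_group)

sublocale F: comm_group F
  by (rule F_comm_group)

lemma F_simps [simp]:
  "u \<in> carrier F \<longleftrightarrow> Poly_Mapping.keys u \<subseteq> carrier B \<times> carrier M"
  "\<one>\<^bsub>F\<^esub> = 0" "u \<otimes>\<^bsub>F\<^esub> v = u + v"
  by (simp_all add: tensor_free_def)

lemma F_inv: "u \<in> carrier F \<Longrightarrow> inv\<^bsub>F\<^esub> u = - u"
  unfolding tensor_free_def by (rule inv_free_Abelian_group) simp

definition rels where
  "rels = {frag_of (b \<oplus>\<^bsub>B\<^esub> b', m) - frag_of (b, m) - frag_of (b', m) | b b' m.
         b \<in> carrier B \<and> b' \<in> carrier B \<and> m \<in> carrier M} \<union>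
      {frag_of (b, m \<oplus>\<^bsub>M\<^esub> m') - frag_of (b, m) - frag_of (b, m') | b m m'.
         b \<in> carrier B \<and> m \<in> carrier M \<and> m' \<in> carrier M} \<union>
      {frag_of (b \<otimes>\<^bsub>B\<^esub> \<phi> a, m) - frag_of (b, a \<odot>\<^bsub>M\<^esub> m) | b a m.
         b \<in> carrier B \<and> a \<in> carrier A \<and> m \<in> carrier M}"

lemma K_rels: "K = generate F rels"
  by (simp add: tensor_rels_def rels_def)

lemma F_diff: "u \<in> carrier F \<Longrightarrow> v \<in> carrier F \<Longrightarrow> u - v \<in> carrier F"
  using keys_diff[of u v] by auto

lemma F_frag: "b \<in> carrier B \<Longrightarrow> m \<in> carrier M \<Longrightarrow> frag_of (b, m) \<in> carrier F"
  by simp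

lemma rels_subset: "rels \<subseteq> carrier F"
  unfolding rels_def
  by (auto simp del: F_simps intro!: F_diff F_frag L.smult_closed \<phi>_closed)

lemma K_subgroup: "subgroup K F"
  unfolding K_rels by (rule F.generate_is_subgroup[OF rels_subset])

lemma K_normal: "K \<lhd> F"
  by (rule F.subgroup_imp_normal[OF K_subgroup])

lemma T_simps:
  "carrier T = carrier (F Mod K)" "\<zero>\<^bsub>T\<^esub> = \<one>\<^bsub>F Mod K\<^esub>" "x \<oplus>\<^bsub>T\<^esub> y = x \<otimes>\<^bsub>F Mod K\<^esub> y"
  by (simp_all add: tensor_def Let_def FactGroup_def)

lemma T_abelian_group: "abelian_group T"
proof -
  interpret Q: comm_group "F Mod K" by (rule F.abelian_FactGroup[OF K_subgroup])
  show ?thesis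
  proof (rule abelian_groupI)
    fix x assume x: "x \<in> carrier T"
    show "\<exists>y\<in>carrier T. y \<oplus>\<^bsub>T\<^esub> x = \<zero>\<^bsub>T\<^esub>"
      using x Q.l_inv[of x] Q.inv_closed[of x]
      by (intro bexI[of _ "inv\<^bsub>F Mod K\<^esub> x"]) (simp_all add: T_simps)
  qed (use Q.m_closed Q.one_closed Q.m_assoc Q.m_comm Q.l_one in \<open>simp_all add: T_simps\<close>)
qed

sublocale T: abelian_group T
  by (rule T_abelian_group)

lemma T_carrier: "carrier T = cls ` carrier F"
  by (auto simp: T_simps carrier_FactGroup tensor_class_def)

lemma cls_closed: "u \<in> carrier F \<Longrightarrow> cls u \<in> carrier T"
  by (auto simp: T_carrier)

lemma cls_add: "u \<in> carrier F \<Longrightarrow> v \<in> carrier F \<Longrightarrow> cls (u + v) = cls u \<oplus>\<^bsub>T\<^esub> cls v"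
  using normal.rcos_sum[OF K_normal, of u v] by (simp add: T_simps FactGroup_def tensor_class_def)

lemma cls_zero: "cls 0 = \<zero>\<^bsub>T\<^esub>"
  using F.coset_join2[OF F.one_closed K_subgroup] subgroup.one_closed[OF K_subgroup]
  by (simp add: T_simps FactGroup_def tensor_class_def)

lemma cls_minus:
  assumes "u \<in> carrier F" "v \<in> carrier F" shows "cls (u - v) = cls u \<ominus>\<^bsub>T\<^esub> cls v"
proof -
  have "cls (u - v) \<oplus>\<^bsub>T\<^esub> cls v = cls u"
    using cls_add[OF F_diff[OF assms] assms(2)] by simp
  then have "cls u \<ominus>\<^bsub>T\<^esub> cls v = (cls (u - v) \<oplus>\<^bsub>T\<^esub> cls v) \<ominus>\<^bsub>T\<^esub> cls v"
    by simp
  then show ?thesis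
    using cls_closed[OF assms(2)] cls_closed[OF F_diff[OF assms]]
    by (simp add: T.minus_eq T.a_assoc T.r_neg)
qed

lemma cls_rels: "u \<in> rels \<Longrightarrow> cls u = \<zero>\<^bsub>T\<^esub>"
  using F.coset_join2[OF _ K_subgroup, of u] rels_subset generate.incl[of u rels F]
  by (auto simp: T_simps FactGroup_def tensor_class_def K_rels simp del: F_simps)

lemma tens_closed: "b \<in> carrier B \<Longrightarrow> m \<in> carrier M \<Longrightarrow> tens b m \<in> carrier T"
  unfolding tens_def by (rule cls_closed[OF F_frag])

lemma T_minus_zeroD:
  assumes "x \<in> carrier T" "y \<in> carrier T" "x \<ominus>\<^bsub>T\<^esub> y = \<zero>\<^bsub>T\<^esub>"
  shows "x = y"
proof -
  have "(x \<ominus>\<^bsub>T\<^esub> y) \<oplus>\<^bsub>T\<^esub> y = x"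
    using assms(1,2) by (simp add: T.minus_eq T.a_assoc T.l_neg)
  then show ?thesis using assms by simp
qed

lemma cls_diff2_zero:
  assumes "u - v - v' \<in> rels" "u \<in> carrier F" "v \<in> carrier F" "v' \<in> carrier F"
  shows "cls u = cls v \<oplus>\<^bsub>T\<^esub> cls v'"
proof -
  have vv: "v + v' \<in> carrier F" using F.m_closed[OF assms(3,4)] by simp
  have "u - (v + v') \<in> rels" using assms(1) by (simp add: algebra_simps)
  then have "cls u \<ominus>\<^bsub>T\<^esub> cls (v + v') = \<zero>\<^bsub>T\<^esub>"
    using cls_rels cls_minus[OF assms(2) vv] by simp
  then show ?thesis
    using T_minus_zeroD[OF cls_closed[OF assms(2)] cls_closed[OF vv]] cls_add[OF assms(3,4)] by simp
qed

section \<open>Pure tensors and the universal property\<close>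

lemma tens_biadditive: "biadditive T tens"
  unfolding biadditive_def
proof (intro conjI ballI additiveI)
  fix m b b' assume "m \<in> carrier M" "b \<in> carrier B" "b' \<in> carrier B"
  then show "tens (b \<oplus>\<^bsub>B\<^esub> b') m = tens b m \<oplus>\<^bsub>T\<^esub> tens b' m"
    unfolding tens_def by (intro cls_diff2_zero F_frag) (auto simp: rels_def)
next
  fix m b m' assume "m \<in> carrier M" "b \<in> carrier B" "m' \<in> carrier M"
  then show "tens b (m \<oplus>\<^bsub>M\<^esub> m') = tens b m \<oplus>\<^bsub>T\<^esub> tens b m'"
    unfolding tens_def by (intro cls_diff2_zero F_frag) (auto simp: rels_def)
qed (simp_all add: tens_closed T_abelian_group B.is_abelian_group L.M_abelian_group)

lemma tens_balanced: "balanced tens"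
  unfolding balanced_def
proof (intro ballI)
  fix b a m assume *: "b \<in> carrier B" "a \<in> carrier A" "m \<in> carrier M"
  have F: "frag_of (b \<otimes>\<^bsub>B\<^esub> \<phi> a, m) \<in> carrier F" "frag_of (b, a \<odot>\<^bsub>M\<^esub> m) \<in> carrier F"
    using * \<phi>_closed L.smult_closed by simp_all
  have "frag_of (b \<otimes>\<^bsub>B\<^esub> \<phi> a, m) - frag_of (b, a \<odot>\<^bsub>M\<^esub> m) \<in> rels"
    using * by (auto simp: rels_def)
  then have "cls (frag_of (b \<otimes>\<^bsub>B\<^esub> \<phi> a, m)) \<ominus>\<^bsub>T\<^esub> cls (frag_of (b, a \<odot>\<^bsub>M\<^esub> m)) = \<zero>\<^bsub>T\<^esub>"
    unfolding cls_minus[OF F, symmetric] by (rule cls_rels)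
  then show "tens (b \<otimes>\<^bsub>B\<^esub> \<phi> a) m = tens b (a \<odot>\<^bsub>M\<^esub> m)"
    unfolding tens_def by (rule T_minus_zeroD[OF cls_closed[OF F(1)] cls_closed[OF F(2)]])
qed

lemma tens_additive_left: "m \<in> carrier M \<Longrightarrow> additive B T (\<lambda>b. tens b m)"
  and tens_additive_right: "b \<in> carrier B \<Longrightarrow> additive M T (tens b)"
  using tens_biadditive by (auto simp: biadditive_def)

text \<open>The induction runs over representatives in the free Abelian group, whose induction rule
  is phrased with differences; hence \<open>minus\<close> instead of a sum.\<close>

lemma T_induct [consumes 1, case_names tens minus]:
  assumes x: "x \<in> carrier T"
    and tens: "\<And>b m. \<lbrakk>b \<in> carrier B; m \<in> carrier M\<rbrakk> \<Longrightarrow> P (tens b m)"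
    and minus: "\<And>x y. \<lbrakk>x \<in> carrier T; y \<in> carrier T; P x; P y\<rbrakk> \<Longrightarrow> P (x \<ominus>\<^bsub>T\<^esub> y)"
  shows "P x"
proof -
  obtain u where u: "u \<in> carrier F" "x = cls u" using x by (auto simp: T_carrier)
  \<comment> \<open>Zero needs no case of its own: it is the pure tensor of two zeros.\<close>
  have z: "P (cls 0)"
    using tens[OF B.ring.zero_closed L.M.zero_closed] additive_zero[OF tens_additive_left, of "\<zero>\<^bsub>M\<^esub>"]
      cls_zero by simp
  have "Poly_Mapping.keys u \<subseteq> carrier B \<times> carrier M" using u by simp
  then have "P (cls u)"
  proof (induction u rule: free_Abelian_group_induct[consumes 1, case_names zero minus frag])
    case (minus u v)
    then show ?case using cls_minus assms(3) cls_closed by simp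
  next
    case (frag a)
    then show ?case using tens by (auto simp: tens_def)
  qed (rule z)
  then show ?thesis using u by simp
qed

lemma T_hom_eqI:
  assumes f: "additive T G f" and g: "additive T G g"
    and "\<And>b m. \<lbrakk>b \<in> carrier B; m \<in> carrier M\<rbrakk> \<Longrightarrow> f (tens b m) = g (tens b m)"
    and x: "x \<in> carrier T"
  shows "f x = g x"
  using x
proof (induction x rule: T_induct)
  case (minus x y)
  then show ?case using additive_minus[OF f] additive_minus[OF g] by simp
qed (rule assms(3))

text \<open>The map \<open>f\<close> extends to the free Abelian group, biadditivity and balance put
  the three kinds of relations into the kernel of the extension, and the extension therefore factors
  through the quotient. All maps out of the tensor product below are obtained this way.\<close>

lemma tensor_universal:
  assumes G: "abelian_group G" and f: "biadditive G f" "balanced f"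
  obtains h where "additive T G h"
    "\<And>b m. \<lbrakk>b \<in> carrier B; m \<in> carrier M\<rbrakk> \<Longrightarrow> h (tens b m) = f b m"
proof -
  interpret G: abelian_group G by fact
  have fcl: "f b m \<in> carrier G" if "b \<in> carrier B" "m \<in> carrier M" for b m
    using f that additive_closed unfolding biadditive_def by metis
  have fl: "additive B G (\<lambda>b. f b m)" if "m \<in> carrier M" for m
    using f that by (auto simp: biadditive_def)
  have fr: "additive M G (f b)" if "b \<in> carrier B" for b
    using f that by (auto simp: biadditive_def)
  have img: "case_prod f ` (carrier B \<times> carrier M) \<subseteq> carrier (add_monoid G)"
    using fcl by auto
  obtain h0 where h0: "h0 \<in> hom F (add_monoid G)"
    "\<And>x. x \<in> carrier B \<times> carrier M \<Longrightarrow> h0 (frag_of x) = case_prod f x"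
    unfolding tensor_free_def
    by (rule comm_group.free_Abelian_group_universal[OF G.a_comm_group img]) blast
  interpret h0: group_hom F "add_monoid G" h0
    by (intro group_hom.intro group_hom_axioms.intro F.is_group G.a_group h0(1))
  have h0_add: "h0 (u + v) = h0 u \<oplus>\<^bsub>G\<^esub> h0 v" if "u \<in> carrier F" "v \<in> carrier F" for u v
    using h0.hom_mult[OF that] by simp
  have h0_cl: "h0 u \<in> carrier G" if "u \<in> carrier F" for u
    using h0.hom_closed[OF that] by simp
  have h0_minus: "h0 (u - v) = h0 u \<ominus>\<^bsub>G\<^esub> h0 v" if uv: "u \<in> carrier F" "v \<in> carrier F" for u v
  proof -
    have "h0 u = h0 (u - v) \<oplus>\<^bsub>G\<^esub> h0 v"
      using h0_add[OF F_diff[OF uv] uv(2)] by simp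
    then show ?thesis using h0_cl[OF F_diff[OF uv]] h0_cl[OF uv(2)]
      by (simp add: G.minus_eq G.a_assoc G.r_neg)
  qed
  have "rels \<subseteq> kernel F (add_monoid G) h0"
  proof
    fix u assume u: "u \<in> rels"
    then have uF: "u \<in> carrier F" using rels_subset by blast
    have cancel: "(x \<oplus>\<^bsub>G\<^esub> y) \<ominus>\<^bsub>G\<^esub> x \<ominus>\<^bsub>G\<^esub> y = \<zero>\<^bsub>G\<^esub>" if "x \<in> carrier G" "y \<in> carrier G" for x y
    proof -
      have "(x \<oplus>\<^bsub>G\<^esub> y) \<ominus>\<^bsub>G\<^esub> x \<ominus>\<^bsub>G\<^esub> y = (x \<ominus>\<^bsub>G\<^esub> x) \<oplus>\<^bsub>G\<^esub> (y \<ominus>\<^bsub>G\<^esub> y)"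
        using that by (simp add: G.minus_eq G.a_ac)
      then show ?thesis using that by (simp add: G.minus_eq G.r_neg)
    qed
    have val: "h0 (frag_of (b, m)) = f b m" if "b \<in> carrier B" "m \<in> carrier M" for b m
      using h0(2)[of "(b, m)"] that by simp
    have "h0 u = \<zero>\<^bsub>G\<^esub>"
      using u unfolding rels_def
    proof (elim UnE CollectE exE conjE)
      fix b b' m assume *: "u = frag_of (b \<oplus>\<^bsub>B\<^esub> b', m) - frag_of (b, m) - frag_of (b', m)"
        "b \<in> carrier B" "b' \<in> carrier B" "m \<in> carrier M"
      have "h0 u = f (b \<oplus>\<^bsub>B\<^esub> b') m \<ominus>\<^bsub>G\<^esub> f b m \<ominus>\<^bsub>G\<^esub> f b' m"
        unfolding *(1)
        using h0_minus[OF F_diff[OF F_frag F_frag] F_frag] h0_minus[OF F_frag F_frag] val *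
        by simp
      then show ?thesis using additive_add[OF fl] * fcl cancel by simp
    next
      fix b m m' assume *: "u = frag_of (b, m \<oplus>\<^bsub>M\<^esub> m') - frag_of (b, m) - frag_of (b, m')"
        "b \<in> carrier B" "m \<in> carrier M" "m' \<in> carrier M"
      have "h0 u = f b (m \<oplus>\<^bsub>M\<^esub> m') \<ominus>\<^bsub>G\<^esub> f b m \<ominus>\<^bsub>G\<^esub> f b m'"
        unfolding *(1)
        using h0_minus[OF F_diff[OF F_frag F_frag] F_frag] h0_minus[OF F_frag F_frag] val *
        by simp
      then show ?thesis using additive_add[OF fr] * fcl cancel by simp
    next
      fix b a m assume *: "u = frag_of (b \<otimes>\<^bsub>B\<^esub> \<phi> a, m) - frag_of (b, a \<odot>\<^bsub>M\<^esub> m)"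
        "b \<in> carrier B" "a \<in> carrier A" "m \<in> carrier M"
      then have cl: "b \<otimes>\<^bsub>B\<^esub> \<phi> a \<in> carrier B" "a \<odot>\<^bsub>M\<^esub> m \<in> carrier M"
        using \<phi>_closed L.smult_closed by simp_all
      have "h0 u = f (b \<otimes>\<^bsub>B\<^esub> \<phi> a) m \<ominus>\<^bsub>G\<^esub> f b (a \<odot>\<^bsub>M\<^esub> m)"
        unfolding *(1) using h0_minus[OF F_frag F_frag] val * cl by simp
      then show ?thesis
        using f(2) * cl fcl[OF *(2) cl(2)] by (simp add: balanced_def G.minus_eq G.r_neg)
    qed
    with uF show "u \<in> kernel F (add_monoid G) h0" by (simp add: kernel_def)
  qed
  then have "K \<subseteq> kernel F (add_monoid G) h0"
    unfolding K_rels by (rule F.generate_subgroup_incl[OF _ h0.subgroup_kernel])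
  then obtain h where h: "h \<in> hom (F Mod K) (add_monoid G)" "\<And>u. u \<in> carrier F \<Longrightarrow> h (K #>\<^bsub>F\<^esub> u) = h0 u"
    using h0.FactGroup_universal_kernel[OF K_normal] by blast
  show ?thesis
  proof
    show "additive T G h"
      using h(1) T_abelian_group G by (auto simp: additive_def hom_def T_simps FactGroup_def)
    show "h (tens b m) = f b m" if "b \<in> carrier B" "m \<in> carrier M" for b m
      using h(2)[OF F_frag[OF that]] h0(2)[of "(b, m)"] that
      by (simp add: tens_def tensor_class_def)
  qed
qed

text \<open>The operations of \<^const>\<open>tensor\<close> are unions over representatives.  They are well defined
  because the map on generators comes from an additive map of the quotient.\<close>

lemma induced_on_class:
  assumes h: "additive T T h"
    and g: "\<And>b m. \<lbrakk>b \<in> carrier B; m \<in> carrier M\<rbrakk>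
             \<Longrightarrow> g (b, m) \<in> carrier F \<and> h (tens b m) = cls (g (b, m))"
    and C: "C \<in> carrier T"
  shows "(\<Union>u \<in> C. cls (frag_extend g u)) = h C"
proof -
  have ext: "frag_extend g u \<in> carrier F \<and> cls (frag_extend g u) = h (cls u)"
    if "Poly_Mapping.keys u \<subseteq> carrier B \<times> carrier M" for u
    using that
  proof (induction u rule: free_Abelian_group_induct[consumes 1, case_names zero minus frag])
    case zero
    then show ?case using additive_zero[OF h] by (simp add: cls_zero)
  next
    case (minus u v)
    then have "u \<in> carrier F" "v \<in> carrier F" by simp_all
    with minus show ?case
      using cls_minus cls_closed additive_minus[OF h] F_diff
      by (simp only: frag_extend_diff)
  next
    case (frag a)
    then show ?case using g by (cases a) (auto simp: tens_def simp del: F_simps)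
  qed
  obtain u0 where u0: "u0 \<in> carrier F" "C = cls u0" using C by (auto simp: T_carrier)
  have "cls (frag_extend g u) = h C" if "u \<in> C" for u
  proof -
    have u: "u \<in> K #>\<^bsub>F\<^esub> u0" using that u0 by (simp add: tensor_class_def)
    then have "u \<in> carrier F"
      using F.r_coset_subset_G[OF subgroup.subset[OF K_subgroup] u0(1)] by blast
    moreover have "cls u = C"
      unfolding u0 tensor_class_def by (rule F.repr_independence[OF u u0(1) K_subgroup, symmetric])
    ultimately show ?thesis using ext by simp
  qed
  moreover have "u0 \<in> C"
    unfolding u0 tensor_class_def by (rule F.rcos_self[OF u0(1) K_subgroup])
  ultimately show ?thesis by auto
qed

section \<open>The induced action and the induced differential\<close>

lemma smult_tensor:
  assumes b: "b \<in> carrier B"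
  shows additive_T_smult: "additive T T (\<lambda>x. b \<odot>\<^bsub>T\<^esub> x)"
    and smult_tens: "\<lbrakk>b' \<in> carrier B; m \<in> carrier M\<rbrakk> \<Longrightarrow> b \<odot>\<^bsub>T\<^esub> tens b' m = tens (b \<otimes>\<^bsub>B\<^esub> b') m"
proof -
  let ?f = "\<lambda>b' m. tens (b \<otimes>\<^bsub>B\<^esub> b') m"
  have "biadditive T ?f"
    unfolding biadditive_def
    using b additive_comp[OF B.additive_mult_left[OF b] tens_additive_left] tens_additive_right
    by auto
  moreover have "balanced ?f"
    using tens_balanced b \<phi>_closed by (auto simp: balanced_def B.ring.m_assoc[symmetric])
  ultimately obtain h where h: "additive T T h"
    "\<And>b m. \<lbrakk>b \<in> carrier B; m \<in> carrier M\<rbrakk> \<Longrightarrow> h (tens b m) = ?f b m"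
    using tensor_universal[OF T_abelian_group] by blast
  have eq: "b \<odot>\<^bsub>T\<^esub> C = h C" if "C \<in> carrier T" for C
  proof -
    have "b \<odot>\<^bsub>T\<^esub> C = (\<Union>u \<in> C. cls (frag_extend (\<lambda>(b', m). frag_of (b \<otimes>\<^bsub>B\<^esub> b', m)) u))"
      by (simp add: tensor_def Let_def)
    also have "\<dots> = h C"
      using h b that by (intro induced_on_class) (auto simp: tens_def)
    finally show ?thesis .
  qed
  show "additive T T (\<lambda>x. b \<odot>\<^bsub>T\<^esub> x)"
    by (rule additive_cong[OF h(1) eq])
  show "\<lbrakk>b' \<in> carrier B; m \<in> carrier M\<rbrakk> \<Longrightarrow> b \<odot>\<^bsub>T\<^esub> tens b' m = tens (b \<otimes>\<^bsub>B\<^esub> b') m"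
    using eq h tens_closed by simp
qed

text \<open>By biadditivity, balance can be tested on homogeneous scalars, where signs make sense.
  The element \<open>m\<close> stays arbitrary because its degree enters no sign.\<close>

lemma balancedI:
  assumes "abelian_group G" "biadditive G f"
    and "\<And>i j b a m. \<lbrakk>b \<in> homog B i; a \<in> homog A j; m \<in> carrier M\<rbrakk>
           \<Longrightarrow> f (b \<otimes>\<^bsub>B\<^esub> \<phi> a) m = f b (a \<odot>\<^bsub>M\<^esub> m)"
  shows "balanced f"
  unfolding balanced_def
proof (intro ballI)
  fix b a m assume b: "b \<in> carrier B" and a: "a \<in> carrier A" and m: "m \<in> carrier M"
  have fl: "additive B G (\<lambda>b. f b m)" if "m \<in> carrier M" for m
    using assms(2) that by (auto simp: biadditive_def)
  have fr: "additive M G (f b)" if "b \<in> carrier B" for b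
    using assms(2) that by (auto simp: biadditive_def)
  show "f (b \<otimes>\<^bsub>B\<^esub> \<phi> a) m = f b (a \<odot>\<^bsub>M\<^esub> m)"
  proof (rule additive_eqI[OF A.graded _ _ _ a])
    show "additive A G (\<lambda>a. f (b \<otimes>\<^bsub>B\<^esub> \<phi> a) m)"
      by (rule additive_comp[OF additive_comp[OF additive_\<phi> B.additive_mult_left[OF b]] fl[OF m]])
    show "additive A G (\<lambda>a. f b (a \<odot>\<^bsub>M\<^esub> m))"
      by (rule additive_comp[OF L.additive_scalar[OF m] fr[OF b]])
    fix j a assume aj: "a \<in> homog A j"
    then have a: "a \<in> carrier A" by (rule A.gr.homog_closed)
    show "f (b \<otimes>\<^bsub>B\<^esub> \<phi> a) m = f b (a \<odot>\<^bsub>M\<^esub> m)"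
    proof (rule additive_eqI[OF B.graded _ _ _ b])
      show "additive B G (\<lambda>b. f (b \<otimes>\<^bsub>B\<^esub> \<phi> a) m)"
        by (rule additive_comp[OF B.additive_mult_right[OF \<phi>_closed[OF a]] fl[OF m]])
      show "additive B G (\<lambda>b. f b (a \<odot>\<^bsub>M\<^esub> m))"
        by (rule fl[OF L.smult_closed[OF a m]])
    qed (rule assms(3)[OF _ aj m])
  qed
qed

text \<open>Balance is the only point at issue. For \<open>b\<close> of degree \<open>i\<close> and
  \<open>a\<close> of degree \<open>j\<close>, both ways of writing the tensor lead to the same
  three terms: db \<otimes> am, then b \<otimes> (da)m with sign $(-1)^i$, then b \<otimes> a(dm)
  with sign $(-1)^{i+j}$.\<close>

lemma diff_tensor:
  shows additive_T_diff: "additive T T (diff T)"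
    and diff_tens: "\<lbrakk>b \<in> carrier B; m \<in> carrier M\<rbrakk>
      \<Longrightarrow> diff T (tens b m) = tens (diff B b) m \<oplus>\<^bsub>T\<^esub> tens (sign_twist B b) (diff M m)"
proof -
  let ?f = "\<lambda>b m. tens (diff B b) m \<oplus>\<^bsub>T\<^esub> tens (sign_twist B b) (diff M m)"
  note st = B.gr.additive_sign_twist
  have bi: "biadditive T ?f"
    unfolding biadditive_def
  proof (intro conjI ballI)
    fix m assume "m \<in> carrier M"
    then show "additive B T (\<lambda>b. ?f b m)"
      by (intro additive_plus additive_comp[OF B.additive_diff tens_additive_left]
          additive_comp[OF st tens_additive_left] L.M_diff_closed)
  next
    fix b assume "b \<in> carrier B"
    then show "additive M T (?f b)"
      by (intro additive_plus tens_additive_right B.diff_closed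
          additive_comp[OF L.additive_M_diff tens_additive_right] additive_closed[OF st])
  qed
  have bal: "balanced ?f"
  proof (rule balancedI[OF T_abelian_group bi])
    fix i j b a m assume b: "b \<in> homog B i" and a: "a \<in> homog A j" and m: "m \<in> carrier M"
    have b': "b \<in> carrier B" and a': "a \<in> carrier A"
      using b a by (simp_all add: B.gr.homog_closed A.gr.homog_closed)
    have cl: "\<phi> a \<in> carrier B" "diff B b \<in> carrier B" "diff B (\<phi> a) \<in> carrier B"
      "diff A a \<in> carrier A" "diff M m \<in> carrier M" "\<phi> (diff A a) \<in> carrier B"
      using \<phi>_closed B.diff_closed A.diff_closed L.M_diff_closed a' b' m by auto
    have move: "tens (x \<otimes>\<^bsub>B\<^esub> \<phi> y) z = tens x (y \<odot>\<^bsub>M\<^esub> z)"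
      if "x \<in> carrier B" "y \<in> carrier A" "z \<in> carrier M" for x y z
      using tens_balanced that by (simp add: balanced_def)
    have sT: "tens (signed B k x) y = signed T k (tens x y)"
      if "x \<in> carrier B" "y \<in> carrier M" for k x y
      by (rule additive_apply_signed[OF tens_additive_left[OF that(2)] that(1)])
    have sT': "tens x (signed M k y) = signed T k (tens x y)"
      if "x \<in> carrier B" "y \<in> carrier M" for k x y
      by (rule additive_apply_signed[OF tens_additive_right[OF that(1)] that(2)])
    have "tens (diff B (b \<otimes>\<^bsub>B\<^esub> \<phi> a)) m
        = tens (diff B b \<otimes>\<^bsub>B\<^esub> \<phi> a) m \<oplus>\<^bsub>T\<^esub> tens (signed B i (b \<otimes>\<^bsub>B\<^esub> \<phi> (diff A a))) m"
      unfolding B.leibniz[OF b cl(1)] \<phi>_diff[OF a', symmetric]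
      using b' cl m by (intro additive_add[OF tens_additive_left]) (auto simp: signed_closed B.is_abelian_group)
    also have "\<dots> = tens (diff B b) (a \<odot>\<^bsub>M\<^esub> m) \<oplus>\<^bsub>T\<^esub> signed T i (tens b (diff A a \<odot>\<^bsub>M\<^esub> m))"
      using b' cl m a' by (simp add: sT move)
    finally have 1: "tens (diff B (b \<otimes>\<^bsub>B\<^esub> \<phi> a)) m
        = tens (diff B b) (a \<odot>\<^bsub>M\<^esub> m) \<oplus>\<^bsub>T\<^esub> signed T i (tens b (diff A a \<odot>\<^bsub>M\<^esub> m))" .
    have "sign_twist B (b \<otimes>\<^bsub>B\<^esub> \<phi> a) = signed B (i + j) (b \<otimes>\<^bsub>B\<^esub> \<phi> a)"
      by (rule B.gr.sign_twist_homog[OF B.homog_mult[OF b \<phi>_homog[OF a]]])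
    then have 2: "tens (sign_twist B (b \<otimes>\<^bsub>B\<^esub> \<phi> a)) (diff M m)
        = signed T (i + j) (tens b (a \<odot>\<^bsub>M\<^esub> diff M m))"
      using b' cl a' by (simp add: sT move)
    have "tens (sign_twist B b) (diff M (a \<odot>\<^bsub>M\<^esub> m))
        = signed T i (tens b ((diff A a \<odot>\<^bsub>M\<^esub> m) \<oplus>\<^bsub>M\<^esub> signed M j (a \<odot>\<^bsub>M\<^esub> diff M m)))"
      using b' cl a' m L.smult_closed
      by (simp add: B.gr.sign_twist_homog[OF b] sT L.M_leibniz[OF a m] signed_closed L.M_abelian_group)
    also have "\<dots> = signed T i (tens b (diff A a \<odot>\<^bsub>M\<^esub> m)) \<oplus>\<^bsub>T\<^esub> signed T (i + j) (tens b (a \<odot>\<^bsub>M\<^esub> diff M m))"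
      using b' cl a' m L.smult_closed
      by (simp add: additive_add[OF tens_additive_right[OF b']] signed_closed L.M_abelian_group sT'
          signed_add T_abelian_group tens_closed signed_signed)
    finally have 3: "tens (sign_twist B b) (diff M (a \<odot>\<^bsub>M\<^esub> m)) = \<dots>" .
    show "?f (b \<otimes>\<^bsub>B\<^esub> \<phi> a) m = ?f b (a \<odot>\<^bsub>M\<^esub> m)"
      unfolding 1 2 3 using b' cl a' m L.smult_closed
      by (simp add: T.a_assoc tens_closed signed_closed T_abelian_group)
  qed
  obtain h where h: "additive T T h"
    "\<And>b m. \<lbrakk>b \<in> carrier B; m \<in> carrier M\<rbrakk> \<Longrightarrow> h (tens b m) = ?f b m"
    using tensor_universal[OF T_abelian_group bi bal] by blast
  have eq: "diff T C = h C" if "C \<in> carrier T" for C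
  proof -
    let ?g = "\<lambda>(b, m). frag_of (diff B b, m) + frag_of (sign_twist B b, diff M m)"
    have "diff T C = (\<Union>u \<in> C. cls (frag_extend ?g u))"
      by (simp add: tensor_def Let_def)
    also have "\<dots> = h C"
    proof (rule induced_on_class[OF h(1) _ that])
      fix b m assume bm: "b \<in> carrier B" "m \<in> carrier M"
      have F: "frag_of (diff B b, m) \<in> carrier F" "frag_of (sign_twist B b, diff M m) \<in> carrier F"
        using bm B.diff_closed L.M_diff_closed additive_closed[OF st] by simp_all
      show "?g (b, m) \<in> carrier F \<and> h (tens b m) = cls (?g (b, m))"
        using F.m_closed[OF F] cls_add[OF F] h(2)[OF bm] by (simp add: tens_def)
    qed
    finally show ?thesis .
  qed
  show "additive T T (diff T)"
    by (rule additive_cong[OF h(1) eq])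
  show "\<lbrakk>b \<in> carrier B; m \<in> carrier M\<rbrakk> \<Longrightarrow> diff T (tens b m) = ?f b m"
    using eq h tens_closed by simp
qed

lemma diff_tens_homog:
  assumes "b \<in> homog B i" "m \<in> carrier M"
  shows "diff T (tens b m) = tens (diff B b) m \<oplus>\<^bsub>T\<^esub> signed T i (tens b (diff M m))"
  using assms B.gr.homog_closed L.M_diff_closed additive_apply_signed[OF tens_additive_left]
  by (simp add: diff_tens B.gr.sign_twist_homog)

section \<open>The grading of the tensor product\<close>

lemma homog_tensor:
  "homog T n = cls ` generate F {frag_of (b, m) | b m i j. b \<in> homog B i \<and> m \<in> homog M j \<and> i + j = n}"
  by (simp add: tensor_def Let_def)

lemma tens_homog: "\<lbrakk>b \<in> homog B i; m \<in> homog M j\<rbrakk> \<Longrightarrow> tens b m \<in> homog T (i + j)"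
  unfolding homog_tensor tens_def by (intro imageI generate.incl) auto

lemma homog_generators_subset:
  "{frag_of (b, m) | b m i j. b \<in> homog B i \<and> m \<in> homog M j \<and> i + j = n} \<subseteq> carrier F"
  using B.gr.homog_closed L.M.homog_closed by auto

lemma homog_T_closed: "homog T n \<subseteq> carrier T"
  unfolding homog_tensor T_carrier
  by (intro image_mono subsetI) (rule F.generate_in_carrier[OF homog_generators_subset])

lemma homog_T_zero: "\<zero>\<^bsub>T\<^esub> \<in> homog T n"
  unfolding homog_tensor cls_zero[symmetric] F_simps(2)[symmetric] by (rule imageI[OF generate.one])

lemma homog_T_add: "x \<in> homog T n \<Longrightarrow> y \<in> homog T n \<Longrightarrow> x \<oplus>\<^bsub>T\<^esub> y \<in> homog T n"
proof -
  let ?H = "{frag_of (b, m) | b m i j. b \<in> homog B i \<and> m \<in> homog M j \<and> i + j = n}"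
  assume "x \<in> homog T n" "y \<in> homog T n"
  then obtain u v where uv: "u \<in> generate F ?H" "x = cls u" "v \<in> generate F ?H" "y = cls v"
    unfolding homog_tensor by blast
  have "x \<oplus>\<^bsub>T\<^esub> y = cls (u + v)"
    unfolding uv(2,4) by (rule cls_add[symmetric];
      rule F.generate_in_carrier[OF homog_generators_subset]; rule uv)
  moreover have "u + v \<in> generate F ?H" using generate.eng[OF uv(1,3)] by simp
  ultimately show ?thesis unfolding homog_tensor by blast
qed

text \<open>A homogeneous part of the tensor product is the image of a generated subgroup, so the
  degree of \<open>h\<close> can be followed by induction over that generation.\<close>

lemma T_homog_hom:
  assumes h: "additive T N h" and N: "graded_group N" and x: "x \<in> homog T n"
    and tens: "\<And>i j b m. \<lbrakk>b \<in> homog B i; m \<in> homog M j\<rbrakk> \<Longrightarrow> h (tens b m) \<in> homog N (i + j + r)"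
  shows "h x \<in> homog N (n + r)"
proof -
  interpret N: graded_group N by fact
  let ?H = "{frag_of (b, m) | b m i j. b \<in> homog B i \<and> m \<in> homog M j \<and> i + j = n}"
  note HF = homog_generators_subset[of n]
  obtain u where u: "u \<in> generate F ?H" "x = cls u"
    using x unfolding homog_tensor by blast
  have base: "h (cls u) \<in> homog N (n + r)" if "u \<in> ?H" for u
    using that tens by (auto simp: tens_def)
  have "h (cls u) \<in> homog N (n + r)" using u(1)
  proof (induction rule: generate.induct)
    case one
    then show ?case using additive_zero[OF h] by (simp add: cls_zero N.homog_zero)
  next
    case (incl u)
    then show ?case by (rule base)
  next
    case (inv u)
    then have uF: "u \<in> carrier F" using HF by blast
    have "cls (inv\<^bsub>F\<^esub> u) = \<ominus>\<^bsub>T\<^esub> cls u"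
      using cls_minus[OF F.one_closed uF] F_inv[OF uF] cls_closed[OF uF]
      by (simp add: cls_zero T.minus_eq del: F_simps(1))
    then show ?case
      using additive_uminus[OF h cls_closed[OF uF]] base[OF inv] N.homog_uminus by simp
  next
    case (eng u v)
    have uv: "u \<in> carrier F" "v \<in> carrier F"
      using F.generate_in_carrier[OF HF] eng by simp_all
    have "h (cls (u \<otimes>\<^bsub>F\<^esub> v)) = h (cls u) \<oplus>\<^bsub>N\<^esub> h (cls v)"
      using cls_add[OF uv] additive_add[OF h cls_closed[OF uv(1)] cls_closed[OF uv(2)]] by simp
    then show ?case using eng.IH N.homog_add by simp
  qed
  then show ?thesis using u by simp
qed

end

section \<open>Vanishing of Ext\<close>

lemma (in abelian_group) uminus_zero: "\<ominus> \<zero> = \<zero>"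
  by (rule minus_equality) simp_all

text \<open>The zero map is a boundary, so \<open>f\<close> lies in its own coset modulo the
  boundaries; since the quotient has one element, that coset is the set of boundaries. Cosets are
  treated as mere sets, so the group laws of \<open>Hom_group\<close> need not be derived.
  Boundaries of degree \<open>- i\<close> come from maps of degree \<open>1 - i\<close>.\<close>

lemma Ext_trivialD:
  assumes N: "dg_module R A N" and triv: "trivial_group (Ext R A N N i)"
    and f: "f \<in> Hom_cycles R A N N (- i)"
  obtains h where "h \<in> Hom R A N N (1 - i)" "f = Hom_diff N N (1 - i) h"
proof -
  interpret N: dg_module R A N by fact
  let ?z = "\<lambda>x\<in>carrier N. \<zero>\<^bsub>N\<^esub>"
  let ?G = "(Hom_group R A N N (- i))\<lparr>carrier := Hom_cycles R A N N (- i)\<rparr>"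
  let ?H = "Hom_boundaries R A N N (- i)"
  have z: "?z \<in> Hom R A N N (1 - i)"
    using additive_zero[OF N.additive_smult] N.gr.homog_closed
    by (intro N.Hom_from_moduleI)
      (auto intro!: additiveI simp: N.M_abelian_group N.M.homog_zero signed_def N.M.uminus_zero)
  have "Hom_diff N N (1 - i) ?z = ?z"
    using N.M_diff_closed additive_zero[OF N.additive_M_diff]
    by (auto simp: Hom_diff_def signed_def N.M.minus_eq N.M.uminus_zero)
  then have zH: "?z \<in> ?H"
    using z unfolding Hom_boundaries_def by (metis imageI add.commute uminus_add_conv_diff)
  have "f \<in> ?H #>\<^bsub>?G\<^esub> f"
  proof -
    have f': "f \<in> extensional (carrier N)" "f \<in> carrier N \<rightarrow> carrier N"
      using f by (auto simp: Hom_cycles_def Hom_def R_linear_def)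
    then have "f = ?z \<otimes>\<^bsub>?G\<^esub> f"
      by (auto simp: Hom_group_def extensional_def fun_eq_iff Pi_def)
    then show ?thesis using zH unfolding r_coset_def by blast
  qed
  moreover have "?H #>\<^bsub>?G\<^esub> f \<in> carrier (?G Mod ?H)"
    using f by (auto simp: carrier_FactGroup)
  then have "?H #>\<^bsub>?G\<^esub> f = ?H"
    using triv by (simp add: trivial_group_def Ext_def Hom_homology_def)
  ultimately have "f \<in> ?H" by simp
  then show ?thesis
    using that unfolding Hom_boundaries_def by (auto simp: add.commute[of "- i"])
qed

section \<open>Liftings as decompositions of the module\<close>

text \<open>For $N \cong B \otimes_A M$, the map \<open>j\<close> is $m \mapsto 1 \otimes m$, while \<open>c\<close> and \<open>D\<close>
  are induced by $X \mapsto 0$ and by $d/dX$ on the factor $B$.\<close>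

locale lifting_data = even_adjunction R A w t + N: dg_module R "adjoin_even A w t" N
    + L: dg_module R A M
  for R :: "'r ring" and A :: "('r, 'a) dg" and w :: int and t :: 'a
    and N :: "(nat \<Rightarrow> 'a, 'n) dg" and M :: "('a, 'm) dg" +
  fixes j :: "'m \<Rightarrow> 'n" and c :: "'n \<Rightarrow> 'm" and D :: "'n \<Rightarrow> 'n"
  assumes j_additive: "additive M N j"
    and j_smult: "\<lbrakk>a \<in> carrier A; m \<in> carrier M\<rbrakk> \<Longrightarrow> j (a \<odot>\<^bsub>M\<^esub> m) = \<iota> a \<odot>\<^bsub>N\<^esub> j m"
    and j_homog: "m \<in> homog M n \<Longrightarrow> j m \<in> homog N n"
    and j_diff: "m \<in> carrier M \<Longrightarrow> j (diff M m) = diff N (j m)"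
    and generated: "\<lbrakk>x \<in> carrier N;
          \<And>i b m. \<lbrakk>b \<in> homog B i; m \<in> carrier M\<rbrakk> \<Longrightarrow> P (b \<odot>\<^bsub>N\<^esub> j m);
          \<And>x y. \<lbrakk>x \<in> carrier N; y \<in> carrier N; P x; P y\<rbrakk> \<Longrightarrow> P (x \<oplus>\<^bsub>N\<^esub> y)\<rbrakk> \<Longrightarrow> P x"
    and c_additive: "additive N M c"
    and c_j: "\<lbrakk>b \<in> homog B i; m \<in> carrier M\<rbrakk> \<Longrightarrow> c (b \<odot>\<^bsub>N\<^esub> j m) = b 0 \<odot>\<^bsub>M\<^esub> m"
    and c_homog: "x \<in> homog N n \<Longrightarrow> c x \<in> homog M n"
    and D_additive: "additive N N D"
    and D_j: "\<lbrakk>b \<in> homog B i; m \<in> carrier M\<rbrakk> \<Longrightarrow> D (b \<odot>\<^bsub>N\<^esub> j m) = ddX b \<odot>\<^bsub>N\<^esub> j m"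
    and D_homog: "x \<in> homog N n \<Longrightarrow> D x \<in> homog N (n - w)"
begin

lemmas j_closed = additive_closed[OF j_additive]
lemmas c_closed = additive_closed[OF c_additive]
lemmas D_closed = additive_closed[OF D_additive]

lemma N_eqI:
  assumes f: "additive N G f" and g: "additive N G g"
    and "\<And>i b m. \<lbrakk>b \<in> homog B i; m \<in> carrier M\<rbrakk> \<Longrightarrow> f (b \<odot>\<^bsub>N\<^esub> j m) = g (b \<odot>\<^bsub>N\<^esub> j m)"
    and x: "x \<in> carrier N"
  shows "f x = g x"
  using x assms(3)
proof (rule generated)
  fix x y assume "x \<in> carrier N" "y \<in> carrier N" "f x = g x" "f y = g y"
  then show "f (x \<oplus>\<^bsub>N\<^esub> y) = g (x \<oplus>\<^bsub>N\<^esub> y)"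
    using additive_add[OF f] additive_add[OF g] by simp
qed

lemma j_one: "m \<in> carrier M \<Longrightarrow> \<one>\<^bsub>B\<^esub> \<odot>\<^bsub>N\<^esub> j m = j m"
  by (rule N.smult_one[OF j_closed])

lemma c_j_one: "m \<in> carrier M \<Longrightarrow> c (j m) = m"
  using c_j[OF B.homog_one] j_one L.smult_one by (simp add: one_adjoin_even adjoin_incl_def)

lemma D_j_one: "m \<in> carrier M \<Longrightarrow> D (j m) = \<zero>\<^bsub>N\<^esub>"
  using D_j[OF B.homog_one, of m] j_one[of m] additive_zero[OF N.additive_scalar[OF j_closed]]
  by (simp add: one_divpow ddX_divpow_0)

text \<open>On the generators \<open>b' j m\<close> this is the product rule for \<open>ddX\<close>
  applied to the product of \<open>b\<close> and \<open>b'\<close>.\<close>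

lemma D_smult:
  assumes b: "b \<in> homog B i" and x: "x \<in> carrier N"
  shows "D (b \<odot>\<^bsub>N\<^esub> x) = (ddX b \<odot>\<^bsub>N\<^esub> x) \<oplus>\<^bsub>N\<^esub> (b \<odot>\<^bsub>N\<^esub> D x)"
proof -
  have bc: "b \<in> carrier B" by (rule B.gr.homog_closed[OF b])
  show ?thesis
  proof (rule N_eqI[OF _ _ _ x])
    show "additive N N (\<lambda>x. D (b \<odot>\<^bsub>N\<^esub> x))"
      by (rule additive_comp[OF N.additive_smult[OF bc] D_additive])
    show "additive N N (\<lambda>x. (ddX b \<odot>\<^bsub>N\<^esub> x) \<oplus>\<^bsub>N\<^esub> (b \<odot>\<^bsub>N\<^esub> D x))"
      by (intro additive_plus N.additive_smult ddX_closed bc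
          additive_comp[OF D_additive N.additive_smult])
    fix k b' m assume b': "b' \<in> homog B k" and m: "m \<in> carrier M"
    have bc': "b' \<in> carrier B" by (rule B.gr.homog_closed[OF b'])
    note cl = bc bc' ddX_closed[OF bc] ddX_closed[OF bc'] j_closed[OF m]
    have "D (b \<odot>\<^bsub>N\<^esub> (b' \<odot>\<^bsub>N\<^esub> j m)) = ddX (b \<otimes>\<^bsub>B\<^esub> b') \<odot>\<^bsub>N\<^esub> j m"
      using cl D_j[OF B.homog_mult[OF b b'] m] by (simp add: N.smult_assoc)
    also have "\<dots> = (ddX b \<odot>\<^bsub>N\<^esub> (b' \<odot>\<^bsub>N\<^esub> j m)) \<oplus>\<^bsub>N\<^esub> (b \<odot>\<^bsub>N\<^esub> D (b' \<odot>\<^bsub>N\<^esub> j m))"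
      using cl D_j[OF b' m] by (simp add: ddX_mult N.smult_l_distr N.smult_assoc)
    finally show "D (b \<odot>\<^bsub>N\<^esub> (b' \<odot>\<^bsub>N\<^esub> j m))
      = (ddX b \<odot>\<^bsub>N\<^esub> (b' \<odot>\<^bsub>N\<^esub> j m)) \<oplus>\<^bsub>N\<^esub> (b \<odot>\<^bsub>N\<^esub> D (b' \<odot>\<^bsub>N\<^esub> j m))" .
  qed
qed

lemma diff_generator:
  assumes b: "b \<in> homog B i" and m: "m \<in> carrier M"
  shows "diff N (b \<odot>\<^bsub>N\<^esub> j m) = (diff B b \<odot>\<^bsub>N\<^esub> j m) \<oplus>\<^bsub>N\<^esub> signed N i (b \<odot>\<^bsub>N\<^esub> j (diff M m))"
  using N.M_leibniz[OF b j_closed[OF m]] j_diff[OF m] by simp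

text \<open>On generators it reduces to the fact that \<open>ddX\<close> commutes with the
  differential of \<open>B\<close>. The Leibniz signs agree because \<open>ddX b\<close> has degree
  \<open>i - w\<close>, which has the parity of \<open>i\<close>.\<close>

lemma D_diff:
  assumes x: "x \<in> carrier N" shows "D (diff N x) = diff N (D x)"
proof (rule N_eqI[OF _ _ _ x])
  show "additive N N (\<lambda>x. D (diff N x))" by (rule additive_comp[OF N.additive_M_diff D_additive])
  show "additive N N (\<lambda>x. diff N (D x))" by (rule additive_comp[OF D_additive N.additive_M_diff])
  fix i b m assume b: "b \<in> homog B i" and m: "m \<in> carrier M"
  have bc: "b \<in> carrier B" by (rule B.gr.homog_closed[OF b])
  note dm = L.M_diff_closed[OF m]
  note cl = bc B.diff_closed[OF bc] j_closed[OF m] j_closed[OF dm]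
  have "D (diff N (b \<odot>\<^bsub>N\<^esub> j m))
      = D (diff B b \<odot>\<^bsub>N\<^esub> j m) \<oplus>\<^bsub>N\<^esub> signed N i (D (b \<odot>\<^bsub>N\<^esub> j (diff M m)))"
    unfolding diff_generator[OF b m] using cl
    by (simp add: additive_add[OF D_additive] additive_apply_signed[OF D_additive]
        N.smult_closed signed_closed N.M_abelian_group)
  also have "\<dots> = (diff B (ddX b) \<odot>\<^bsub>N\<^esub> j m) \<oplus>\<^bsub>N\<^esub> signed N i (ddX b \<odot>\<^bsub>N\<^esub> j (diff M m))"
    by (simp add: D_j[OF B.diff_degree[OF b] m] D_j[OF b dm] ddX_diff)
  also have "\<dots> = diff N (D (b \<odot>\<^bsub>N\<^esub> j m))"
    unfolding D_j[OF b m] diff_generator[OF ddX_homog[OF b] m] using w_even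
    by (simp add: signed_def)
  finally show "D (diff N (b \<odot>\<^bsub>N\<^esub> j m)) = diff N (D (b \<odot>\<^bsub>N\<^esub> j m))" .
qed

text \<open>Taking the constant term is a ring map from \<open>B\<close> to \<open>A\<close>, and
  \<open>c\<close> is semilinear over it.\<close>

lemma c_smult:
  assumes b: "b \<in> homog B i" and x: "x \<in> carrier N"
  shows "c (b \<odot>\<^bsub>N\<^esub> x) = b 0 \<odot>\<^bsub>M\<^esub> c x"
proof -
  have bc: "b \<in> carrier B" by (rule B.gr.homog_closed[OF b])
  show ?thesis
  proof (rule N_eqI[OF _ _ _ x])
    show "additive N M (\<lambda>x. c (b \<odot>\<^bsub>N\<^esub> x))"
      by (rule additive_comp[OF N.additive_smult[OF bc] c_additive])
    show "additive N M (\<lambda>x. b 0 \<odot>\<^bsub>M\<^esub> c x)"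
      by (rule additive_comp[OF c_additive L.additive_smult[OF B_closed[OF bc]]])
    fix k b' m assume b': "b' \<in> homog B k" and m: "m \<in> carrier M"
    have bc': "b' \<in> carrier B" by (rule B.gr.homog_closed[OF b'])
    show "c (b \<odot>\<^bsub>N\<^esub> (b' \<odot>\<^bsub>N\<^esub> j m)) = b 0 \<odot>\<^bsub>M\<^esub> c (b' \<odot>\<^bsub>N\<^esub> j m)"
      using c_j[OF B.homog_mult[OF b b'] m] c_j[OF b' m] bc bc' m j_closed
      by (simp add: N.smult_assoc mult_coeff_0 L.smult_assoc B_closed)
  qed
qed

lemma c_smult_incl:
  "a \<in> homog A i \<Longrightarrow> x \<in> carrier N \<Longrightarrow> c (\<iota> a \<odot>\<^bsub>N\<^esub> x) = a \<odot>\<^bsub>M\<^esub> c x"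
  using c_smult[OF incl_homog] by (simp add: adjoin_incl_def)

text \<open>The failure of \<open>c\<close> to be a chain map comes from $dX = t$: the constant term
  of the differential of \<open>b\<close> is that of a chain map plus \<open>t\<close> times
  \<open>b 1\<close>, and \<open>b 1\<close> is the constant term of \<open>ddX b\<close>.\<close>

lemma c_diff:
  assumes x: "x \<in> carrier N"
  shows "c (diff N x) = diff M (c x) \<oplus>\<^bsub>M\<^esub> (t \<odot>\<^bsub>M\<^esub> c (D x))"
proof (rule N_eqI[OF _ _ _ x])
  show "additive N M (\<lambda>x. c (diff N x))" by (rule additive_comp[OF N.additive_M_diff c_additive])
  show "additive N M (\<lambda>x. diff M (c x) \<oplus>\<^bsub>M\<^esub> (t \<odot>\<^bsub>M\<^esub> c (D x)))"
    by (intro additive_plus additive_comp[OF c_additive L.additive_M_diff]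
        additive_comp[OF additive_comp[OF D_additive c_additive] L.additive_smult] t_closed)
  fix i b m assume b: "b \<in> homog B i" and m: "m \<in> carrier M"
  have bc: "b \<in> carrier B" by (rule B.gr.homog_closed[OF b])
  have b0: "b 0 \<in> homog A i" using coeff_homog[OF b, of 0] by simp
  note dm = L.M_diff_closed[OF m]
  have cl: "diff B b \<odot>\<^bsub>N\<^esub> j m \<in> carrier N" "b \<odot>\<^bsub>N\<^esub> j (diff M m) \<in> carrier N"
    "diff A (b 0) \<odot>\<^bsub>M\<^esub> m \<in> carrier M" "t \<otimes>\<^bsub>A\<^esub> b (Suc 0) \<in> carrier A"
    "t \<odot>\<^bsub>M\<^esub> (b (Suc 0) \<odot>\<^bsub>M\<^esub> m) \<in> carrier M" "b 0 \<odot>\<^bsub>M\<^esub> diff M m \<in> carrier M"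
    "diff A (b 0) \<in> carrier A"
    using bc m dm j_closed B.diff_closed A.diff_closed B_closed t_closed
    by (simp_all add: N.smult_closed L.smult_closed)
  have d0: "diff B b 0 = diff A (b 0) \<oplus>\<^bsub>A\<^esub> (t \<otimes>\<^bsub>A\<^esub> b (Suc 0))"
    by (simp add: diff_adjoin_even)
  have dX0: "ddX b 0 = b (Suc 0)" by (simp add: ddX_def)
  have "c (diff N (b \<odot>\<^bsub>N\<^esub> j m)) = c (diff B b \<odot>\<^bsub>N\<^esub> j m) \<oplus>\<^bsub>M\<^esub> signed M i (c (b \<odot>\<^bsub>N\<^esub> j (diff M m)))"
    unfolding diff_generator[OF b m] using cl
    by (simp add: additive_add[OF c_additive] additive_apply_signed[OF c_additive]
        signed_closed N.M_abelian_group)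
  also have "\<dots> = ((diff A (b 0) \<odot>\<^bsub>M\<^esub> m) \<oplus>\<^bsub>M\<^esub> (t \<odot>\<^bsub>M\<^esub> (b (Suc 0) \<odot>\<^bsub>M\<^esub> m)))
      \<oplus>\<^bsub>M\<^esub> signed M i (b 0 \<odot>\<^bsub>M\<^esub> diff M m)"
    using cl bc m t_closed B_closed
    by (simp add: c_j[OF B.diff_degree[OF b] m] c_j[OF b dm] d0 L.smult_l_distr L.smult_assoc)
  also have "\<dots> = diff M (c (b \<odot>\<^bsub>N\<^esub> j m)) \<oplus>\<^bsub>M\<^esub> (t \<odot>\<^bsub>M\<^esub> c (D (b \<odot>\<^bsub>N\<^esub> j m)))"
    using cl m
    by (simp add: c_j[OF b m] D_j[OF b m] c_j[OF ddX_homog[OF b] m] L.M_leibniz[OF b0 m] dX0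
        L.M.a_ac signed_closed L.M_abelian_group)
  finally show "c (diff N (b \<odot>\<^bsub>N\<^esub> j m))
      = diff M (c (b \<odot>\<^bsub>N\<^esub> j m)) \<oplus>\<^bsub>M\<^esub> (t \<odot>\<^bsub>M\<^esub> c (D (b \<odot>\<^bsub>N\<^esub> j m)))" .
qed

end

text \<open>Both sides only depend on the class of \<open>x\<close> modulo the submodule generated by the
  $X^{(i)}$ with $i > 0$.\<close>

lemma coefficient_of_representative:
  assumes "lifting_data R A w t N M j c D" "lifting_data R A w t N M' j' c' D'"
    and k: "additive N N k"
      "\<And>i b x. \<lbrakk>b \<in> homog (adjoin_even A w t) i; x \<in> carrier N\<rbrakk>
         \<Longrightarrow> k (b \<odot>\<^bsub>N\<^esub> x) = signed N (r * i) (b \<odot>\<^bsub>N\<^esub> k x)"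
    and x: "x \<in> carrier N"
  shows "c' (k (j (c x))) = c' (k x)"
proof -
  interpret L1: lifting_data R A w t N M j c D by fact
  interpret L2: lifting_data R A w t N M' j' c' D' by fact
  show ?thesis
  proof (rule L1.N_eqI[OF _ _ _ x])
    show "additive N M' (\<lambda>x. c' (k (j (c x))))"
      by (intro additive_comp[OF additive_comp[OF additive_comp[OF L1.c_additive L1.j_additive] k(1)] L2.c_additive])
    show "additive N M' (\<lambda>x. c' (k x))"
      by (rule additive_comp[OF k(1) L2.c_additive])
    fix i b m assume b: "b \<in> homog L1.B i" and m: "m \<in> carrier M"
    have b0: "b 0 \<in> homog A i" using L1.coeff_homog[OF b, of 0] by simp
    have bc: "b \<in> carrier L1.B" "b 0 \<in> carrier A"
      using b b0 L1.B.gr.homog_closed L1.A.gr.homog_closed by blast+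
    have jm: "j m \<in> carrier N" "k (j m) \<in> carrier N"
      using L1.j_closed[OF m] additive_closed[OF k(1)] by auto
    \<comment> \<open>On a generator, \<open>j\<close> after \<open>c\<close> replaces
      \<open>b\<close> by its constant term. That term again has degree \<open>i\<close>, so
      \<open>k\<close> produces the same sign, and \<open>c'\<close> does not see the
      difference.\<close>
    have "c' (k (j (c (b \<odot>\<^bsub>N\<^esub> j m)))) = signed M' (r * i) (b 0 \<odot>\<^bsub>M'\<^esub> c' (k (j m)))"
      using jm bc m
      by (simp add: L1.c_j[OF b m] L1.j_smult k(2)[OF L1.incl_homog[OF b0]]
          additive_apply_signed[OF L2.c_additive] L1.N.smult_closed L1.incl_closed
          L2.c_smult_incl[OF b0])
    also have "\<dots> = c' (k (b \<odot>\<^bsub>N\<^esub> j m))"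
      using jm bc
      by (simp add: k(2)[OF b] additive_apply_signed[OF L2.c_additive] L1.N.smult_closed
          L2.c_smult[OF b])
    finally show "c' (k (j (c (b \<odot>\<^bsub>N\<^esub> j m)))) = c' (k (b \<odot>\<^bsub>N\<^esub> j m))" .
  qed
qed

section \<open>Comparison of two liftings whose derivations are homotopic\<close>

locale lifting_pair = L1: lifting_data R A w t N M1 j1 c1 D1 + L2: lifting_data R A w t N M2 j2 c2 D2
  for R :: "'r ring" and A :: "('r, 'a) dg" and w :: int and t :: 'a
    and N :: "(nat \<Rightarrow> 'a, 'n) dg" and M1 :: "('a, 'm) dg" and j1 c1 D1
    and M2 :: "('a, 'l) dg" and j2 c2 D2 +
  fixes h :: "'n \<Rightarrow> 'n"
  assumes h_additive: "additive N N h"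
    and h_homog: "x \<in> homog N n \<Longrightarrow> h x \<in> homog N (n + (1 - w))"
    and h_smult: "\<lbrakk>b \<in> homog (adjoin_even A w t) i; x \<in> carrier N\<rbrakk>
          \<Longrightarrow> h (b \<odot>\<^bsub>N\<^esub> x) = signed N ((1 - w) * i) (b \<odot>\<^bsub>N\<^esub> h x)"
    and h_homotopy: "x \<in> carrier N
          \<Longrightarrow> D1 x \<ominus>\<^bsub>N\<^esub> D2 x = diff N (h x) \<oplus>\<^bsub>N\<^esub> h (diff N x)"
begin

text \<open>The second summand is chosen so that its differential supplies what \<open>c2 j1\<close>
  lacks: the homotopy expresses the defect \<open>t c2 (D1 - D2) j1\<close> through
  \<open>h\<close>.\<close>

definition compare :: "'m \<Rightarrow> 'l" where
  "compare m = c2 (j1 m) \<oplus>\<^bsub>M2\<^esub> (t \<odot>\<^bsub>M2\<^esub> c2 (h (j1 m)))"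

lemmas h_closed = additive_closed[OF h_additive]
lemmas t_closed = L1.t_closed

lemma compare_additive: "additive M1 M2 compare"
  unfolding compare_def
  by (intro additive_plus additive_comp[OF L1.j_additive L2.c_additive]
      additive_comp[OF additive_comp[OF additive_comp[OF L1.j_additive h_additive] L2.c_additive]
        L2.L.additive_smult] t_closed)

text \<open>The degrees \<open>w - 1\<close> of \<open>t\<close> and \<open>1 - w\<close> of
  \<open>h\<close> cancel.\<close>

lemma compare_homog: "m \<in> homog M1 n \<Longrightarrow> compare m \<in> homog M2 (n + 0)"
  unfolding compare_def
  using L2.c_homog[OF L1.j_homog] L2.L.M_homog_smult[OF L1.t_homog L2.c_homog[OF h_homog[OF L1.j_homog]]]
  by (auto intro!: L2.L.M.homog_add)

text \<open>Moving \<open>a\<close> past \<open>h\<close> and moving it past \<open>t\<close> each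
  cost the sign $(-1)^i$, because both have odd degree; the two signs cancel.\<close>

lemma compare_smult:
  assumes a: "a \<in> homog A i" and m: "m \<in> carrier M1"
  shows "compare (a \<odot>\<^bsub>M1\<^esub> m) = a \<odot>\<^bsub>M2\<^esub> compare m"
proof -
  have ac: "a \<in> carrier A" by (rule L1.A.gr.homog_closed[OF a])
  note jm = L1.j_closed[OF m] h_closed[OF L1.j_closed[OF m]]
  note cl = jm L2.c_closed[OF jm(1)] L2.c_closed[OF jm(2)] ac L1.t_closed L1.incl_closed[OF ac]
  have ta: "t \<otimes>\<^bsub>A\<^esub> a = signed A i (a \<otimes>\<^bsub>A\<^esub> t)"
    using L1.A.graded_comm[OF L1.t_homog a] L1.w_even by (simp add: signed_def)
  have "t \<odot>\<^bsub>M2\<^esub> c2 (h (j1 (a \<odot>\<^bsub>M1\<^esub> m))) = signed M2 i (t \<odot>\<^bsub>M2\<^esub> (a \<odot>\<^bsub>M2\<^esub> c2 (h (j1 m))))"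
    using cl m L1.w_even
    by (simp add: L1.j_smult h_smult[OF L1.incl_homog[OF a]] additive_apply_signed[OF L2.c_additive]
        L1.N.smult_closed L2.c_smult_incl[OF a] L2.L.smult_signed_right L2.L.smult_closed)
      (simp add: signed_def)
  also have "t \<odot>\<^bsub>M2\<^esub> (a \<odot>\<^bsub>M2\<^esub> c2 (h (j1 m))) = signed M2 i (a \<odot>\<^bsub>M2\<^esub> (t \<odot>\<^bsub>M2\<^esub> c2 (h (j1 m))))"
    using cl by (simp add: L2.L.smult_assoc[symmetric] ta L2.L.smult_signed_left)
  finally have "t \<odot>\<^bsub>M2\<^esub> c2 (h (j1 (a \<odot>\<^bsub>M1\<^esub> m))) = a \<odot>\<^bsub>M2\<^esub> (t \<odot>\<^bsub>M2\<^esub> c2 (h (j1 m)))"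
    using cl
    by (simp add: signed_signed L2.L.M_abelian_group L2.L.smult_closed)
      (simp add: signed_def)
  then show ?thesis
    using cl m by (simp add: compare_def L1.j_smult L2.c_smult_incl[OF a] L2.L.smult_r_distr L2.L.smult_closed)
qed

lemma t_t_smult: "y \<in> carrier M2 \<Longrightarrow> t \<odot>\<^bsub>M2\<^esub> (t \<odot>\<^bsub>M2\<^esub> y) = \<zero>\<^bsub>M2\<^esub>"
  using L2.L.smult_assoc[OF t_closed t_closed, of y] additive_zero[OF L2.L.additive_scalar, of y]
  by (simp add: L1.t_square)

lemma diff_t_smult:
  "y \<in> carrier M2 \<Longrightarrow> diff M2 (t \<odot>\<^bsub>M2\<^esub> y) = \<ominus>\<^bsub>M2\<^esub> (t \<odot>\<^bsub>M2\<^esub> diff M2 y)"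
  using L2.L.M_leibniz[OF L1.t_homog, of y] L1.w_even additive_zero[OF L2.L.additive_scalar, of y]
    L2.L.smult_closed[OF t_closed L2.L.M_diff_closed]
  by (simp add: L1.t_cycle signed_def)

text \<open>Put \<open>y = j1 m\<close>. Since \<open>D1 y\<close> is zero, the homotopy determines
  \<open>D2 y\<close>, and \<open>c_diff\<close> makes the differential of \<open>c2 y\<close> equal
  to \<open>p + q + r\<close>. The correction term contributes \<open>- q\<close>. What remains,
  \<open>p + r\<close>, is the value of \<open>compare\<close> at the differential of
  \<open>m\<close>.\<close>

lemma compare_diff:
  assumes m: "m \<in> carrier M1"
  shows "compare (diff M1 m) = diff M2 (compare m)"
proof -
  define y where "y = j1 m"
  have y: "y \<in> carrier N" using L1.j_closed[OF m] by (simp add: y_def)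
  note hy = h_closed[OF y] note dy = L1.N.M_diff_closed[OF y]
  define p q r where "p = c2 (diff N y)" and "q = t \<odot>\<^bsub>M2\<^esub> c2 (diff N (h y))"
    and "r = t \<odot>\<^bsub>M2\<^esub> c2 (h (diff N y))"
  have pqr: "p \<in> carrier M2" "q \<in> carrier M2" "r \<in> carrier M2"
    using dy L1.N.M_diff_closed[OF hy] h_closed[OF dy] L2.c_closed L2.L.smult_closed[OF t_closed]
    by (simp_all add: p_def q_def r_def)
  have D1y: "D1 y = \<zero>\<^bsub>N\<^esub>" using L1.D_j_one[OF m] by (simp add: y_def)
  have tD2: "t \<odot>\<^bsub>M2\<^esub> c2 (D2 y) = \<ominus>\<^bsub>M2\<^esub> (q \<oplus>\<^bsub>M2\<^esub> r)"
  proof -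
    have "\<ominus>\<^bsub>N\<^esub> D2 y = diff N (h y) \<oplus>\<^bsub>N\<^esub> h (diff N y)"
      using h_homotopy[OF y] L2.D_closed[OF y] by (simp add: D1y L1.N.M.minus_eq)
    then have "D2 y = \<ominus>\<^bsub>N\<^esub> (diff N (h y) \<oplus>\<^bsub>N\<^esub> h (diff N y))"
      using L2.D_closed[OF y] by (metis L1.N.M.minus_minus)
    then show ?thesis
      using L1.N.M_diff_closed[OF hy] h_closed[OF dy] L2.c_closed t_closed
      by (simp add: additive_uminus[OF L2.c_additive] additive_add[OF L2.c_additive]
          additive_uminus[OF L2.L.additive_smult] L2.L.smult_r_distr q_def r_def)
  qed
  have 1: "diff M2 (c2 y) = p \<oplus>\<^bsub>M2\<^esub> (q \<oplus>\<^bsub>M2\<^esub> r)"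
  proof -
    have "p = diff M2 (c2 y) \<oplus>\<^bsub>M2\<^esub> \<ominus>\<^bsub>M2\<^esub> (q \<oplus>\<^bsub>M2\<^esub> r)"
      unfolding p_def L2.c_diff[OF y] tD2 ..
    then have "p \<oplus>\<^bsub>M2\<^esub> (q \<oplus>\<^bsub>M2\<^esub> r)
        = (diff M2 (c2 y) \<oplus>\<^bsub>M2\<^esub> \<ominus>\<^bsub>M2\<^esub> (q \<oplus>\<^bsub>M2\<^esub> r)) \<oplus>\<^bsub>M2\<^esub> (q \<oplus>\<^bsub>M2\<^esub> r)"
      by simp
    then show ?thesis
      using pqr L2.L.M_diff_closed[OF L2.c_closed[OF y]] by (simp add: L2.L.M.a_assoc L2.L.M.l_neg)
  qed
  \<comment> \<open>At \<open>h y\<close> the defect of \<open>c2\<close> is a multiple of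
    \<open>t\<close>, so it disappears after multiplication by \<open>t\<close>; the sign comes from
    moving the differential past \<open>t\<close>.\<close>
  have 2: "diff M2 (t \<odot>\<^bsub>M2\<^esub> c2 (h y)) = \<ominus>\<^bsub>M2\<^esub> q"
  proof -
    note cl = L2.c_closed[OF hy] L2.L.M_diff_closed[OF L2.c_closed[OF hy]] L2.c_closed[OF L2.D_closed[OF hy]]
    have "q = t \<odot>\<^bsub>M2\<^esub> diff M2 (c2 (h y))"
      unfolding q_def L2.c_diff[OF hy]
      using cl t_closed by (simp add: L2.L.smult_r_distr L2.L.smult_closed t_t_smult)
    then show ?thesis by (simp add: diff_t_smult cl)
  qed
  have "diff M2 (compare m) = diff M2 (c2 y) \<oplus>\<^bsub>M2\<^esub> diff M2 (t \<odot>\<^bsub>M2\<^esub> c2 (h y))"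
    using L2.c_closed[OF y] L2.L.smult_closed[OF t_closed L2.c_closed[OF hy]]
    by (simp add: compare_def L2.L.M_diff_add flip: y_def)
  also have "\<dots> = p \<oplus>\<^bsub>M2\<^esub> r \<oplus>\<^bsub>M2\<^esub> (q \<oplus>\<^bsub>M2\<^esub> \<ominus>\<^bsub>M2\<^esub> q)"
    unfolding 1 2 using pqr by (simp add: L2.L.M.a_ac)
  also have "\<dots> = compare (diff M1 m)"
    using pqr by (simp add: L2.L.M.r_neg compare_def L1.j_diff[OF m] p_def r_def flip: y_def)
  finally show ?thesis by simp
qed

lemma compare_dg_hom: "restrict compare (carrier M1) \<in> dg_hom R A M1 M2"
  using L1.L.Hom_from_moduleI[OF compare_additive compare_homog]
    compare_smult compare_diff L1.L.M_diff_closed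
  by (simp add: dg_hom_def signed_def)

lemma coefficient_through:
  assumes "x \<in> carrier N"
  shows "c1 (j2 (c2 x)) = c1 x" "c1 (h (j2 (c2 x))) = c1 (h x)"
proof -
  note L = L2.lifting_data_axioms L1.lifting_data_axioms
  show "c1 (j2 (c2 x)) = c1 x"
    by (rule coefficient_of_representative[OF L additive_id[OF L1.N.M_abelian_group] _ assms, where r = 0])
      (simp add: signed_def)
  show "c1 (h (j2 (c2 x))) = c1 (h x)"
    by (rule coefficient_of_representative[OF L h_additive h_smult assms])
qed

text \<open>The left side is the comparison map of the interchanged pair, written out. With
  \<open>s = t c1 h j1 m\<close> its first summand is \<open>m + s\<close> and its second is
  \<open>s\<close>, up to a term containing $t^2$; both use that \<open>c1 j2 c2\<close> may be
  replaced by \<open>c1\<close>.\<close>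

lemma compare_inverse:
  assumes m: "m \<in> carrier M1"
  shows "c1 (j2 (compare m)) \<ominus>\<^bsub>M1\<^esub> (t \<odot>\<^bsub>M1\<^esub> c1 (h (j2 (compare m)))) = m"
proof -
  define y where "y = j1 m"
  have y: "y \<in> carrier N" using L1.j_closed[OF m] by (simp add: y_def)
  note hy = h_closed[OF y]
  define v where "v = t \<odot>\<^bsub>M2\<^esub> c2 (h y)"
  have cmp: "compare m = c2 y \<oplus>\<^bsub>M2\<^esub> v" by (simp add: compare_def y_def v_def)
  note cl = L2.c_closed[OF y] L2.c_closed[OF hy]
  have v: "v \<in> carrier M2" using L2.L.smult_closed[OF t_closed cl(2)] by (simp add: v_def)
  define s where "s = t \<odot>\<^bsub>M1\<^esub> c1 (h y)"
  have s: "s \<in> carrier M1" using L1.L.smult_closed[OF t_closed L1.c_closed[OF hy]] by (simp add: s_def)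
  have jv: "j2 v = L1.\<iota> t \<odot>\<^bsub>N\<^esub> j2 (c2 (h y))"
    unfolding v_def by (rule L2.j_smult[OF t_closed cl(2)])
  note jc = L2.j_closed[OF cl(2)] h_closed[OF L2.j_closed[OF cl(2)]]
  have "c1 (j2 (compare m)) = c1 (j2 (c2 y)) \<oplus>\<^bsub>M1\<^esub> c1 (j2 v)"
    unfolding cmp using cl v L2.j_closed
    by (simp add: additive_add[OF L2.j_additive] additive_add[OF L1.c_additive])
  also have "c1 (j2 v) = s"
    unfolding jv s_def L1.c_smult_incl[OF L1.t_homog jc(1)] coefficient_through(1)[OF hy] ..
  finally have 1: "c1 (j2 (compare m)) = m \<oplus>\<^bsub>M1\<^esub> s"
    using coefficient_through(1)[OF y] L1.c_j_one[OF m] by (simp add: y_def)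
  have "c1 (h (j2 (compare m))) = c1 (h (j2 (c2 y))) \<oplus>\<^bsub>M1\<^esub> c1 (h (j2 v))"
    unfolding cmp using cl v L2.j_closed h_closed
    by (simp add: additive_add[OF L2.j_additive] additive_add[OF L1.c_additive] additive_add[OF h_additive])
  also have "c1 (h (j2 v)) = signed M1 ((1 - w) * (w - 1)) (t \<odot>\<^bsub>M1\<^esub> c1 (h (j2 (c2 (h y)))))"
    using jc t_closed
    by (simp add: jv h_smult[OF L1.incl_homog[OF L1.t_homog]] additive_apply_signed[OF L1.c_additive]
        L1.N.smult_closed L1.incl_closed L1.c_smult_incl[OF L1.t_homog])
  finally have 2: "t \<odot>\<^bsub>M1\<^esub> c1 (h (j2 (compare m))) = s"
  proof -
    define z where "z = c1 (h (j2 (c2 (h y))))"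
    have z: "z \<in> carrier M1" unfolding z_def by (rule L1.c_closed[OF jc(2)])
    have tt: "t \<odot>\<^bsub>M1\<^esub> (t \<odot>\<^bsub>M1\<^esub> z) = \<zero>\<^bsub>M1\<^esub>"
      using L1.L.smult_assoc[OF t_closed t_closed z] additive_zero[OF L1.L.additive_scalar[OF z]]
      by (simp add: L1.t_square)
    assume "c1 (h (j2 (compare m))) = c1 (h (j2 (c2 y))) \<oplus>\<^bsub>M1\<^esub>
        signed M1 ((1 - w) * (w - 1)) (t \<odot>\<^bsub>M1\<^esub> c1 (h (j2 (c2 (h y)))))"
    then show ?thesis
      using z tt t_closed L1.c_closed[OF hy] s
      by (simp add: coefficient_through(2)[OF y] L1.L.smult_r_distr L1.L.smult_closed signed_closed
          L1.L.M_abelian_group L1.L.smult_signed_right additive_apply_signed flip: z_def s_def)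
        (simp add: signed_def L1.L.M.uminus_zero)
  qed
  show ?thesis unfolding 1 2 using m s by (simp add: L1.L.M.minus_eq L1.L.M.a_assoc L1.L.M.r_neg)
qed

text \<open>Interchanging the liftings negates the homotopy. The other inverse law then follows from
  the first by symmetry.\<close>

lemma swap:
  "lifting_pair R A w t N M2 j2 c2 D2 M1 j1 c1 D1 (\<lambda>x. \<ominus>\<^bsub>N\<^esub> h x)"
proof (intro lifting_pair.intro lifting_pair_axioms.intro L2.lifting_data_axioms L1.lifting_data_axioms)
  show "additive N N (\<lambda>x. \<ominus>\<^bsub>N\<^esub> h x)" by (rule additive_neg[OF h_additive])
  show "\<ominus>\<^bsub>N\<^esub> h x \<in> homog N (n + (1 - w))" if "x \<in> homog N n" for x n
    using that by (intro L1.N.M.homog_uminus h_homog)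
  show "\<ominus>\<^bsub>N\<^esub> h (b \<odot>\<^bsub>N\<^esub> x) = signed N ((1 - w) * i) (b \<odot>\<^bsub>N\<^esub> \<ominus>\<^bsub>N\<^esub> h x)"
    if "b \<in> homog L1.B i" "x \<in> carrier N" for b i x
  proof -
    have b: "b \<in> carrier L1.B" by (rule L1.B.gr.homog_closed[OF that(1)])
    show ?thesis
      using h_smult[OF that] b h_closed[OF that(2)]
      by (simp add: additive_uminus[OF L1.N.additive_smult[OF b]] signed_def)
  qed
  show "D2 x \<ominus>\<^bsub>N\<^esub> D1 x = diff N (\<ominus>\<^bsub>N\<^esub> h x) \<oplus>\<^bsub>N\<^esub> \<ominus>\<^bsub>N\<^esub> h (diff N x)" if x: "x \<in> carrier N" for x
  proof -
    note cl = L1.D_closed[OF x] L2.D_closed[OF x] h_closed[OF x] L1.N.M_diff_closed[OF h_closed[OF x]]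
      h_closed[OF L1.N.M_diff_closed[OF x]]
    have "D2 x \<ominus>\<^bsub>N\<^esub> D1 x = \<ominus>\<^bsub>N\<^esub> (D1 x \<ominus>\<^bsub>N\<^esub> D2 x)"
      using cl by (simp add: L1.N.M.minus_eq L1.N.M.minus_add L1.N.M.a_comm)
    also have "\<dots> = diff N (\<ominus>\<^bsub>N\<^esub> h x) \<oplus>\<^bsub>N\<^esub> \<ominus>\<^bsub>N\<^esub> h (diff N x)"
      unfolding h_homotopy[OF x] using cl
      by (simp add: L1.N.M.minus_add additive_uminus[OF L1.N.additive_M_diff])
    finally show ?thesis .
  qed
qed

end

context lifting_pair
begin

interpretation S: lifting_pair R A w t N M2 j2 c2 D2 M1 j1 c1 D1 "\<lambda>x. \<ominus>\<^bsub>N\<^esub> h x"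
  by (rule swap)

lemma compare_left_inverse: "m \<in> carrier M1 \<Longrightarrow> S.compare (compare m) = m"
proof -
  assume m: "m \<in> carrier M1"
  note cm = additive_closed[OF compare_additive m]
  note hj = h_closed[OF L2.j_closed[OF cm]]
  show "S.compare (compare m) = m"
    using compare_inverse[OF m] hj L1.c_closed[OF hj] t_closed
    by (simp add: S.compare_def additive_uminus[OF L1.c_additive]
        additive_uminus[OF L1.L.additive_smult] L1.L.M.minus_eq)
qed

lemma compare_right_inverse: "m \<in> carrier M2 \<Longrightarrow> compare (S.compare m) = m"
proof -
  assume m: "m \<in> carrier M2"
  note cm = additive_closed[OF S.compare_additive m]
  note jc = L1.j_closed[OF cm] note hj = h_closed[OF jc]
  have "c2 (\<ominus>\<^bsub>N\<^esub> h (j1 (S.compare m))) = \<ominus>\<^bsub>M2\<^esub> c2 (h (j1 (S.compare m)))"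
    by (rule additive_uminus[OF L2.c_additive hj])
  then show "compare (S.compare m) = m"
    using S.compare_inverse[OF m] L2.c_closed[OF hj] t_closed L2.L.smult_closed[OF t_closed L2.c_closed[OF hj]]
    by (simp add: compare_def additive_uminus[OF L2.L.additive_smult] L2.L.M.minus_eq)
qed

lemma liftings_isomorphic: "dg_isomorphic R A M1 M2"
  unfolding dg_isomorphic_def
proof (intro bexI conjI ballI)
  show "restrict compare (carrier M1) \<in> dg_hom R A M1 M2" by (rule compare_dg_hom)
  show "restrict S.compare (carrier M2) \<in> dg_hom R A M2 M1" by (rule S.compare_dg_hom)
qed (simp_all add: compare_left_inverse compare_right_inverse
    additive_closed[OF compare_additive] additive_closed[OF S.compare_additive])

end

section \<open>From a lifting to its decomposition data, and uniqueness\<close>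

context even_adjunction
begin

text \<open>The maps \<open>c\<close> and \<open>D\<close> are built on the tensor product, where
  the universal property applies, and are carried to \<open>N\<close> by the isomorphism
  \<open>f\<close> with inverse \<open>g\<close>. Already on the tensor product, \<open>D\<close>
  takes its values in \<open>N\<close>, where the module laws are at hand.\<close>

lemma lifting_data_exists:
  assumes N: "dg_module R B N" and lift: "is_lifting R A B \<iota> N M"
  obtains j c D where "lifting_data R A w t N M j c D"
proof -
  interpret N: dg_module R B N by fact
  interpret L: dg_module R A M using lift by (simp add: is_lifting_def)
  interpret bc: base_change R A B \<iota> M
    by (intro base_change.intro dg_algebra_hom_incl L.dg_module_axioms)
  obtain f g where f: "f \<in> dg_hom R B N bc.T" and g: "g \<in> dg_hom R B bc.T N"
    and gf: "\<And>x. x \<in> carrier N \<Longrightarrow> g (f x) = x" and fg: "\<And>y. y \<in> carrier bc.T \<Longrightarrow> f (g y) = y"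
    using lift by (auto simp: is_lifting_def dg_isomorphic_def)
  have fH: "f \<in> Hom R B N bc.T 0" and gH: "g \<in> Hom R B bc.T N 0"
    and g_diff: "\<And>y. y \<in> carrier bc.T \<Longrightarrow> g (diff bc.T y) = diff N (g y)"
    using f g by (auto simp: dg_hom_def)
  have f_add: "additive N bc.T f" by (rule Hom_additive[OF N.M_abelian_group bc.T_abelian_group fH])
  have g_add: "additive bc.T N g" by (rule Hom_additive[OF bc.T_abelian_group N.M_abelian_group gH])
  have g_smult: "g (b \<odot>\<^bsub>bc.T\<^esub> y) = b \<odot>\<^bsub>N\<^esub> g y" if "b \<in> homog B i" "y \<in> carrier bc.T" for b i y
    using Hom_smult[OF gH that] by (simp add: signed_def)
  have tens_closed: "bc.tens b m \<in> carrier bc.T" if "b \<in> carrier B" "m \<in> carrier M" for b m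
    by (rule bc.tens_closed[OF that])
  define j where "j m = g (bc.tens \<one>\<^bsub>B\<^esub> m)" for m
  have j_add: "additive M N j"
    unfolding j_def by (rule additive_comp[OF bc.tens_additive_right[OF B.ring.one_closed] g_add])
  note j_closed = additive_closed[OF j_add]
  have g_tens: "g (bc.tens b m) = b \<odot>\<^bsub>N\<^esub> j m" if b: "b \<in> homog B i" and m: "m \<in> carrier M" for b i m
    using g_smult[OF b tens_closed[OF B.ring.one_closed m]] bc.smult_tens[of b "\<one>\<^bsub>B\<^esub>" m]
      B.gr.homog_closed[OF b] m by (simp add: j_def)
  have f_j: "f (b \<odot>\<^bsub>N\<^esub> j m) = bc.tens b m" if b: "b \<in> homog B i" and m: "m \<in> carrier M" for b i m
    using fg[OF tens_closed[OF B.gr.homog_closed[OF b] m]] g_tens[OF b m] by simp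
  obtain c where c: "additive bc.T M c"
    "\<And>b m. \<lbrakk>b \<in> carrier B; m \<in> carrier M\<rbrakk> \<Longrightarrow> c (bc.tens b m) = b 0 \<odot>\<^bsub>M\<^esub> m"
  proof (rule bc.tensor_universal[OF L.M_abelian_group])
    show "bc.biadditive M (\<lambda>b m. b 0 \<odot>\<^bsub>M\<^esub> m)"
      unfolding bc.biadditive_def
      by (intro conjI ballI additive_comp[OF additive_coeff L.additive_scalar] L.additive_smult B_closed)
    show "bc.balanced (\<lambda>b m. b 0 \<odot>\<^bsub>M\<^esub> m)"
      by (simp add: bc.balanced_def mult_incl_right L.smult_assoc B_closed)
  qed blast
  obtain D where D: "additive bc.T N D"
    "\<And>b m. \<lbrakk>b \<in> carrier B; m \<in> carrier M\<rbrakk> \<Longrightarrow> D (bc.tens b m) = ddX b \<odot>\<^bsub>N\<^esub> j m"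
  proof (rule bc.tensor_universal[OF N.M_abelian_group])
    show bi: "bc.biadditive N (\<lambda>b m. ddX b \<odot>\<^bsub>N\<^esub> j m)"
      unfolding bc.biadditive_def
      by (intro conjI ballI additive_comp[OF additive_ddX N.additive_scalar] j_closed
          additive_comp[OF j_add N.additive_smult] ddX_closed)
    show "bc.balanced (\<lambda>b m. ddX b \<odot>\<^bsub>N\<^esub> j m)"
    proof (rule bc.balancedI[OF N.M_abelian_group bi])
      fix i k b a m assume b: "b \<in> homog B i" and a: "a \<in> homog A k" and m: "m \<in> carrier M"
      have bc': "b \<in> carrier B" "a \<in> carrier A"
        using B.gr.homog_closed[OF b] A.gr.homog_closed[OF a] by auto
      have am: "a \<odot>\<^bsub>M\<^esub> m \<in> carrier M" by (rule L.smult_closed[OF bc'(2) m])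
      have "j (a \<odot>\<^bsub>M\<^esub> m) = g (bc.tens (\<iota> a) m)"
        using bc.tens_balanced bc' m incl_closed[OF bc'(2)]
        unfolding j_def bc.balanced_def by (metis B.ring.l_one B.ring.one_closed)
      also have "\<dots> = \<iota> a \<odot>\<^bsub>N\<^esub> j m" by (rule g_tens[OF incl_homog[OF a] m])
      finally show "ddX (b \<otimes>\<^bsub>B\<^esub> \<iota> a) \<odot>\<^bsub>N\<^esub> j m = ddX b \<odot>\<^bsub>N\<^esub> j (a \<odot>\<^bsub>M\<^esub> m)"
        using bc' m by (simp add: ddX_mult_incl N.smult_assoc ddX_closed incl_closed j_closed)
    qed
  qed blast
  have "lifting_data R A w t N M j (\<lambda>x. c (f x)) (\<lambda>x. D (f x))"
  proof (intro lifting_data.intro lifting_data_axioms.intro even_adjunction_axioms N L.dg_module_axioms)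
    show "additive M N j" by (rule j_add)
  next
    fix a m assume a: "a \<in> carrier A" and m: "m \<in> carrier M"
    show "j (a \<odot>\<^bsub>M\<^esub> m) = \<iota> a \<odot>\<^bsub>N\<^esub> j m"
    \<comment> \<open>The isomorphism is known to be linear over homogeneous scalars, so
      \<open>a\<close> is made homogeneous first.\<close>
    proof (rule additive_eqI[OF A.graded _ _ _ a])
      show "additive A N (\<lambda>a. j (a \<odot>\<^bsub>M\<^esub> m))" by (rule additive_comp[OF L.additive_scalar[OF m] j_add])
      show "additive A N (\<lambda>a. \<iota> a \<odot>\<^bsub>N\<^esub> j m)"
        by (rule additive_comp[OF additive_\<phi> N.additive_scalar[OF j_closed[OF m]]])
      fix i a assume a: "a \<in> homog A i"
      have ac: "a \<in> carrier A" by (rule A.gr.homog_closed[OF a])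
      have "j (a \<odot>\<^bsub>M\<^esub> m) = g (bc.tens (\<iota> a) m)"
        using bc.tens_balanced ac m incl_closed[OF ac]
        unfolding j_def bc.balanced_def by (metis B.ring.l_one B.ring.one_closed)
      then show "j (a \<odot>\<^bsub>M\<^esub> m) = \<iota> a \<odot>\<^bsub>N\<^esub> j m" by (simp add: g_tens[OF incl_homog[OF a] m])
    qed
  next
    fix m n assume "m \<in> homog M n"
    then show "j m \<in> homog N n"
      using Hom_homog[OF gH bc.tens_homog[OF B.homog_one]] by (simp add: j_def)
  next
    fix m assume m: "m \<in> carrier M"
    have "diff bc.T (bc.tens \<one>\<^bsub>B\<^esub> m) = bc.tens \<one>\<^bsub>B\<^esub> (diff M m)"
      using bc.diff_tens_homog[OF B.homog_one m] additive_zero[OF bc.tens_additive_left[OF m]]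
        tens_closed[OF B.ring.one_closed L.M_diff_closed[OF m]]
      by (simp add: B.diff_one signed_def)
    then show "j (diff M m) = diff N (j m)"
      using g_diff[OF tens_closed[OF B.ring.one_closed m]] by (simp add: j_def)
  next
    fix x P
    assume x: "x \<in> carrier N"
      and gen: "\<And>i b m. \<lbrakk>b \<in> homog B i; m \<in> carrier M\<rbrakk> \<Longrightarrow> P (b \<odot>\<^bsub>N\<^esub> j m)"
      and P_add: "\<And>x y. \<lbrakk>x \<in> carrier N; y \<in> carrier N; P x; P y\<rbrakk> \<Longrightarrow> P (x \<oplus>\<^bsub>N\<^esub> y)"
    \<comment> \<open>Tensor induction produces differences, while \<open>generated\<close> closes
      \<open>P\<close> under sums only. Carrying \<open>P\<close> for an element and its negative
      turns each difference into a sum.\<close>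
    define Q where "Q y \<longleftrightarrow> P (g y) \<and> P (\<ominus>\<^bsub>N\<^esub> g y)" for y
    have "Q (f x)"
    proof (induction rule: bc.T_induct[OF additive_closed[OF f_add x]])
      case (1 b m)
      then have b: "b \<in> carrier B" and m: "m \<in> carrier M" by auto
      have ga: "additive B N (\<lambda>b. g (bc.tens b m))"
        by (rule additive_comp[OF bc.tens_additive_left[OF m] g_add])
      show ?case using b
      proof (induction b rule: B.gr.homog_induct)
        case zero
        have "P (\<zero>\<^bsub>N\<^esub>)" using gen[OF B.gr.homog_zero m] additive_zero[OF N.additive_scalar[OF j_closed[OF m]]] by simp
        then show ?case using additive_zero[OF ga] by (simp add: Q_def N.M.uminus_zero)
      next
        case (homog i b)
        have b: "b \<in> carrier B" by (rule B.gr.homog_closed[OF homog])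
        have "g (bc.tens b m) = b \<odot>\<^bsub>N\<^esub> j m" by (rule g_tens[OF homog m])
        moreover have "\<ominus>\<^bsub>N\<^esub> (b \<odot>\<^bsub>N\<^esub> j m) = (\<ominus>\<^bsub>B\<^esub> b) \<odot>\<^bsub>N\<^esub> j m"
          using additive_uminus[OF N.additive_scalar[OF j_closed[OF m]] b] by simp
        ultimately show ?case
          using gen[OF homog m] gen[OF B.gr.homog_uminus[OF homog] m] by (simp add: Q_def)
      next
        case (add y z)
        have cl: "g (bc.tens y m) \<in> carrier N" "g (bc.tens z m) \<in> carrier N"
          using additive_closed[OF ga] add by auto
        have "g (bc.tens (y \<oplus>\<^bsub>B\<^esub> z) m) = g (bc.tens y m) \<oplus>\<^bsub>N\<^esub> g (bc.tens z m)"
          using additive_add[OF ga] add by simp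
        then show ?case
          using add(3,4) cl P_add
          by (simp add: Q_def N.M.minus_add)
      qed
    next
      case (2 y z)
      then have cl: "g y \<in> carrier N" "g z \<in> carrier N"
        using additive_closed[OF g_add] by auto
      have "g (y \<ominus>\<^bsub>bc.T\<^esub> z) = g y \<oplus>\<^bsub>N\<^esub> \<ominus>\<^bsub>N\<^esub> g z"
        using additive_minus[OF g_add] 2 by (simp add: N.M.minus_eq)
      then show ?case
        using 2(3,4) cl P_add by (simp add: Q_def N.M.minus_add N.M.minus_minus)
    qed
    then show "P x" by (simp add: Q_def gf[OF x])
  next
    show "additive N M (\<lambda>x. c (f x))" by (rule additive_comp[OF f_add c(1)])
    show "additive N N (\<lambda>x. D (f x))" by (rule additive_comp[OF f_add D(1)])
  next
    fix b i m assume b: "b \<in> homog B i" and m: "m \<in> carrier M"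
    show "c (f (b \<odot>\<^bsub>N\<^esub> j m)) = b 0 \<odot>\<^bsub>M\<^esub> m" "D (f (b \<odot>\<^bsub>N\<^esub> j m)) = ddX b \<odot>\<^bsub>N\<^esub> j m"
      using B.gr.homog_closed[OF b] m by (simp_all add: f_j[OF b m] c(2) D(2))
  next
    fix x n assume x: "x \<in> homog N n"
    have fx: "f x \<in> homog bc.T n" using Hom_homog[OF fH x] by simp
    have "c (f x) \<in> homog M (n + 0)"
    proof (rule bc.T_homog_hom[OF c(1) L.M_graded fx])
      fix i k b m assume b: "b \<in> homog B i" and m: "m \<in> homog M k"
      show "c (bc.tens b m) \<in> homog M (i + k + 0)"
        using L.M_homog_smult[OF coeff_homog[OF b, of 0] m] c(2)
          B.gr.homog_closed[OF b] L.M.homog_closed[OF m] by simp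
    qed
    then show "c (f x) \<in> homog M n" by simp
    have "D (f x) \<in> homog N (n + (- w))"
    proof (rule bc.T_homog_hom[OF D(1) N.M_graded fx])
      fix i k b m assume b: "b \<in> homog B i" and m: "m \<in> homog M k"
      have jm: "j m \<in> homog N k"
        using m Hom_homog[OF gH bc.tens_homog[OF B.homog_one m]] by (simp add: j_def)
      show "D (bc.tens b m) \<in> homog N (i + k + (- w))"
        using N.M_homog_smult[OF ddX_homog[OF b] jm] D(2)
          B.gr.homog_closed[OF b] L.M.homog_closed[OF m] by (simp add: algebra_simps)
    qed
    then show "D (f x) \<in> homog N (n - w)" by simp
  qed
  then show ?thesis by (rule that)
qed

text \<open>Both derivations obey the product rule with the same \<open>ddX\<close>, so the terms
  that differentiate the scalar cancel in their difference, which is therefore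
  \<open>B\<close>-linear. It is a cycle because each derivation commutes with the
  differential.\<close>

theorem lifting_unique:
  assumes N: "dg_module R B N" and ext: "trivial_group (Ext R B N N w)"
    and lift: "is_lifting R A B \<iota> N M1" "is_lifting R A B \<iota> N M2"
  shows "dg_isomorphic R A M1 M2"
proof -
  interpret N: dg_module R B N by fact
  obtain j1 c1 D1 where "lifting_data R A w t N M1 j1 c1 D1"
    using lifting_data_exists[OF N lift(1)] .
  then interpret L1: lifting_data R A w t N M1 j1 c1 D1 .
  obtain j2 c2 D2 where "lifting_data R A w t N M2 j2 c2 D2"
    using lifting_data_exists[OF N lift(2)] .
  then interpret L2: lifting_data R A w t N M2 j2 c2 D2 .
  let ?\<Delta> = "\<lambda>x. D1 x \<ominus>\<^bsub>N\<^esub> D2 x"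
  have \<Delta>: "additive N N ?\<Delta>" by (rule additive_diff[OF L1.D_additive L2.D_additive])
  have hom: "restrict ?\<Delta> (carrier N) \<in> Hom R B N N (- w)"
  proof (rule N.Hom_from_moduleI[OF \<Delta>])
    show "?\<Delta> x \<in> homog N (n + - w)" if "x \<in> homog N n" for n x
      using L1.D_homog[OF that] L2.D_homog[OF that] by (simp add: N.M.homog_minus)
    fix i b x assume b: "b \<in> homog B i" and x: "x \<in> carrier N"
    have bc: "b \<in> carrier B" by (rule B.gr.homog_closed[OF b])
    note cl = N.smult_closed[OF ddX_closed[OF bc] x] N.smult_closed[OF bc L1.D_closed[OF x]]
      N.smult_closed[OF bc L2.D_closed[OF x]]
    have "?\<Delta> (b \<odot>\<^bsub>N\<^esub> x) = (b \<odot>\<^bsub>N\<^esub> D1 x) \<ominus>\<^bsub>N\<^esub> (b \<odot>\<^bsub>N\<^esub> D2 x)"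
    proof -
      have "?\<Delta> (b \<odot>\<^bsub>N\<^esub> x) = ((ddX b \<odot>\<^bsub>N\<^esub> x) \<ominus>\<^bsub>N\<^esub> (ddX b \<odot>\<^bsub>N\<^esub> x)) \<oplus>\<^bsub>N\<^esub> ((b \<odot>\<^bsub>N\<^esub> D1 x) \<ominus>\<^bsub>N\<^esub> (b \<odot>\<^bsub>N\<^esub> D2 x))"
        unfolding L1.D_smult[OF b x] L2.D_smult[OF b x] using cl
        by (simp add: N.M.minus_eq N.M.minus_add N.M.a_ac)
      then show ?thesis using cl by (simp add: N.M.minus_eq N.M.r_neg)
    qed
    also have "\<dots> = b \<odot>\<^bsub>N\<^esub> ?\<Delta> x"
      using additive_minus[OF N.additive_smult[OF bc] L1.D_closed[OF x] L2.D_closed[OF x]] by simp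
    finally show "?\<Delta> (b \<odot>\<^bsub>N\<^esub> x) = signed N (- w * i) (b \<odot>\<^bsub>N\<^esub> ?\<Delta> x)"
      using w_even by (simp add: signed_def)
  qed
  have "diff N (?\<Delta> x) \<ominus>\<^bsub>N\<^esub> ?\<Delta> (diff N x) = \<zero>\<^bsub>N\<^esub>" if x: "x \<in> carrier N" for x
    using L1.D_closed[OF x] L2.D_closed[OF x] N.M_diff_closed additive_minus[OF N.additive_M_diff]
    by (simp add: L1.D_diff[OF x] L2.D_diff[OF x] N.M.minus_eq N.M.r_neg)
  then have "restrict ?\<Delta> (carrier N) \<in> Hom_cycles R B N N (- w)"
    using hom w_even N.M_diff_closed by (auto simp: Hom_cycles_def Hom_diff_def signed_def)
  \<comment> \<open>The degree \<open>1 - w\<close> is odd, so the minus sign in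
    \<open>Hom_diff\<close> becomes the plus sign of a homotopy.\<close>
  then obtain h where h: "h \<in> Hom R B N N (1 - w)" "restrict ?\<Delta> (carrier N) = Hom_diff N N (1 - w) h"
    using Ext_trivialD[OF N ext] by blast
  have h_add: "additive N N h" by (rule Hom_additive[OF N.M_abelian_group N.M_abelian_group h(1)])
  interpret lifting_pair R A w t N M1 j1 c1 D1 M2 j2 c2 D2 h
  proof (intro lifting_pair.intro lifting_pair_axioms.intro L1.lifting_data_axioms L2.lifting_data_axioms h_add)
    show "h x \<in> homog N (n + (1 - w))" if "x \<in> homog N n" for x n
      by (rule Hom_homog[OF h(1) that])
    show "h (b \<odot>\<^bsub>N\<^esub> x) = signed N ((1 - w) * i) (b \<odot>\<^bsub>N\<^esub> h x)"
      if "b \<in> homog B i" "x \<in> carrier N" for b i x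
      by (rule Hom_smult[OF h(1) that])
    fix x assume x: "x \<in> carrier N"
    have "h (diff N x) \<in> carrier N" by (rule additive_closed[OF h_add N.M_diff_closed[OF x]])
    moreover have "?\<Delta> x = Hom_diff N N (1 - w) h x"
      using fun_cong[OF h(2), of x] x by simp
    ultimately show "?\<Delta> x = diff N (h x) \<oplus>\<^bsub>N\<^esub> h (diff N x)"
      using x w_even by (simp add: Hom_diff_def signed_def N.M.minus_eq)
  qed
  show ?thesis by (rule liftings_isomorphic)
qed

end

section \<open>Lifting along a locally nilpotent derivation\<close>

text \<open>Nilpotency is required element by element: it makes each expansion in divided powers
  finite, with a length that may depend on the element.\<close>

locale nilpotent_derivation = even_adjunction R A w t + N: dg_module R "adjoin_even A w t" N
  for R :: "'r ring" and A :: "('r, 'a) dg" and w :: int and t :: 'a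
    and N :: "(nat \<Rightarrow> 'a, 'n) dg" +
  fixes D :: "'n \<Rightarrow> 'n"
  assumes D_additive: "additive N N D"
    and D_smult: "\<lbrakk>b \<in> carrier (adjoin_even A w t); x \<in> carrier N\<rbrakk>
          \<Longrightarrow> D (b \<odot>\<^bsub>N\<^esub> x) = (ddX b \<odot>\<^bsub>N\<^esub> x) \<oplus>\<^bsub>N\<^esub> (b \<odot>\<^bsub>N\<^esub> D x)"
    and D_homog: "x \<in> homog N n \<Longrightarrow> D x \<in> homog N (n - w)"
    and D_diff: "x \<in> carrier N \<Longrightarrow> D (diff N x) = diff N (D x)"
    and D_nilpotent: "x \<in> carrier N \<Longrightarrow> \<exists>k. (D ^^ k) x = \<zero>\<^bsub>N\<^esub>"
begin

text \<open>Scalars are restricted along the inclusion of \<open>A\<close>. The elements keep the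
  type of \<open>N\<close>, as \<open>liftable\<close> demands.\<close>

definition ker_D :: "('a, 'n) dg" where
  "ker_D = \<lparr>carrier = {x \<in> carrier N. D x = \<zero>\<^bsub>N\<^esub>}, monoid.mult = undefined, one = undefined,
     ring.zero = \<zero>\<^bsub>N\<^esub>, add = add N, smult = (\<lambda>a x. \<iota> a \<odot>\<^bsub>N\<^esub> x),
     homog = (\<lambda>n. {x \<in> homog N n. D x = \<zero>\<^bsub>N\<^esub>}), diff = diff N\<rparr>"

lemma ker_D_simps:
  "x \<in> carrier ker_D \<longleftrightarrow> x \<in> carrier N \<and> D x = \<zero>\<^bsub>N\<^esub>"
  "\<zero>\<^bsub>ker_D\<^esub> = \<zero>\<^bsub>N\<^esub>" "x \<oplus>\<^bsub>ker_D\<^esub> y = x \<oplus>\<^bsub>N\<^esub> y" "a \<odot>\<^bsub>ker_D\<^esub> x = \<iota> a \<odot>\<^bsub>N\<^esub> x"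
  "x \<in> homog ker_D n \<longleftrightarrow> x \<in> homog N n \<and> D x = \<zero>\<^bsub>N\<^esub>" "diff ker_D = diff N"
  by (simp_all add: ker_D_def)

lemmas D_closed = additive_closed[OF D_additive]

lemma ker_D_abelian_group: "abelian_group ker_D"
proof (rule abelian_groupI)
  fix x assume x: "x \<in> carrier ker_D"
  then show "\<exists>y\<in>carrier ker_D. y \<oplus>\<^bsub>ker_D\<^esub> x = \<zero>\<^bsub>ker_D\<^esub>"
    by (intro bexI[of _ "\<ominus>\<^bsub>N\<^esub> x"])
      (simp_all add: ker_D_simps N.M.l_neg additive_uminus[OF D_additive] N.M.uminus_zero)
qed (auto simp: ker_D_simps N.M.a_ac additive_add[OF D_additive] additive_zero[OF D_additive])

sublocale K: abelian_group ker_D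
  by (rule ker_D_abelian_group)

lemma ker_D_inclusion: "additive ker_D N (\<lambda>x. x)"
  by (intro additiveI ker_D_abelian_group N.M_abelian_group) (simp_all add: ker_D_simps)

text \<open>A homogeneous \<open>D\<close> maps the component of \<open>x\<close> in degree
  \<open>n\<close> to the component of \<open>D x\<close> in degree \<open>n - w\<close>, so it
  kills every component of an element that it kills.\<close>

lemma ker_D_graded: "graded_group ker_D"
proof (intro graded_group.intro graded_group_axioms.intro ker_D_abelian_group)
  fix n
  show "subgroup (homog ker_D n) (add_monoid ker_D)"
  proof (rule group.subgroupI[OF K.a_group])
    show "homog ker_D n \<subseteq> carrier (add_monoid ker_D)"
      using N.M.homog_closed by (auto simp: ker_D_simps)
    show "homog ker_D n \<noteq> {}"
      using N.M.homog_zero additive_zero[OF D_additive] by (auto simp: ker_D_def)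
    fix x y assume x: "x \<in> homog ker_D n" and y: "y \<in> homog ker_D n"
    have xc: "x \<in> carrier ker_D" using x N.M.homog_closed by (auto simp: ker_D_simps)
    show "inv\<^bsub>add_monoid ker_D\<^esub> x \<in> homog ker_D n"
      unfolding a_inv_def[symmetric] using additive_uminus[OF ker_D_inclusion xc] x xc
      by (simp add: ker_D_simps N.M.homog_uminus N.M.uminus_zero additive_uminus[OF D_additive])
    show "x \<otimes>\<^bsub>add_monoid ker_D\<^esub> y \<in> homog ker_D n"
      using x y N.M.homog_closed[of x n] N.M.homog_closed[of y n]
      by (simp add: ker_D_simps N.M.homog_add additive_add[OF D_additive])
  qed
next
  fix x assume x: "x \<in> carrier ker_D"
  have D0: "D (component N x n) = \<zero>\<^bsub>N\<^esub>" for n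
    using component_additive_homog[OF N.M_graded N.M_graded D_additive, of "- w" x n] D_homog x
    by (simp add: ker_D_simps N.M.component_zero)
  \<comment> \<open>Sums in the kernel are sums in \<open>N\<close>, so existence and uniqueness of
    decompositions are inherited from \<open>N\<close>.\<close>
  have decomp: "is_decomp ker_D x f \<longleftrightarrow> is_decomp N x f \<and> (\<forall>n. D (f n) = \<zero>\<^bsub>N\<^esub>)" for f
  proof (cases "\<forall>n. f n \<in> carrier ker_D")
    case True
    then have "finsum N f S = finsum ker_D f S" for S
      using additive_finsum[OF ker_D_inclusion, of f S] by auto
    then show ?thesis by (auto simp: is_decomp_def ker_D_simps)
  next
    case False
    then show ?thesis using N.M.homog_closed by (auto simp: is_decomp_def ker_D_simps)
  qed
  show "\<exists>!f. is_decomp ker_D x f"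
    using N.M.component_decomp[of x] N.M.decomp_ex1[of x] D0 x unfolding decomp
    by (auto simp: ker_D_simps)
qed

text \<open>The kernel is stable under \<open>A\<close> because \<open>ddX\<close> kills
  \<open>A\<close>, and under the differential because \<open>D\<close> commutes with it. The axioms
  are then restrictions of those of \<open>N\<close>.\<close>

lemma ker_D_dg_module: "dg_module R A ker_D"
proof -
  have sg: "signed ker_D k x = signed N k x" if "x \<in> carrier ker_D" for k x
    using additive_apply_signed[OF ker_D_inclusion that] by simp
  have smD: "D (\<iota> a \<odot>\<^bsub>N\<^esub> x) = \<zero>\<^bsub>N\<^esub>" if "a \<in> carrier A" "x \<in> carrier N" "D x = \<zero>\<^bsub>N\<^esub>" for a x
    using D_smult[OF incl_closed[OF that(1)] that(2)] that
      additive_zero[OF N.additive_scalar[OF that(2)]] additive_zero[OF N.additive_smult[OF incl_closed[OF that(1)]]]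
    by (simp add: ddX_incl)
  have dD: "D (diff N x) = \<zero>\<^bsub>N\<^esub>" if "x \<in> carrier N" "D x = \<zero>\<^bsub>N\<^esub>" for x
    using D_diff[OF that(1)] that(2) additive_zero[OF N.additive_M_diff] by simp
  have leib: "diff N (\<iota> a \<odot>\<^bsub>N\<^esub> x)
      = (\<iota> (diff A a) \<odot>\<^bsub>N\<^esub> x) \<oplus>\<^bsub>N\<^esub> signed N i (\<iota> a \<odot>\<^bsub>N\<^esub> diff N x)"
    if "a \<in> homog A i" "x \<in> carrier N" for a i x
    using N.M_leibniz[OF incl_homog[OF that(1)] that(2)] A.gr.homog_closed[OF that(1)] by (simp add: \<phi>_diff)
  have diff_add: "additive ker_D ker_D (diff N)"
    by (intro additiveI ker_D_abelian_group) (simp_all add: ker_D_simps dD N.M_diff_closed N.M_diff_add)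
  have lin: "R_linear R A ker_D ker_D (diff ker_D)"
  proof (rule R_linearI[OF A.dg_algebra_axioms])
    show "additive ker_D ker_D (diff ker_D)" using diff_add by (simp add: ker_D_simps)
    fix a x assume a: "a \<in> homog A 0" and x: "x \<in> carrier ker_D"
    \<comment> \<open>The differential of a scalar of degree 0 lies in degree -1, where
      \<open>A\<close> is zero.\<close>
    have "diff A a = \<zero>\<^bsub>A\<^esub>" using A.diff_degree[OF a] A.homog_neg[of "-1"] by simp
    then show "diff ker_D (a \<odot>\<^bsub>ker_D\<^esub> x) = a \<odot>\<^bsub>ker_D\<^esub> diff ker_D x"
      using leib[OF a, of x] x additive_zero[OF additive_\<phi>] additive_zero[OF N.additive_scalar, of x]
        N.smult_closed[OF incl_closed[OF A.gr.homog_closed[OF a]] N.M_diff_closed]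
      by (simp add: ker_D_simps signed_def)
  qed
  have smDh: "D (\<iota> a \<odot>\<^bsub>N\<^esub> x) = \<zero>\<^bsub>N\<^esub>" if "a \<in> homog A i" "x \<in> homog N j \<and> D x = \<zero>\<^bsub>N\<^esub>" for a i x j
    using that smD A.gr.homog_closed N.M.homog_closed by blast
  have dDh: "D (diff N x) = \<zero>\<^bsub>N\<^esub>" if "x \<in> homog N j \<and> D x = \<zero>\<^bsub>N\<^esub>" for x j
    using that dD N.M.homog_closed by blast
  show ?thesis
    using lin smD dD
    by (intro dg_module.intro dg_module_axioms.intro A.dg_algebra_axioms ker_D_graded)
      (auto intro: smDh dDh simp: ker_D_simps N.smult_closed incl_closed N.smult_l_distr N.smult_r_distr \<phi>_add
        \<phi>_mult N.smult_assoc \<phi>_one N.smult_one N.M_homog_smult incl_homog N.M_diff_degree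
        N.M_diff_diff leib sg A.gr.homog_closed N.M_diff_closed)
qed

section \<open>Expansions in divided powers over the kernel\<close>

sublocale L: base_change R A "adjoin_even A w t" "adjoin_incl A" ker_D
  by (intro base_change.intro dg_algebra_hom_incl ker_D_dg_module)

text \<open>Each application of \<open>D\<close> lowers the divided power by one, without an integer
  factor, and leaves \<open>x\<close> untouched.\<close>

lemma D_divpow: "x \<in> carrier ker_D \<Longrightarrow> (D ^^ k) (divpow A k \<odot>\<^bsub>N\<^esub> x) = x"
proof (induction k)
  case 0
  then show ?case using N.smult_one[of x] by (simp add: ker_D_simps one_divpow)
next
  case (Suc k)
  then have x: "x \<in> carrier N" "D x = \<zero>\<^bsub>N\<^esub>" by (simp_all add: ker_D_simps)
  have "D (divpow A (Suc k) \<odot>\<^bsub>N\<^esub> x) = divpow A k \<odot>\<^bsub>N\<^esub> x"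
    using D_smult[OF divpow_closed x(1), of "Suc k"] x
      additive_zero[OF N.additive_smult[OF divpow_closed]] N.smult_closed[OF divpow_closed x(1)]
    by (simp add: ddX_divpow_Suc)
  then show ?case using Suc by (simp add: funpow_swap1)
qed

lemma D_funpow_zero: "(D ^^ k) \<zero>\<^bsub>N\<^esub> = \<zero>\<^bsub>N\<^esub>"
  by (rule additive_zero[OF additive_funpow[OF D_additive]])

lemma D_divpow_less:
  assumes "x \<in> carrier ker_D" "k < n" shows "(D ^^ n) (divpow A k \<odot>\<^bsub>N\<^esub> x) = \<zero>\<^bsub>N\<^esub>"
proof -
  have "n = (n - Suc k) + Suc k" using assms(2) by simp
  then have "D ^^ n = (D ^^ (n - Suc k)) \<circ> (D ^^ Suc k)" by (metis funpow_add)
  then have "(D ^^ n) (divpow A k \<odot>\<^bsub>N\<^esub> x) = (D ^^ (n - Suc k)) (D ((D ^^ k) (divpow A k \<odot>\<^bsub>N\<^esub> x)))"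
    by simp
  then show ?thesis using assms(1) D_funpow_zero by (simp add: D_divpow ker_D_simps)
qed

text \<open>Applying \<open>D\<close> as often as the highest index kills all lower summands and
  leaves the top coefficient. Once that is zero, the sum is shorter.\<close>

lemma divpow_independent:
  assumes m: "\<And>k. m k \<in> carrier ker_D"
    and sum: "(\<Oplus>\<^bsub>N\<^esub>k\<in>{..<n}. divpow A k \<odot>\<^bsub>N\<^esub> m k) = \<zero>\<^bsub>N\<^esub>" and k: "k < n"
  shows "m k = \<zero>\<^bsub>N\<^esub>"
  using sum k
proof (induction n)
  case (Suc n)
  let ?u = "\<lambda>k. divpow A k \<odot>\<^bsub>N\<^esub> m k"
  have u: "?u k \<in> carrier N" for k
    using m[of k] N.smult_closed[OF divpow_closed] by (simp add: ker_D_simps)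
  note Dn = additive_funpow[OF D_additive, of n]
  have mn: "m n \<in> carrier N" using m by (simp add: ker_D_simps)
  have "(D ^^ n) (finsum N ?u {..<n}) = (\<Oplus>\<^bsub>N\<^esub>k\<in>{..<n}. (D ^^ n) (?u k))"
    using u by (intro additive_finsum[OF Dn]) auto
  also have "\<dots> = (\<Oplus>\<^bsub>N\<^esub>k\<in>{..<n}. \<zero>\<^bsub>N\<^esub>)"
    using D_divpow_less m by (intro N.M.finsum_cong') auto
  finally have lower: "(D ^^ n) (finsum N ?u {..<n}) = \<zero>\<^bsub>N\<^esub>" by simp
  have split: "finsum N ?u {..<Suc n} = ?u n \<oplus>\<^bsub>N\<^esub> finsum N ?u {..<n}"
    using u by (simp add: lessThan_Suc)
  have cl: "finsum N ?u {..<n} \<in> carrier N" using u by (intro N.M.finsum_closed) auto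
  have "(D ^^ n) (finsum N ?u {..<Suc n}) = m n"
    unfolding split using additive_add[OF Dn u cl] D_divpow[OF m] lower mn by simp
  then have n0: "m n = \<zero>\<^bsub>N\<^esub>" using Suc.prems(1) D_funpow_zero by simp
  have "?u n = \<zero>\<^bsub>N\<^esub>" using n0 additive_zero[OF N.additive_smult[OF divpow_closed]] by simp
  then have "finsum N ?u {..<n} = \<zero>\<^bsub>N\<^esub>" using Suc.prems(1) split cl by simp
  then show ?case using Suc n0 by (cases "k = n") auto
qed simp

text \<open>Stated for all large \<open>n\<close> so that two expansions have a common range.\<close>

lemma tensor_expansion:
  assumes "y \<in> carrier L.T"
  shows "\<exists>m n0. (\<forall>k. m k \<in> carrier ker_D) \<and>
     (\<forall>n\<ge>n0. y = (\<Oplus>\<^bsub>L.T\<^esub>k\<in>{..<n}. L.tens (divpow A k) (m k)))"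
  using assms
proof (induction rule: L.T_induct)
  case (tens b x)
  let ?m = "\<lambda>k. b k \<odot>\<^bsub>ker_D\<^esub> x"
  have m: "?m k \<in> carrier ker_D" for k by (rule L.L.smult_closed[OF B_closed[OF tens(1)] tens(2)])
  have "finite {i. b i \<noteq> \<zero>\<^bsub>A\<^esub>}" using tens(1) by (simp add: carrier_adjoin_even)
  then obtain n0 where n0: "\<forall>i\<in>{i. b i \<noteq> \<zero>\<^bsub>A\<^esub>}. i < n0" using finite_nat_set_iff_bounded by blast
  have "L.tens b x = (\<Oplus>\<^bsub>L.T\<^esub>k\<in>{..<n}. L.tens (divpow A k) (?m k))" if "n \<ge> n0" for n
  proof -
    have "b = (\<Oplus>\<^bsub>B\<^esub>k\<in>{..<n}. divpow A k \<otimes>\<^bsub>B\<^esub> \<iota> (b k))"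
      using n0 that by (intro divpow_expansion tens(1)) auto
    then have "L.tens b x = L.tens (\<Oplus>\<^bsub>B\<^esub>k\<in>{..<n}. divpow A k \<otimes>\<^bsub>B\<^esub> \<iota> (b k)) x" by simp
    also have "\<dots> = (\<Oplus>\<^bsub>L.T\<^esub>k\<in>{..<n}. L.tens (divpow A k \<otimes>\<^bsub>B\<^esub> \<iota> (b k)) x)"
      using divpow_closed incl_closed B_closed tens(1)
      by (intro additive_finsum[OF L.tens_additive_left[OF tens(2)]]) auto
    also have "\<dots> = (\<Oplus>\<^bsub>L.T\<^esub>k\<in>{..<n}. L.tens (divpow A k) (?m k))"
      using L.tens_balanced B_closed[OF tens(1)] tens(2) divpow_closed
        L.tens_closed[OF divpow_closed m]
      by (intro L.T.finsum_cong') (auto simp: L.balanced_def)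
    finally show ?thesis .
  qed
  then show ?case using m by (intro exI[of _ ?m] exI[of _ n0]) auto
next
  case (minus x y)
  obtain m n0 where m: "\<And>k. m k \<in> carrier ker_D"
    "\<And>n. n \<ge> n0 \<Longrightarrow> x = (\<Oplus>\<^bsub>L.T\<^esub>k\<in>{..<n}. L.tens (divpow A k) (m k))" using minus(3) by blast
  obtain m' n1 where m': "\<And>k. m' k \<in> carrier ker_D"
    "\<And>n. n \<ge> n1 \<Longrightarrow> y = (\<Oplus>\<^bsub>L.T\<^esub>k\<in>{..<n}. L.tens (divpow A k) (m' k))" using minus(4) by blast
  have tm: "L.tens (divpow A k) (m k) \<in> carrier L.T" "L.tens (divpow A k) (m' k) \<in> carrier L.T" for k
    using m(1) m'(1) L.tens_closed[OF divpow_closed] by auto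
  have "x \<ominus>\<^bsub>L.T\<^esub> y = (\<Oplus>\<^bsub>L.T\<^esub>k\<in>{..<n}. L.tens (divpow A k) (m k \<ominus>\<^bsub>ker_D\<^esub> m' k))"
    if n: "n \<ge> max n0 n1" for n
  proof -
    have "(\<Oplus>\<^bsub>L.T\<^esub>k\<in>{..<n}. L.tens (divpow A k) (m k \<ominus>\<^bsub>ker_D\<^esub> m' k))
        = (\<Oplus>\<^bsub>L.T\<^esub>k\<in>{..<n}. L.tens (divpow A k) (m k) \<oplus>\<^bsub>L.T\<^esub> \<ominus>\<^bsub>L.T\<^esub> L.tens (divpow A k) (m' k))"
      using tm m(1) m'(1)
      by (intro L.T.finsum_cong')
        (auto simp: additive_minus[OF L.tens_additive_right[OF divpow_closed]] L.T.minus_eq)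
    also have "\<dots> = (\<Oplus>\<^bsub>L.T\<^esub>k\<in>{..<n}. L.tens (divpow A k) (m k)) \<oplus>\<^bsub>L.T\<^esub>
        (\<Oplus>\<^bsub>L.T\<^esub>k\<in>{..<n}. \<ominus>\<^bsub>L.T\<^esub> L.tens (divpow A k) (m' k))"
      using tm by (intro L.T.finsum_addf) auto
    also have "(\<Oplus>\<^bsub>L.T\<^esub>k\<in>{..<n}. \<ominus>\<^bsub>L.T\<^esub> L.tens (divpow A k) (m' k))
        = \<ominus>\<^bsub>L.T\<^esub> (\<Oplus>\<^bsub>L.T\<^esub>k\<in>{..<n}. L.tens (divpow A k) (m' k))"
      using tm by (intro additive_finsum[OF additive_neg[OF additive_id[OF L.T_abelian_group]], symmetric]) auto
    finally show ?thesis using m(2)[of n] m'(2)[of n] n by (simp add: L.T.minus_eq)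
  qed
  then show ?case using m(1) m'(1)
    by (intro exI[of _ "\<lambda>k. m k \<ominus>\<^bsub>ker_D\<^esub> m' k"] exI[of _ "max n0 n1"]) auto
qed

text \<open>The isomorphism is the multiplication map b \<otimes> m \<mapsto> bm. Surjectivity comes
  from nilpotency, injectivity from the independence of divided powers over the kernel.\<close>

lemma is_lifting_ker_D: "is_lifting R A B \<iota> N ker_D"
proof -
  obtain \<psi> where \<psi>: "additive L.T N \<psi>"
    "\<And>b m. \<lbrakk>b \<in> carrier B; m \<in> carrier ker_D\<rbrakk> \<Longrightarrow> \<psi> (L.tens b m) = b \<odot>\<^bsub>N\<^esub> m"
  proof (rule L.tensor_universal[OF N.M_abelian_group])
    show "L.biadditive N (\<lambda>b m. b \<odot>\<^bsub>N\<^esub> m)"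
      unfolding L.biadditive_def
      by (intro conjI ballI additive_comp[OF ker_D_inclusion N.additive_smult] N.additive_scalar)
        (auto simp: ker_D_simps)
    show "L.balanced (\<lambda>b m. b \<odot>\<^bsub>N\<^esub> m)"
      by (simp add: L.balanced_def ker_D_simps N.smult_assoc incl_closed)
  qed blast
  have \<psi>_closed: "\<psi> y \<in> carrier N" if "y \<in> carrier L.T" for y
    by (rule additive_closed[OF \<psi>(1) that])
  have \<psi>_homog: "\<psi> y \<in> homog N (n + 0)" if y: "y \<in> homog L.T n" for y n
  proof (rule L.T_homog_hom[OF \<psi>(1) N.M_graded y])
    fix i k b m assume b: "b \<in> homog B i" and m: "m \<in> homog ker_D k"
    have "m \<in> homog N k" using m by (simp add: ker_D_simps)
    then show "\<psi> (L.tens b m) \<in> homog N (i + k + 0)"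
      using \<psi>(2)[OF B.gr.homog_closed[OF b] L.L.M.homog_closed[OF m]] N.M_homog_smult[OF b] by simp
  qed
  have \<psi>_smult: "\<psi> (b \<odot>\<^bsub>L.T\<^esub> y) = b \<odot>\<^bsub>N\<^esub> \<psi> y" if b: "b \<in> carrier B" and y: "y \<in> carrier L.T" for b y
  proof (rule L.T_hom_eqI[OF _ _ _ y])
    show "additive L.T N (\<lambda>y. \<psi> (b \<odot>\<^bsub>L.T\<^esub> y))"
      by (rule additive_comp[OF L.additive_T_smult[OF b] \<psi>(1)])
    show "additive L.T N (\<lambda>y. b \<odot>\<^bsub>N\<^esub> \<psi> y)"
      by (rule additive_comp[OF \<psi>(1) N.additive_smult[OF b]])
    fix b' m assume "b' \<in> carrier B" "m \<in> carrier ker_D"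
    then show "\<psi> (b \<odot>\<^bsub>L.T\<^esub> L.tens b' m) = b \<odot>\<^bsub>N\<^esub> \<psi> (L.tens b' m)"
      using b by (simp add: L.smult_tens \<psi>(2)) (simp add: ker_D_simps N.smult_assoc)
  qed
  have \<psi>_diff: "\<psi> (diff L.T y) = diff N (\<psi> y)" if y: "y \<in> carrier L.T" for y
  proof (rule L.T_hom_eqI[OF _ _ _ y])
    show "additive L.T N (\<lambda>y. \<psi> (diff L.T y))"
      by (rule additive_comp[OF L.additive_T_diff \<psi>(1)])
    show "additive L.T N (\<lambda>y. diff N (\<psi> y))"
      by (rule additive_comp[OF \<psi>(1) N.additive_M_diff])
    fix b m assume b: "b \<in> carrier B" and m: "m \<in> carrier ker_D"
    have cl: "diff B b \<in> carrier B" "sign_twist B b \<in> carrier B" "diff ker_D m \<in> carrier ker_D"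
      using b m B.diff_closed additive_closed[OF B.gr.additive_sign_twist] L.L.M_diff_closed by auto
    have "\<psi> (diff L.T (L.tens b m)) = (diff B b \<odot>\<^bsub>N\<^esub> m) \<oplus>\<^bsub>N\<^esub> (sign_twist B b \<odot>\<^bsub>N\<^esub> diff N m)"
      using \<psi>(2)[OF cl(1) m] \<psi>(2)[OF cl(2,3)] L.tens_closed[OF cl(1) m] L.tens_closed[OF cl(2,3)]
      by (simp add: L.diff_tens[OF b m] additive_add[OF \<psi>(1)]) (simp add: ker_D_simps)
    also have "\<dots> = diff N (\<psi> (L.tens b m))"
      using N.M_leibniz_twist[OF b, of m] m \<psi>(2)[OF b m] by (simp add: ker_D_simps)
    finally show "\<psi> (diff L.T (L.tens b m)) = diff N (\<psi> (L.tens b m))" .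
  qed
  \<comment> \<open>Preimages are found degree by degree: the inverse must preserve degrees, and
    splitting an arbitrary preimage into components would need a direct sum decomposition of the
    tensor product.\<close>
  have surj_homog: "\<exists>y. y \<in> homog L.T n \<and> \<psi> y = x"
    if "x \<in> homog N n" "(D ^^ k) x = \<zero>\<^bsub>N\<^esub>" for x n k
    using that
  proof (induction k arbitrary: x)
    case 0
    then show ?case using L.homog_T_zero additive_zero[OF \<psi>(1)] by auto
  next
    case (Suc k)
    have deg: "(D ^^ i) x \<in> homog N (n - int i * w)" for i
    proof (induction i)
      case (Suc i)
      then show ?case using D_homog[OF Suc] by (simp add: algebra_simps)
    qed (use Suc.prems in simp)
    let ?m = "(D ^^ k) x"
    have m: "?m \<in> homog ker_D (n - int k * w)" using deg Suc.prems by (simp add: ker_D_simps)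
    then have mc: "?m \<in> carrier ker_D" by (rule L.L.M.homog_closed)
    then have mN: "?m \<in> carrier N" by (simp add: ker_D_simps)
    let ?u = "divpow A k \<odot>\<^bsub>N\<^esub> ?m"
    have u: "?u \<in> homog N n" using N.M_homog_smult[OF divpow_homog deg, of k k] by simp
    have xu: "x \<in> carrier N" "?u \<in> carrier N" using Suc.prems(1) u N.M.homog_closed by auto
    \<comment> \<open>The subtracted element has the same image as \<open>x\<close> under the
      \<open>k\<close>-th power of \<open>D\<close>, so the difference needs one application of
      \<open>D\<close> less.\<close>
    have "(D ^^ k) (x \<ominus>\<^bsub>N\<^esub> ?u) = \<zero>\<^bsub>N\<^esub>"
      using additive_minus[OF additive_funpow[OF D_additive] xu] D_divpow[OF mc] mN
      by (simp add: N.M.minus_eq N.M.r_neg)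
    then obtain y where y: "y \<in> homog L.T n" "\<psi> y = x \<ominus>\<^bsub>N\<^esub> ?u"
      using Suc.IH[OF N.M.homog_minus[OF Suc.prems(1) u]] by auto
    have T: "L.tens (divpow A k) ?m \<in> homog L.T n"
      using L.tens_homog[OF divpow_homog m, of k] by simp
    have "\<psi> (y \<oplus>\<^bsub>L.T\<^esub> L.tens (divpow A k) ?m) = (x \<ominus>\<^bsub>N\<^esub> ?u) \<oplus>\<^bsub>N\<^esub> ?u"
      using additive_add[OF \<psi>(1)] subsetD[OF L.homog_T_closed] y T \<psi>(2)[OF divpow_closed mc] by simp
    also have "\<dots> = x" using xu by (simp add: N.M.minus_eq N.M.a_assoc N.M.l_neg)
    finally show ?case using L.homog_T_add[OF y(1) T] by blast
  qed
  have surj_deg: "\<exists>y. y \<in> homog L.T n \<and> \<psi> y = x" if "x \<in> homog N n" for x n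
    using surj_homog[OF that] D_nilpotent[OF N.M.homog_closed[OF that]] by blast
  have surj: "\<exists>y\<in>carrier L.T. \<psi> y = x" if "x \<in> carrier N" for x
    using that
  proof (induction x rule: N.M.homog_induct)
    case zero
    then show ?case using additive_zero[OF \<psi>(1)] by (intro bexI[of _ "\<zero>\<^bsub>L.T\<^esub>"]) auto
  next
    case (homog n x)
    then show ?case using surj_deg L.homog_T_closed by blast
  next
    case (add x x')
    then obtain y y' where "y \<in> carrier L.T" "y' \<in> carrier L.T" "\<psi> y = x" "\<psi> y' = x'" by blast
    then show ?case using additive_add[OF \<psi>(1)] by (intro bexI[of _ "y \<oplus>\<^bsub>L.T\<^esub> y'"]) auto
  qed
  have ker: "y = \<zero>\<^bsub>L.T\<^esub>" if y: "y \<in> carrier L.T" "\<psi> y = \<zero>\<^bsub>N\<^esub>" for y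
  proof -
    obtain m n where m: "\<And>k. m k \<in> carrier ker_D"
      and yn: "y = (\<Oplus>\<^bsub>L.T\<^esub>k\<in>{..<n}. L.tens (divpow A k) (m k))"
      using tensor_expansion[OF y(1)] by blast
    have tm: "L.tens (divpow A k) (m k) \<in> carrier L.T" for k
      using m L.tens_closed[OF divpow_closed] by auto
    have mN: "m k \<in> carrier N" for k using m[of k] by (simp add: ker_D_simps)
    have "\<psi> y = (\<Oplus>\<^bsub>N\<^esub>k\<in>{..<n}. \<psi> (L.tens (divpow A k) (m k)))"
      unfolding yn using tm by (intro additive_finsum[OF \<psi>(1)]) auto
    also have "\<dots> = (\<Oplus>\<^bsub>N\<^esub>k\<in>{..<n}. divpow A k \<odot>\<^bsub>N\<^esub> m k)"
      using m mN \<psi>(2) divpow_closed N.smult_closed by (intro N.M.finsum_cong') auto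
    finally have sum: "(\<Oplus>\<^bsub>N\<^esub>k\<in>{..<n}. divpow A k \<odot>\<^bsub>N\<^esub> m k) = \<zero>\<^bsub>N\<^esub>" using y(2) by simp
    have "m k = \<zero>\<^bsub>N\<^esub>" if "k < n" for k
      by (rule divpow_independent[OF m sum that])
    then have "L.tens (divpow A k) (m k) = \<zero>\<^bsub>L.T\<^esub>" if "k < n" for k
      using that additive_zero[OF L.tens_additive_right[OF divpow_closed]] by (simp add: ker_D_simps)
    then have "y = (\<Oplus>\<^bsub>L.T\<^esub>k\<in>{..<n}. \<zero>\<^bsub>L.T\<^esub>)"
      unfolding yn by (intro L.T.finsum_cong') auto
    then show ?thesis by simp
  qed
  have inj: "y = y'" if "y \<in> carrier L.T" "y' \<in> carrier L.T" "\<psi> y = \<psi> y'" for y y'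
  proof -
    have "\<psi> (y \<ominus>\<^bsub>L.T\<^esub> y') = \<zero>\<^bsub>N\<^esub>"
      using additive_minus[OF \<psi>(1)] that \<psi>_closed by (simp add: N.M.minus_eq N.M.r_neg)
    then show ?thesis using ker L.T_minus_zeroD that by simp
  qed
  \<comment> \<open>A set-theoretic inverse; each of its properties follows from the one for \<psi>
    by injectivity.\<close>
  define \<chi> where "\<chi> = inv_into (carrier L.T) \<psi>"
  have \<chi>_closed: "\<chi> x \<in> carrier L.T" and \<psi>_\<chi>: "\<psi> (\<chi> x) = x" if "x \<in> carrier N" for x
    using surj[OF that] inv_into_into[of x \<psi> "carrier L.T"] f_inv_into_f[of x \<psi> "carrier L.T"]
    unfolding \<chi>_def by (metis image_eqI)+
  have \<chi>_eqI: "\<chi> x = y" if "x \<in> carrier N" "y \<in> carrier L.T" "\<psi> y = x" for x y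
    using inj[OF \<chi>_closed[OF that(1)] that(2)] \<psi>_\<chi>[OF that(1)] that(3) by simp
  have \<chi>: "additive N L.T \<chi>"
    using N.M_abelian_group L.T_abelian_group \<chi>_closed
  proof (rule additiveI)
    fix x y assume "x \<in> carrier N" "y \<in> carrier N"
    then show "\<chi> (x \<oplus>\<^bsub>N\<^esub> y) = \<chi> x \<oplus>\<^bsub>L.T\<^esub> \<chi> y"
      using \<chi>_closed \<psi>_\<chi> additive_add[OF \<psi>(1)] by (intro \<chi>_eqI) auto
  qed
  have "restrict \<chi> (carrier N) \<in> Hom R B N L.T 0"
  proof (rule N.Hom_from_moduleI[OF \<chi>])
    fix n x assume x: "x \<in> homog N n"
    then obtain y where y: "y \<in> homog L.T n" "\<psi> y = x" using surj_deg by blast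
    then have "\<chi> x = y" using N.M.homog_closed[OF x] L.homog_T_closed by (intro \<chi>_eqI) auto
    then show "\<chi> x \<in> homog L.T (n + 0)" using y by simp
  next
    fix i b x assume "b \<in> homog B i" "x \<in> carrier N"
    then have "\<chi> (b \<odot>\<^bsub>N\<^esub> x) = b \<odot>\<^bsub>L.T\<^esub> \<chi> x"
      using B.gr.homog_closed \<chi>_closed \<psi>_\<chi> \<psi>_smult N.smult_closed additive_closed[OF L.additive_T_smult]
      by (intro \<chi>_eqI) auto
    then show "\<chi> (b \<odot>\<^bsub>N\<^esub> x) = signed L.T (0 * i) (b \<odot>\<^bsub>L.T\<^esub> \<chi> x)" by (simp add: signed_def)
  qed
  moreover have "\<chi> (diff N x) = diff L.T (\<chi> x)" if "x \<in> carrier N" for x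
    using that N.M_diff_closed \<chi>_closed \<psi>_\<chi> \<psi>_diff additive_closed[OF L.additive_T_diff]
    by (intro \<chi>_eqI) auto
  ultimately have \<chi>_hom: "restrict \<chi> (carrier N) \<in> dg_hom R B N L.T"
    using N.M_diff_closed by (simp add: dg_hom_def)
  have "restrict \<psi> (carrier L.T) \<in> Hom R B L.T N 0"
    using \<psi>_homog \<psi>_smult B.gr.homog_closed
    by (intro HomI[OF B.dg_algebra_axioms \<psi>(1) L.homog_T_closed additive_closed[OF L.additive_T_smult]])
      (auto simp: signed_def)
  then have \<psi>_hom: "restrict \<psi> (carrier L.T) \<in> dg_hom R B L.T N"
    using \<psi>_diff additive_closed[OF L.additive_T_diff] by (simp add: dg_hom_def)
  have "dg_isomorphic R B N L.T"
    unfolding dg_isomorphic_def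
  proof (intro bexI[OF _ \<chi>_hom] bexI[OF _ \<psi>_hom] conjI ballI)
    show "restrict \<psi> (carrier L.T) (restrict \<chi> (carrier N) x) = x" if "x \<in> carrier N" for x
      using that \<chi>_closed \<psi>_\<chi> by simp
    show "restrict \<chi> (carrier N) (restrict \<psi> (carrier L.T) y) = y" if "y \<in> carrier L.T" for y
      using that \<psi>_closed \<chi>_eqI by simp
  qed
  then show ?thesis using ker_D_dg_module by (simp add: is_lifting_def)
qed

end

section \<open>The derivation defined by a basis\<close>

locale free_module = dg_module R A M for R :: "'r ring" and A :: "('r, 'a) dg" and M :: "('a, 'm) dg" +
  fixes E :: "'m set"
  assumes basis: "graded_free_basis A M E"
begin

definition coef :: "'m \<Rightarrow> 'm \<Rightarrow> 'a" where
  "coef x = (THE c. c \<in> E \<rightarrow> carrier A \<and> (\<forall>e. e \<notin> E \<longrightarrow> c e = \<zero>\<^bsub>A\<^esub>) \<and> finite {e. c e \<noteq> \<zero>\<^bsub>A\<^esub>} \<and>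
        x = lin_comb M c {e. c e \<noteq> \<zero>\<^bsub>A\<^esub>})"

lemma basis_closed: "e \<in> E \<Longrightarrow> e \<in> carrier M"
  using basis M.homog_closed unfolding graded_free_basis_def by blast

lemma basis_homog: "e \<in> E \<Longrightarrow> \<exists>d. e \<in> homog M d"
  using basis unfolding graded_free_basis_def by blast

lemma coef_ex1:
  "x \<in> carrier M \<Longrightarrow> \<exists>!c. c \<in> E \<rightarrow> carrier A \<and> (\<forall>e. e \<notin> E \<longrightarrow> c e = \<zero>\<^bsub>A\<^esub>) \<and>
     finite {e. c e \<noteq> \<zero>\<^bsub>A\<^esub>} \<and> x = lin_comb M c {e. c e \<noteq> \<zero>\<^bsub>A\<^esub>}"
  using basis by (simp add: graded_free_basis_def)

lemma term_closed: "\<lbrakk>S \<subseteq> E; c \<in> S \<rightarrow> carrier A; e \<in> S\<rbrakk> \<Longrightarrow> c e \<odot>\<^bsub>M\<^esub> e \<in> carrier M"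
  using basis_closed smult_closed by blast

lemma lin_comb_closed: "\<lbrakk>S \<subseteq> E; c \<in> S \<rightarrow> carrier A\<rbrakk> \<Longrightarrow> lin_comb M c S \<in> carrier M"
  unfolding lin_comb_def using term_closed by (intro M.finsum_closed) auto

lemma smult_zero_left: "x \<in> carrier M \<Longrightarrow> \<zero>\<^bsub>A\<^esub> \<odot>\<^bsub>M\<^esub> x = \<zero>\<^bsub>M\<^esub>"
  by (rule additive_zero[OF additive_scalar])

lemma sum_support:
  assumes "finite S" "{e. c e \<noteq> \<zero>\<^bsub>A\<^esub>} \<subseteq> S" "S \<subseteq> E" "c \<in> S \<rightarrow> carrier A"
  shows "lin_comb M c {e. c e \<noteq> \<zero>\<^bsub>A\<^esub>} = lin_comb M c S"
  unfolding lin_comb_def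
proof (intro M.add.finprod_mono_neutral_cong_left assms)
  show "c e \<odot>\<^bsub>M\<^esub> e = \<zero>\<^bsub>M\<^esub>" if "e \<in> S - {e. c e \<noteq> \<zero>\<^bsub>A\<^esub>}" for e
    using that assms(3) basis_closed smult_zero_left by auto
qed (use term_closed[OF assms(3,4)] in auto)

lemma
  assumes x: "x \<in> carrier M"
  shows coef_closed: "e \<in> E \<Longrightarrow> coef x e \<in> carrier A"
    and coef_finite: "finite {e. coef x e \<noteq> \<zero>\<^bsub>A\<^esub>}"
    and coef_support: "{e. coef x e \<noteq> \<zero>\<^bsub>A\<^esub>} \<subseteq> E"
    and coef_sum: "x = lin_comb M (coef x) {e. coef x e \<noteq> \<zero>\<^bsub>A\<^esub>}"
  using theI'[OF coef_ex1[OF x]] unfolding coef_def[symmetric] by auto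

lemma coef_sum_superset:
  assumes "x \<in> carrier M" "finite S" "{e. coef x e \<noteq> \<zero>\<^bsub>A\<^esub>} \<subseteq> S" "S \<subseteq> E"
  shows "lin_comb M (coef x) S = x"
proof -
  have "coef x \<in> S \<rightarrow> carrier A" using coef_closed[OF assms(1)] assms(4) by blast
  then show ?thesis using sum_support[OF assms(2-4)] coef_sum[OF assms(1)] by simp
qed

lemma coef_lin_comb:
  assumes S: "finite S" "S \<subseteq> E" and c: "c \<in> S \<rightarrow> carrier A"
  shows "coef (lin_comb M c S) = (\<lambda>e. if e \<in> S then c e else \<zero>\<^bsub>A\<^esub>)" (is "_ = ?c")
proof -
  have supp: "{e. ?c e \<noteq> \<zero>\<^bsub>A\<^esub>} \<subseteq> S" by auto
  have cl: "?c \<in> S \<rightarrow> carrier A" "?c \<in> E \<rightarrow> carrier A" using c by auto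
  have "lin_comb M ?c S = lin_comb M c S"
    unfolding lin_comb_def using term_closed[OF S(2) c] by (intro M.finsum_cong') auto
  then have "lin_comb M c S = lin_comb M ?c {e. ?c e \<noteq> \<zero>\<^bsub>A\<^esub>}"
    using sum_support[OF S(1) supp S(2) cl(1)] by simp
  then have "?c \<in> E \<rightarrow> carrier A \<and> (\<forall>e. e \<notin> E \<longrightarrow> ?c e = \<zero>\<^bsub>A\<^esub>) \<and> finite {e. ?c e \<noteq> \<zero>\<^bsub>A\<^esub>} \<and>
      lin_comb M c S = lin_comb M ?c {e. ?c e \<noteq> \<zero>\<^bsub>A\<^esub>}"
    using cl(2) finite_subset[OF supp S(1)] S(2) by auto
  then show ?thesis
    unfolding coef_def by (rule the1_equality[OF coef_ex1[OF lin_comb_closed[OF S(2) c]]])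
qed

end

locale free_adjunction_module = even_adjunction R A w t + N: free_module R "adjoin_even A w t" N E
  for R :: "'r ring" and A :: "('r, 'a) dg" and w :: int and t :: 'a
    and N :: "(nat \<Rightarrow> 'a, 'n) dg" and E :: "'n set"
begin

text \<open>A basis identifies the underlying module with a direct sum of copies of
  \<open>B\<close>; this is $d/dX$ on each copy.\<close>

definition basis_derivation :: "'n \<Rightarrow> 'n" where
  "basis_derivation x = (\<Oplus>\<^bsub>N\<^esub>e \<in> {e. N.coef x e \<noteq> \<zero>\<^bsub>B\<^esub>}. ddX (N.coef x e) \<odot>\<^bsub>N\<^esub> e)"

text \<open>Zero coefficients are allowed in \<open>S\<close>, so sums and multiples can be computed
  over one index set although their supports may shrink.\<close>

lemma basis_derivation_lin_comb:
  assumes S: "finite S" "S \<subseteq> E" and c: "c \<in> S \<rightarrow> carrier B"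
  shows "basis_derivation (lin_comb N c S) = (\<Oplus>\<^bsub>N\<^esub>e\<in>S. ddX (c e) \<odot>\<^bsub>N\<^esub> e)"
proof -
  let ?c = "\<lambda>e. if e \<in> S then c e else \<zero>\<^bsub>B\<^esub>"
  have cl: "c e \<in> carrier B" "e \<in> carrier N" if "e \<in> S" for e
    using that S(2) c N.basis_closed by auto
  have z: "ddX \<zero>\<^bsub>B\<^esub> \<odot>\<^bsub>N\<^esub> e = \<zero>\<^bsub>N\<^esub>" if "e \<in> S" for e
    using additive_zero[OF additive_ddX] N.smult_zero_left[OF cl(2)[OF that]] by simp
  show ?thesis
    unfolding basis_derivation_def N.coef_lin_comb[OF S c]
  proof (rule N.M.add.finprod_mono_neutral_cong_left[OF S(1)])
    show "ddX (c e) \<odot>\<^bsub>N\<^esub> e = \<zero>\<^bsub>N\<^esub>" if "e \<in> S - {e. ?c e \<noteq> \<zero>\<^bsub>B\<^esub>}" for e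
      using that z by auto
    show "(\<lambda>e. ddX (c e) \<odot>\<^bsub>N\<^esub> e) \<in> S \<rightarrow> carrier N"
      using cl ddX_closed N.smult_closed by auto
  qed (auto split: if_splits)
qed

lemma basis_derivation_superset:
  assumes "x \<in> carrier N" "finite S" "{e. N.coef x e \<noteq> \<zero>\<^bsub>B\<^esub>} \<subseteq> S" "S \<subseteq> E"
  shows "basis_derivation x = (\<Oplus>\<^bsub>N\<^esub>e\<in>S. ddX (N.coef x e) \<odot>\<^bsub>N\<^esub> e)"
proof -
  have "N.coef x \<in> S \<rightarrow> carrier B" using N.coef_closed[OF assms(1)] assms(4) by blast
  then show ?thesis
    using basis_derivation_lin_comb[OF assms(2,4), of "N.coef x"] N.coef_sum_superset[OF assms] by simp
qed

lemma basis_derivation_additive: "additive N N basis_derivation"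
proof (rule additiveI[OF N.M_abelian_group N.M_abelian_group])
  fix x assume x: "x \<in> carrier N"
  then show "basis_derivation x \<in> carrier N"
    unfolding basis_derivation_def
    using N.coef_support[OF x] N.coef_closed[OF x] N.basis_closed
    by (intro N.M.finsum_closed) (auto intro!: N.smult_closed ddX_closed)
next
  fix x y assume x: "x \<in> carrier N" and y: "y \<in> carrier N"
  define S where "S = {e. N.coef x e \<noteq> \<zero>\<^bsub>B\<^esub>} \<union> {e. N.coef y e \<noteq> \<zero>\<^bsub>B\<^esub>}"
  have S: "finite S" "S \<subseteq> E" "{e. N.coef x e \<noteq> \<zero>\<^bsub>B\<^esub>} \<subseteq> S" "{e. N.coef y e \<noteq> \<zero>\<^bsub>B\<^esub>} \<subseteq> S"
    using N.coef_finite x y N.coef_support by (auto simp: S_def)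
  have cl: "N.coef x e \<in> carrier B" "N.coef y e \<in> carrier B" "e \<in> carrier N" if "e \<in> S" for e
    using that S(2) N.coef_closed x y N.basis_closed by auto
  have "x \<oplus>\<^bsub>N\<^esub> y = lin_comb N (N.coef x) S \<oplus>\<^bsub>N\<^esub> lin_comb N (N.coef y) S"
    using N.coef_sum_superset[OF x S(1,3,2)] N.coef_sum_superset[OF y S(1,4,2)] by simp
  also have "\<dots> = lin_comb N (\<lambda>e. N.coef x e \<oplus>\<^bsub>B\<^esub> N.coef y e) S"
  proof -
    have "lin_comb N (\<lambda>e. N.coef x e \<oplus>\<^bsub>B\<^esub> N.coef y e) S
        = (\<Oplus>\<^bsub>N\<^esub>e\<in>S. (N.coef x e \<odot>\<^bsub>N\<^esub> e) \<oplus>\<^bsub>N\<^esub> (N.coef y e \<odot>\<^bsub>N\<^esub> e))"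
      unfolding lin_comb_def using cl
      by (intro N.M.finsum_cong') (auto simp: N.smult_l_distr N.smult_closed)
    also have "\<dots> = lin_comb N (N.coef x) S \<oplus>\<^bsub>N\<^esub> lin_comb N (N.coef y) S"
      unfolding lin_comb_def using cl by (intro N.M.finsum_addf) (auto simp: N.smult_closed)
    finally show ?thesis ..
  qed
  finally have "basis_derivation (x \<oplus>\<^bsub>N\<^esub> y)
      = (\<Oplus>\<^bsub>N\<^esub>e\<in>S. ddX (N.coef x e \<oplus>\<^bsub>B\<^esub> N.coef y e) \<odot>\<^bsub>N\<^esub> e)"
    using basis_derivation_lin_comb[OF S(1,2), of "\<lambda>e. N.coef x e \<oplus>\<^bsub>B\<^esub> N.coef y e"] cl by auto
  also have "\<dots> = (\<Oplus>\<^bsub>N\<^esub>e\<in>S. (ddX (N.coef x e) \<odot>\<^bsub>N\<^esub> e) \<oplus>\<^bsub>N\<^esub> (ddX (N.coef y e) \<odot>\<^bsub>N\<^esub> e))"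
    using cl
    by (intro N.M.finsum_cong')
      (auto simp: additive_add[OF additive_ddX] N.smult_l_distr ddX_closed N.smult_closed)
  also have "\<dots> = basis_derivation x \<oplus>\<^bsub>N\<^esub> basis_derivation y"
    unfolding basis_derivation_superset[OF x S(1,3,2)] basis_derivation_superset[OF y S(1,4,2)]
    using cl by (intro N.M.finsum_addf) (auto simp: ddX_closed N.smult_closed)
  finally show "basis_derivation (x \<oplus>\<^bsub>N\<^esub> y) = basis_derivation x \<oplus>\<^bsub>N\<^esub> basis_derivation y" .
qed

lemmas basis_derivation_closed = additive_closed[OF basis_derivation_additive]

text \<open>The product rule of \<open>ddX\<close>, applied to each coordinate of
  \<open>x\<close>.\<close>

lemma basis_derivation_smult:
  assumes b: "b \<in> carrier B" and x: "x \<in> carrier N"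
  shows "basis_derivation (b \<odot>\<^bsub>N\<^esub> x) = (ddX b \<odot>\<^bsub>N\<^esub> x) \<oplus>\<^bsub>N\<^esub> (b \<odot>\<^bsub>N\<^esub> basis_derivation x)"
proof -
  define c where "c = N.coef x"
  define S where "S = {e. c e \<noteq> \<zero>\<^bsub>B\<^esub>}"
  have S: "finite S" "S \<subseteq> E" using N.coef_finite[OF x] N.coef_support[OF x] by (simp_all add: S_def c_def)
  have cl: "c e \<in> carrier B" "e \<in> carrier N" if "e \<in> S" for e
    using that S(2) N.coef_closed[OF x] N.basis_closed by (auto simp: c_def)
  have xs: "x = (\<Oplus>\<^bsub>N\<^esub>e\<in>S. c e \<odot>\<^bsub>N\<^esub> e)"
    using N.coef_sum[OF x] by (simp add: lin_comb_def S_def c_def)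
  have Dx: "basis_derivation x = (\<Oplus>\<^bsub>N\<^esub>e\<in>S. ddX (c e) \<odot>\<^bsub>N\<^esub> e)"
    by (simp add: basis_derivation_def S_def c_def)
  have scale: "b' \<odot>\<^bsub>N\<^esub> (\<Oplus>\<^bsub>N\<^esub>e\<in>S. d e \<odot>\<^bsub>N\<^esub> e) = (\<Oplus>\<^bsub>N\<^esub>e\<in>S. (b' \<otimes>\<^bsub>B\<^esub> d e) \<odot>\<^bsub>N\<^esub> e)"
    if "b' \<in> carrier B" "\<And>e. e \<in> S \<Longrightarrow> d e \<in> carrier B" for b' d
  proof -
    have "b' \<odot>\<^bsub>N\<^esub> (\<Oplus>\<^bsub>N\<^esub>e\<in>S. d e \<odot>\<^bsub>N\<^esub> e) = (\<Oplus>\<^bsub>N\<^esub>e\<in>S. b' \<odot>\<^bsub>N\<^esub> (d e \<odot>\<^bsub>N\<^esub> e))"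
      using that cl by (intro additive_finsum[OF N.additive_smult]) (auto simp: N.smult_closed)
    also have "\<dots> = (\<Oplus>\<^bsub>N\<^esub>e\<in>S. (b' \<otimes>\<^bsub>B\<^esub> d e) \<odot>\<^bsub>N\<^esub> e)"
      using that cl by (intro N.M.finsum_cong') (auto simp: N.smult_closed N.smult_assoc)
    finally show ?thesis .
  qed
  have "basis_derivation (b \<odot>\<^bsub>N\<^esub> x) = basis_derivation (lin_comb N (\<lambda>e. b \<otimes>\<^bsub>B\<^esub> c e) S)"
    by (subst xs) (simp add: scale[OF b cl(1)] lin_comb_def)
  also have "\<dots> = (\<Oplus>\<^bsub>N\<^esub>e\<in>S. ddX (b \<otimes>\<^bsub>B\<^esub> c e) \<odot>\<^bsub>N\<^esub> e)"
    using b cl by (intro basis_derivation_lin_comb S) auto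
  also have "\<dots> = (\<Oplus>\<^bsub>N\<^esub>e\<in>S. ((ddX b \<otimes>\<^bsub>B\<^esub> c e) \<odot>\<^bsub>N\<^esub> e) \<oplus>\<^bsub>N\<^esub> ((b \<otimes>\<^bsub>B\<^esub> ddX (c e)) \<odot>\<^bsub>N\<^esub> e))"
    using b cl
    by (intro N.M.finsum_cong') (auto simp: ddX_mult N.smult_l_distr ddX_closed N.smult_closed)
  also have "\<dots> = (\<Oplus>\<^bsub>N\<^esub>e\<in>S. (ddX b \<otimes>\<^bsub>B\<^esub> c e) \<odot>\<^bsub>N\<^esub> e) \<oplus>\<^bsub>N\<^esub> (\<Oplus>\<^bsub>N\<^esub>e\<in>S. (b \<otimes>\<^bsub>B\<^esub> ddX (c e)) \<odot>\<^bsub>N\<^esub> e)"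
    using b cl by (intro N.M.finsum_addf) (auto simp: ddX_closed N.smult_closed)
  also have "\<dots> = (ddX b \<odot>\<^bsub>N\<^esub> x) \<oplus>\<^bsub>N\<^esub> (b \<odot>\<^bsub>N\<^esub> basis_derivation x)"
  proof -
    have "ddX b \<odot>\<^bsub>N\<^esub> x = (\<Oplus>\<^bsub>N\<^esub>e\<in>S. (ddX b \<otimes>\<^bsub>B\<^esub> c e) \<odot>\<^bsub>N\<^esub> e)"
      unfolding xs by (rule scale[OF ddX_closed[OF b] cl(1)])
    moreover have "b \<odot>\<^bsub>N\<^esub> basis_derivation x = (\<Oplus>\<^bsub>N\<^esub>e\<in>S. (b \<otimes>\<^bsub>B\<^esub> ddX (c e)) \<odot>\<^bsub>N\<^esub> e)"
      unfolding Dx by (rule scale[OF b ddX_closed[OF cl(1)]])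
    ultimately show ?thesis by simp
  qed
  finally show ?thesis .
qed

lemma basis_derivation_basis:
  assumes e: "e \<in> E" shows "basis_derivation e = \<zero>\<^bsub>N\<^esub>"
proof -
  have "lin_comb N (\<lambda>_. \<one>\<^bsub>B\<^esub>) {e} = e"
    using N.basis_closed[OF e] by (simp add: lin_comb_def N.smult_one)
  then have "basis_derivation e = (\<Oplus>\<^bsub>N\<^esub>e\<in>{e}. ddX \<one>\<^bsub>B\<^esub> \<odot>\<^bsub>N\<^esub> e)"
    using basis_derivation_lin_comb[of "{e}" "\<lambda>_. \<one>\<^bsub>B\<^esub>"] e by simp
  also have "\<dots> = \<zero>\<^bsub>N\<^esub>"
    using N.smult_zero_left[OF N.basis_closed[OF e]] by (simp add: one_divpow ddX_divpow_0)
  finally show ?thesis .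
qed

text \<open>The coordinates of a homogeneous \<open>x\<close> are not known in advance to be
  homogeneous. Taking the part of degree \<open>n\<close> of the expansion fixes \<open>x\<close>
  and replaces the coordinate at \<open>e\<close> by its component of degree \<open>n - d e\<close>;
  the degree can then be read off termwise, since the derivation kills the basis.\<close>

lemma basis_derivation_homog:
  assumes x: "x \<in> homog N n" shows "basis_derivation x \<in> homog N (n - w)"
proof -
  have xc: "x \<in> carrier N" by (rule N.M.homog_closed[OF x])
  define c where "c = N.coef x"
  define S where "S = {e. c e \<noteq> \<zero>\<^bsub>B\<^esub>}"
  have S: "finite S" "S \<subseteq> E" using N.coef_finite[OF xc] N.coef_support[OF xc] by (simp_all add: S_def c_def)
  have cl: "c e \<in> carrier B" "e \<in> carrier N" if "e \<in> S" for e
    using that S(2) N.coef_closed[OF xc] N.basis_closed by (auto simp: c_def)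
  have xs: "x = (\<Oplus>\<^bsub>N\<^esub>e\<in>S. c e \<odot>\<^bsub>N\<^esub> e)"
    using N.coef_sum[OF xc] by (simp add: lin_comb_def S_def c_def)
  obtain d where d: "\<And>e. e \<in> E \<Longrightarrow> e \<in> homog N (d e)" using N.basis_homog by metis
  let ?b = "\<lambda>e. component B (c e) (n - d e)"
  have b: "?b e \<in> homog B (n - d e)" "?b e \<in> carrier B" if "e \<in> S" for e
    using B.gr.component_homog B.gr.component_closed cl that by auto
  have comp: "component N (c e \<odot>\<^bsub>N\<^esub> e) n = ?b e \<odot>\<^bsub>N\<^esub> e" if e: "e \<in> S" for e
  proof -
    have "e \<in> E" using e S by auto
    then have "component N (c e \<odot>\<^bsub>N\<^esub> e) ((n - d e) + d e) = ?b e \<odot>\<^bsub>N\<^esub> e"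
      using N.M_homog_smult d
      by (intro component_additive_homog[OF B.graded N.M_graded N.additive_scalar[OF cl(2)[OF e]] _ cl(1)[OF e]])
        auto
    then show ?thesis by simp
  qed
  have "x = component N x n" by (simp add: N.M.component_of_homog[OF x])
  also have "\<dots> = (\<Oplus>\<^bsub>N\<^esub>e\<in>S. component N (c e \<odot>\<^bsub>N\<^esub> e) n)"
    unfolding xs using cl N.smult_closed by (intro additive_finsum[OF N.M.additive_component]) auto
  also have "\<dots> = (\<Oplus>\<^bsub>N\<^esub>e\<in>S. ?b e \<odot>\<^bsub>N\<^esub> e)"
    using comp b cl N.smult_closed by (intro N.M.finsum_cong') auto
  finally have "basis_derivation x = (\<Oplus>\<^bsub>N\<^esub>e\<in>S. basis_derivation (?b e \<odot>\<^bsub>N\<^esub> e))"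
    using b cl N.smult_closed additive_finsum[OF basis_derivation_additive, of "\<lambda>e. ?b e \<odot>\<^bsub>N\<^esub> e" S] by auto
  also have "\<dots> \<in> homog N (n - w)"
  proof (rule N.M.homog_finsum)
    fix e assume e: "e \<in> S"
    then have eE: "e \<in> E" using S by auto
    have "basis_derivation (?b e \<odot>\<^bsub>N\<^esub> e) = ddX (?b e) \<odot>\<^bsub>N\<^esub> e"
      using b[OF e] cl[OF e] basis_derivation_basis[OF eE] additive_zero[OF N.additive_smult[OF b(2)[OF e]]]
      by (simp add: basis_derivation_smult ddX_closed N.smult_closed)
    also have "\<dots> \<in> homog N (n - d e - w + d e)"
      by (rule N.M_homog_smult[OF ddX_homog[OF b(1)[OF e]] d[OF eE]])
    finally show "basis_derivation (?b e \<odot>\<^bsub>N\<^esub> e) \<in> homog N (n - w)" by simp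
  qed
  finally show ?thesis .
qed

section \<open>The commutator of the basis derivation with the differential\<close>

abbreviation obstruction :: "'n \<Rightarrow> 'n" where
  "obstruction x \<equiv> diff N (basis_derivation x) \<ominus>\<^bsub>N\<^esub> basis_derivation (diff N x)"

lemma obstruction_additive: "additive N N obstruction"
  by (intro additive_diff additive_comp[OF basis_derivation_additive N.additive_M_diff]
      additive_comp[OF N.additive_M_diff basis_derivation_additive])

text \<open>The terms \<open>p\<close>, \<open>q\<close> and \<open>r\<close> occur in both products
  and cancel, which uses that \<open>ddX\<close> commutes with the differential of \<open>B\<close>.
  The survivors carry the sign expected of a linear map of odd degree.\<close>

lemma obstruction_smult:
  assumes b: "b \<in> homog B i" and x: "x \<in> carrier N"
  shows "obstruction (b \<odot>\<^bsub>N\<^esub> x) = signed N i (b \<odot>\<^bsub>N\<^esub> obstruction x)"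
proof -
  let ?D = basis_derivation
  have bc: "b \<in> carrier B" by (rule B.gr.homog_closed[OF b])
  note Dx = basis_derivation_closed[OF x] and dx = N.M_diff_closed[OF x]
  note dDx = N.M_diff_closed[OF Dx] and Ddx = basis_derivation_closed[OF dx]
  define p q r u v where "p = diff B (ddX b) \<odot>\<^bsub>N\<^esub> x" and "q = signed N i (ddX b \<odot>\<^bsub>N\<^esub> diff N x)"
    and "r = diff B b \<odot>\<^bsub>N\<^esub> ?D x" and "u = signed N i (b \<odot>\<^bsub>N\<^esub> diff N (?D x))"
    and "v = signed N i (b \<odot>\<^bsub>N\<^esub> ?D (diff N x))"
  have cl: "p \<in> carrier N" "q \<in> carrier N" "r \<in> carrier N" "u \<in> carrier N" "v \<in> carrier N"
    using bc x Dx dx dDx Ddx ddX_closed B.diff_closed N.smult_closed signed_closed[OF N.M_abelian_group]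
    by (simp_all add: p_def q_def r_def u_def v_def)
  \<comment> \<open>The scalar \<open>ddX b\<close> has degree \<open>i - w\<close>, which has the
    parity of \<open>i\<close>.\<close>
  have w: "signed N (i - w) y = signed N i y" for y using w_even by (simp add: signed_def)
  have "diff N (?D (b \<odot>\<^bsub>N\<^esub> x)) = diff N (ddX b \<odot>\<^bsub>N\<^esub> x) \<oplus>\<^bsub>N\<^esub> diff N (b \<odot>\<^bsub>N\<^esub> ?D x)"
    using bc x Dx by (simp add: basis_derivation_smult N.M_diff_add N.smult_closed ddX_closed)
  also have "\<dots> = (p \<oplus>\<^bsub>N\<^esub> q) \<oplus>\<^bsub>N\<^esub> (r \<oplus>\<^bsub>N\<^esub> u)"
    unfolding N.M_leibniz[OF b Dx] N.M_leibniz[OF ddX_homog[OF b] x] w p_def q_def r_def u_def ..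
  finally have 1: "diff N (?D (b \<odot>\<^bsub>N\<^esub> x)) = (p \<oplus>\<^bsub>N\<^esub> q) \<oplus>\<^bsub>N\<^esub> (r \<oplus>\<^bsub>N\<^esub> u)" .
  have "?D (diff N (b \<odot>\<^bsub>N\<^esub> x)) = ?D (diff B b \<odot>\<^bsub>N\<^esub> x) \<oplus>\<^bsub>N\<^esub> signed N i (?D (b \<odot>\<^bsub>N\<^esub> diff N x))"
    unfolding N.M_leibniz[OF b x] using bc x dx B.diff_closed
    by (simp add: additive_add[OF basis_derivation_additive] N.smult_closed
        additive_apply_signed[OF basis_derivation_additive] signed_closed N.M_abelian_group)
  also have "\<dots> = (p \<oplus>\<^bsub>N\<^esub> r) \<oplus>\<^bsub>N\<^esub> (q \<oplus>\<^bsub>N\<^esub> v)"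
    using bc x dx Ddx B.diff_closed
    by (simp add: basis_derivation_smult ddX_diff signed_add N.M_abelian_group N.smult_closed
        ddX_closed p_def q_def r_def v_def)
  finally have 2: "?D (diff N (b \<odot>\<^bsub>N\<^esub> x)) = (p \<oplus>\<^bsub>N\<^esub> r) \<oplus>\<^bsub>N\<^esub> (q \<oplus>\<^bsub>N\<^esub> v)" .
  have "obstruction (b \<odot>\<^bsub>N\<^esub> x) = (u \<ominus>\<^bsub>N\<^esub> v) \<oplus>\<^bsub>N\<^esub> ((p \<oplus>\<^bsub>N\<^esub> q \<oplus>\<^bsub>N\<^esub> r) \<ominus>\<^bsub>N\<^esub> (p \<oplus>\<^bsub>N\<^esub> q \<oplus>\<^bsub>N\<^esub> r))"
    unfolding 1 2 using cl by (simp add: N.M.minus_eq N.M.minus_add N.M.a_ac)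
  also have "\<dots> = u \<ominus>\<^bsub>N\<^esub> v" using cl by (simp add: N.M.minus_eq N.M.r_neg)
  also have "\<dots> = signed N i (b \<odot>\<^bsub>N\<^esub> obstruction x)"
    using additive_minus[OF additive_signed[OF N.additive_smult[OF bc]] dDx Ddx] by (simp add: u_def v_def)
  finally show ?thesis .
qed

text \<open>The degree is odd, so the cycle condition is a sum. Both of its terms reduce to the
  differential of the derivation of the differential of \<open>x\<close>, with opposite signs,
  because the differential squares to zero.\<close>

lemma obstruction_cycle:
  "restrict obstruction (carrier N) \<in> Hom_cycles R B N N (- (w + 1))"
proof -
  have "restrict obstruction (carrier N) \<in> Hom R B N N (- (w + 1))"
  proof (rule N.Hom_from_moduleI[OF obstruction_additive])
    show "obstruction x \<in> homog N (n + - (w + 1))" if x: "x \<in> homog N n" for n x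
      using N.M.homog_minus[OF N.M_diff_degree[OF basis_derivation_homog[OF x]]]
        basis_derivation_homog[OF N.M_diff_degree[OF x]] by (simp add: algebra_simps)
    show "obstruction (b \<odot>\<^bsub>N\<^esub> x) = signed N (- (w + 1) * i) (b \<odot>\<^bsub>N\<^esub> obstruction x)"
      if "b \<in> homog B i" "x \<in> carrier N" for i b x
      using obstruction_smult[OF that] w_even by (simp add: signed_def)
  qed
  moreover have "diff N (obstruction x) \<oplus>\<^bsub>N\<^esub> obstruction (diff N x) = \<zero>\<^bsub>N\<^esub>" if x: "x \<in> carrier N" for x
  proof -
    note Dx = basis_derivation_closed[OF x] and dx = N.M_diff_closed[OF x]
    note dDx = N.M_diff_closed[OF Dx] and Ddx = basis_derivation_closed[OF dx]
    show ?thesis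
      using additive_minus[OF N.additive_M_diff dDx Ddx] N.M_diff_closed[OF Ddx]
        additive_zero[OF basis_derivation_additive]
      by (simp add: N.M_diff_diff Dx x N.M.minus_eq N.M.l_neg N.M.uminus_zero)
  qed
  moreover have "obstruction x \<in> carrier N" if "x \<in> carrier N" for x
    by (rule additive_closed[OF obstruction_additive that])
  ultimately show ?thesis
    using w_even N.M_diff_closed
    by (auto simp: Hom_cycles_def Hom_diff_def signed_def N.M.minus_eq N.M.minus_minus)
qed

text \<open>Subtracting a \<open>B\<close>-linear map leaves the product rule intact, so the basis
  derivation may be corrected by any \<open>h\<close> that bounds its commutator with the
  differential.\<close>

theorem liftable_if_Ext_trivial:
  assumes bdd: "bounded_below N" and ext: "trivial_group (Ext R B N N (w + 1))"
  shows "liftable R A B \<iota> N"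
proof -
  obtain h where h: "h \<in> Hom R B N N (1 - (w + 1))"
    "restrict obstruction (carrier N) = Hom_diff N N (1 - (w + 1)) h"
    using Ext_trivialD[OF N.dg_module_axioms ext obstruction_cycle] .
  have h_add: "additive N N h" by (rule Hom_additive[OF N.M_abelian_group N.M_abelian_group h(1)])
  \<comment> \<open>Here \<open>h\<close> has degree \<open>1 - (w + 1) = - w\<close>, which is
    even, so it is linear without a sign.\<close>
  have h_smult: "h (b \<odot>\<^bsub>N\<^esub> x) = b \<odot>\<^bsub>N\<^esub> h x" if "b \<in> carrier B" "x \<in> carrier N" for b x
    using Hom_smult_even[OF N.dg_module_axioms N.dg_module_axioms h(1) _ that] w_even by simp
  define D where "D x = basis_derivation x \<ominus>\<^bsub>N\<^esub> h x" for x
  have D_add: "additive N N D"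
    unfolding D_def by (rule additive_diff[OF basis_derivation_additive h_add])
  have D_homog: "D x \<in> homog N (n - w)" if x: "x \<in> homog N n" for n x
    unfolding D_def using N.M.homog_minus[OF basis_derivation_homog[OF x]] Hom_homog[OF h(1) x] by simp
  interpret nilpotent_derivation R A w t N D
  proof (intro nilpotent_derivation.intro nilpotent_derivation_axioms.intro even_adjunction_axioms
      N.dg_module_axioms D_add D_homog)
    fix b x assume b: "b \<in> carrier B" and x: "x \<in> carrier N"
    have cl: "ddX b \<odot>\<^bsub>N\<^esub> x \<in> carrier N" "b \<odot>\<^bsub>N\<^esub> basis_derivation x \<in> carrier N" "b \<odot>\<^bsub>N\<^esub> h x \<in> carrier N"
      using b x basis_derivation_closed additive_closed[OF h_add] ddX_closed by (auto intro: N.smult_closed)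
    show "D (b \<odot>\<^bsub>N\<^esub> x) = (ddX b \<odot>\<^bsub>N\<^esub> x) \<oplus>\<^bsub>N\<^esub> (b \<odot>\<^bsub>N\<^esub> D x)"
      using cl additive_minus[OF N.additive_smult[OF b] basis_derivation_closed[OF x] additive_closed[OF h_add x]]
      by (simp add: D_def basis_derivation_smult[OF b x] h_smult[OF b x] N.M.minus_eq N.M.a_assoc)
  next
    fix x assume x: "x \<in> carrier N"
    let ?dD = "diff N (basis_derivation x)" and ?Dd = "basis_derivation (diff N x)"
      and ?dh = "diff N (h x)" and ?hd = "h (diff N x)"
    have cl: "?dD \<in> carrier N" "?Dd \<in> carrier N" "?dh \<in> carrier N" "?hd \<in> carrier N"
      using x N.M_diff_closed basis_derivation_closed additive_closed[OF h_add] by auto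
    have "obstruction x = ?dh \<ominus>\<^bsub>N\<^esub> ?hd"
      using fun_cong[OF h(2), of x] x w_even by (simp add: Hom_diff_def signed_def)
    then have "?dD = (?dh \<ominus>\<^bsub>N\<^esub> ?hd) \<oplus>\<^bsub>N\<^esub> ?Dd"
      using cl by (metis N.M.minus_eq N.M.a_assoc N.M.l_neg N.M.r_zero N.M.a_inv_closed)
    then have "diff N (D x) = ((?dh \<ominus>\<^bsub>N\<^esub> ?hd) \<oplus>\<^bsub>N\<^esub> ?Dd) \<ominus>\<^bsub>N\<^esub> ?dh"
      using additive_minus[OF N.additive_M_diff basis_derivation_closed[OF x] additive_closed[OF h_add x]]
      by (simp add: D_def)
    also have "\<dots> = (?Dd \<ominus>\<^bsub>N\<^esub> ?hd) \<oplus>\<^bsub>N\<^esub> (?dh \<ominus>\<^bsub>N\<^esub> ?dh)"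
      using cl by (simp add: N.M.minus_eq N.M.a_ac)
    also have "\<dots> = D (diff N x)" using cl by (simp add: D_def N.M.minus_eq N.M.r_neg)
    finally show "D (diff N x) = diff N (D x)" ..
  next
    obtain k where k: "\<And>i. i \<ge> k \<Longrightarrow> homog N (- i) = {\<zero>\<^bsub>N\<^esub>}"
      using bdd by (auto simp: bounded_below_def)
    fix x assume "x \<in> carrier N"
    then show "\<exists>m. (D ^^ m) x = \<zero>\<^bsub>N\<^esub>"
    proof (induction x rule: N.M.homog_induct)
      case zero
      show ?case by (rule exI[of _ 0]) simp
    next
      case (homog n x)
      have deg: "(D ^^ m) x \<in> homog N (n - int m * w)" for m
      proof (induction m)
        case (Suc m)
        then show ?case using D_homog[OF Suc] by (simp add: algebra_simps)
      qed (use homog in simp)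
      \<comment> \<open>Since \<open>w\<close> is at least 1, after \<open>n + k\<close>
        applications of \<open>D\<close> the degree is at most \<open>- k\<close>, where
        \<open>N\<close> vanishes; \<open>nat\<close> covers the case that \<open>n + k\<close> is
        negative.\<close>
      define m where "m = nat (n + k)"
      have "int m * 1 \<le> int m * w" using w_pos by (intro mult_left_mono) auto
      moreover have "n + k \<le> int m" by (simp add: m_def)
      ultimately have "homog N (- (int m * w - n)) = {\<zero>\<^bsub>N\<^esub>}" by (intro k) linarith
      then show ?case using deg[of m] by (intro exI[of _ m]) simp
    next
      case (add y z)
      then obtain m m' where m: "(D ^^ m) y = \<zero>\<^bsub>N\<^esub>" "(D ^^ m') z = \<zero>\<^bsub>N\<^esub>" by blast
      note p = additive_funpow[OF D_add]
      have "(D ^^ (m' + m)) y = \<zero>\<^bsub>N\<^esub>" "(D ^^ (m + m')) z = \<zero>\<^bsub>N\<^esub>"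
        using m additive_zero[OF p] by (simp_all add: funpow_add)
      then have "(D ^^ (m + m')) (y \<oplus>\<^bsub>N\<^esub> z) = \<zero>\<^bsub>N\<^esub>"
        using additive_add[OF p add(1,2)] by (simp add: add.commute)
      then show ?case by blast
    qed
  qed
  show ?thesis
    unfolding liftable_def using is_lifting_ker_D by blast
qed

end

theorem mainTheorem1:
  fixes R :: "'r ring" and A :: "('r, 'a) dg" and B :: "('r, nat \<Rightarrow> 'a) dg"
    and w :: int and t :: 'a and \<iota> :: "'a \<Rightarrow> (nat \<Rightarrow> 'a)"
    and N :: "(nat \<Rightarrow> 'a, 'n) dg"
  assumes "dg_algebra R A"
    and "w > 0" and "even w"
    and "t \<in> homog A (w - 1)" and "diff A t = \<zero>\<^bsub>A\<^esub>"
    and "B = adjoin_even A w t" and "\<iota> = adjoin_incl A"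
    and "dg_module R B N" and "semi_free B N"
  shows "(bounded_below N \<and> trivial_group (Ext R B N N (w + 1)) \<longrightarrow> liftable R A B \<iota> N) \<and>
         (liftable R A B \<iota> N \<and> trivial_group (Ext R B N N w) \<longrightarrow>
            (\<forall>(M :: ('a, 'm) dg) (M' :: ('a, 'l) dg).
               is_lifting R A B \<iota> N M \<and> is_lifting R A B \<iota> N M' \<longrightarrow> dg_isomorphic R A M M'))"
proof -
  have N: "dg_module R (adjoin_even A w t) N" using assms by simp
  interpret even_adjunction R A w t
    using assms(1-5) dg_module.axioms(1)[OF N]
    by (intro even_adjunction.intro even_adjunction_axioms.intro)
  \<comment> \<open>The union of the levels of the semi-free basis, taken as one graded
    basis.\<close>
  obtain E where "graded_free_basis (adjoin_even A w t) N E"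
    using assms unfolding semi_free_def by blast
  then interpret free_adjunction_module R A w t N E
    by (intro free_adjunction_module.intro free_module.intro free_module_axioms.intro
        even_adjunction_axioms N)
  show ?thesis
    unfolding assms(6,7) using liftable_if_Ext_trivial lifting_unique[OF N] by blast
qed

end
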